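(* Every subcubic outerplanar graph $G$ has a packing $(1,1,2,4)$-coloring $f: V(G)\to\{1_a,1_b,2,4\}$ such that: (A) color $4$ is used at most once within each block of $G$; (B) if $v$ is a vertex of $G$ of degree at most $2$ and $f(v)=2$, then there is no vertex of color $4$ within distance two from $v$.
   Context: A graph is subcubic if its maximum degree is at most $3$. For a non-decreasing sequence $S=(s_1,\dots,s_k)$ of positive integers, a packing $S$-coloring of a graph $G$ is a partition of $V(G)$ into sets $V_1,\dots,V_k$ (some possibly empty) such that, for each $1\le i\le k$, the distance in $G$ between any two distinct vertices $x,y\in V_i$ is at least $s_i+1$. For $S=(1,1,2,4)$ the four colors are denoted $1_a,1_b,2,4$: two distinct vertices of the same color $1_a$ (or of the same color $1_b$) are at distance at least $2$, two distinct vertices of color $2$ are at distance at least $3$, and two distinct vertices of color $4$ are at distance at least $5$. A block of a graph $G$ is an inclusion-maximal subgraph with no cut vertices (of its own). *)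

theory Defs
  imports "HOL-Analysis.Analysis" "HOL-Library.Extended_Nat"
begin

text \<open>Finite simple graphs, given by a vertex set and a set of two-element edges.\<close>

definition simple_graph :: "'a set \<Rightarrow> 'a set set \<Rightarrow> bool" where
  "simple_graph V E \<longleftrightarrow> finite V \<and> (\<forall>e\<in>E. e \<subseteq> V \<and> card e = 2)"

definition vdegree :: "'a set set \<Rightarrow> 'a \<Rightarrow> nat" where
  "vdegree E v = card {e \<in> E. v \<in> e}"

definition subcubic :: "'a set \<Rightarrow> 'a set set \<Rightarrow> bool" where
  "subcubic V E \<longleftrightarrow> (\<forall>v\<in>V. vdegree E v \<le> 3)"

definition walk_betw :: "'a set \<Rightarrow> 'a set set \<Rightarrow> 'a \<Rightarrow> 'a list \<Rightarrow> 'a \<Rightarrow> bool" where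
  "walk_betw V E u xs v \<longleftrightarrow>
     xs \<noteq> [] \<and> hd xs = u \<and> last xs = v \<and> set xs \<subseteq> V \<and> successively (\<lambda>x y. {x, y} \<in> E) xs"

text \<open>The list of vertices of a walk with \<open>n\<close> edges has length \<open>n + 1\<close>. Since \<open>Inf {} = \<infinity>\<close>,
  vertices in different components are at distance \<open>\<infinity>\<close>.\<close>

definition gdist :: "'a set \<Rightarrow> 'a set set \<Rightarrow> 'a \<Rightarrow> 'a \<Rightarrow> enat" where
  "gdist V E u v = Inf {enat (length xs - 1) | xs. walk_betw V E u xs v}"

definition reachable_in :: "'a set \<Rightarrow> 'a set set \<Rightarrow> 'a \<Rightarrow> 'a \<Rightarrow> bool" where
  "reachable_in V E u v \<longleftrightarrow> (\<exists>xs. walk_betw V E u xs v)"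

definition connected_graph :: "'a set \<Rightarrow> 'a set set \<Rightarrow> bool" where
  "connected_graph V E \<longleftrightarrow> V \<noteq> {} \<and> (\<forall>u\<in>V. \<forall>v\<in>V. reachable_in V E u v)"

text \<open>A cut vertex separates two other vertices of its component.\<close>

definition cut_vertex :: "'a set \<Rightarrow> 'a set set \<Rightarrow> 'a \<Rightarrow> bool" where
  "cut_vertex V E c \<longleftrightarrow> c \<in> V \<and>
     (\<exists>u\<in>V - {c}. \<exists>v\<in>V - {c}. reachable_in V E u v \<and>
        \<not> reachable_in (V - {c}) {e \<in> E. c \<notin> e} u v)"

definition subgraph :: "'a set \<Rightarrow> 'a set set \<Rightarrow> 'a set \<Rightarrow> 'a set set \<Rightarrow> bool" where
  "subgraph W F V E \<longleftrightarrow> simple_graph W F \<and> W \<subseteq> V \<and> F \<subseteq> E"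

definition nonseparable :: "'a set \<Rightarrow> 'a set set \<Rightarrow> bool" where
  "nonseparable W F \<longleftrightarrow> connected_graph W F \<and> (\<forall>c. \<not> cut_vertex W F c)"

text \<open>As usual, the maximality is among connected subgraphs; isolated vertices and bridges
  (with their ends) are blocks.\<close>

definition block :: "'a set \<Rightarrow> 'a set set \<Rightarrow> 'a set \<Rightarrow> 'a set set \<Rightarrow> bool" where
  "block V E W F \<longleftrightarrow> subgraph W F V E \<and> nonseparable W F \<and>
     (\<forall>W' F'. subgraph W' F' V E \<and> nonseparable W' F' \<and> W \<subseteq> W' \<and> F \<subseteq> F'
        \<longrightarrow> W' = W \<and> F' = F)"

text \<open>Crossing-free drawings in the plane: vertex \<open>v\<close> is the point \<open>p v\<close>, edge \<open>e\<close> is the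
  simple arc \<open>\<gamma> e\<close>, traversed in either direction.\<close>

definition plane_drawing ::
    "'a set \<Rightarrow> 'a set set \<Rightarrow> ('a \<Rightarrow> complex) \<Rightarrow> ('a set \<Rightarrow> real \<Rightarrow> complex) \<Rightarrow> bool" where
  "plane_drawing V E p \<gamma> \<longleftrightarrow>
     inj_on p V \<and>
     (\<forall>e\<in>E. arc (\<gamma> e) \<and> {pathstart (\<gamma> e), pathfinish (\<gamma> e)} = p ` e \<and>
            path_image (\<gamma> e) \<inter> p ` V = p ` e) \<and>
     (\<forall>e\<in>E. \<forall>e'\<in>E. e \<noteq> e' \<longrightarrow> path_image (\<gamma> e) \<inter> path_image (\<gamma> e') \<subseteq> p ` (e \<inter> e'))"

definition drawing_set ::
    "'a set \<Rightarrow> 'a set set \<Rightarrow> ('a \<Rightarrow> complex) \<Rightarrow> ('a set \<Rightarrow> real \<Rightarrow> complex) \<Rightarrow> complex set" where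
  "drawing_set V E p \<gamma> = p ` V \<union> (\<Union>e\<in>E. path_image (\<gamma> e))"

text \<open>The drawing of a finite graph is compact, so \<open>outside\<close> yields its unique unbounded face;
  all vertices have to lie on the boundary of that face.\<close>

definition outerplanar :: "'a set \<Rightarrow> 'a set set \<Rightarrow> bool" where
  "outerplanar V E \<longleftrightarrow> (\<exists>p \<gamma>. plane_drawing V E p \<gamma> \<and>
     (\<forall>v\<in>V. p v \<in> frontier (outside (drawing_set V E p \<gamma>))))"

text \<open>The sequence \<open>S\<close> is a function \<open>s\<close> on the colors (the indices of \<open>S\<close>), and the classes
  of the partition are the preimages of the colors under \<open>f\<close>.\<close>

definition packing_coloring ::
    "'a set \<Rightarrow> 'a set set \<Rightarrow> ('c \<Rightarrow> nat) \<Rightarrow> ('a \<Rightarrow> 'c) \<Rightarrow> bool" where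
  "packing_coloring V E s f \<longleftrightarrow>
     (\<forall>x\<in>V. \<forall>y\<in>V. x \<noteq> y \<and> f x = f y \<longrightarrow> gdist V E x y \<ge> enat (s (f x) + 1))"

datatype color = Color1a | Color1b | Color2 | Color4

fun seq1124 :: "color \<Rightarrow> nat" where
  "seq1124 Color1a = 1"
| "seq1124 Color1b = 1"
| "seq1124 Color2 = 2"
| "seq1124 Color4 = 4"

end

(* Idea.  By the theta-curve theorem, transported by an inversion when the arcs lie outside of each
   other, an outerplanar graph contains neither three paths with inner vertices between two
   vertices nor a subdivided K4.  Take a least nonempty vertex set S left by at most one edge: it
   induces a bridgeless subcubic graph, hence a single vertex or a Hamiltonian cycle with a
   noncrossing matching of chords.  Color the rest by induction, and then S with root v, the end of
   the edge uv leaving S.  If u has color 1, v gets the other color 1 and color 4 stays at distance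
   at least 3 from v; if u has color 2, v gets a color 1 and no neighbor of v has color 2; if u has
   color 4, no 4 is used on S.  That these colorings of S exist follows from a finite computation: to
   a stretch of the cycle left by no chord belongs the set of all color states at its two ends that
   some coloring realizes, and always one of twelve such sets occurs, up to weakening.  The induction
   claims (A) for all nonseparable subgraphs, which passes to induced subgraphs. *)
theory Submission imports Defs begin

section \<open>Theta curves and the outer face\<close>

text \<open>The obstacle is range: color 4 reaches over distance four and so across a bridge,
  whereas a finite computation can only remember what is near the two ends of a segment. Inside a
  bridgeless piece (A) removes the problem: 4 occurs at most once there, and all other constraints,
  (B) included, have range two, so that the color of an end and a summary of the colors next to it
  suffice. Across a bridge (B) removes it. Before the attachment, \<open>u\<close> is recolored with
  1a or 1b if one of them is missing among its neighbors. Otherwise \<open>u\<close> has exactly two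
  neighbors in the rest, colored 1a and 1b. If \<open>u\<close> then has color 2, (B) for the rest
  keeps every 4 there at distance at least three from \<open>u\<close>, hence at least five from
  every 4 in the new piece, since \<open>v\<close> is not colored 4; and the bridge gives
  \<open>u\<close> degree three, so that (B) no longer speaks about \<open>u\<close>. This is why
  (B) has to be carried through the induction. In the theta configuration each path needs an inner
  vertex, because only vertices are known to lie on the outer face; so chords of a cycle are not
  excluded, only detours.\<close>

definition arc_between :: "complex set \<Rightarrow> complex \<Rightarrow> complex \<Rightarrow> bool" where
  "arc_between S a b \<longleftrightarrow> (\<exists>g. arc g \<and> path_image g = S \<and> pathstart g = a \<and> pathfinish g = b)"

lemma arc_between_commute: "arc_between S a b \<Longrightarrow> arc_between S b a"
  unfolding arc_between_def by (metis arc_reversepath path_image_reversepath pathstart_reversepath pathfinish_reversepath)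

lemma arc_between_join:
  assumes "arc_between S a b" "arc_between T b c" "S \<inter> T \<subseteq> {b}"
  shows "arc_between (S \<union> T) a c"
proof -
  from assms(1) obtain g where g: "arc g" "path_image g = S" "pathstart g = a" "pathfinish g = b"
    unfolding arc_between_def by blast
  from assms(2) obtain h where h: "arc h" "path_image h = T" "pathstart h = b" "pathfinish h = c"
    unfolding arc_between_def by blast
  have "arc (g +++ h)" by (rule arc_join) (use g h assms(3) in auto)
  moreover have "path_image (g +++ h) = S \<union> T" using g h by (simp add: path_image_join)
  ultimately show ?thesis unfolding arc_between_def using g h by (metis pathstart_join pathfinish_join)
qed

lemma arc_between_ends: "arc_between S a b \<Longrightarrow> a \<in> S \<and> b \<in> S \<and> a \<noteq> b"
  unfolding arc_between_def by (auto simp: arc_simple_path)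

lemma arc_between_compact: "arc_between S a b \<Longrightarrow> compact S"
  unfolding arc_between_def by (auto simp: compact_arc_image)

lemma arc_between_image:
  assumes "arc_between S a b" "continuous_on S f" "inj_on f S"
  shows "arc_between (f ` S) (f a) (f b)"
proof -
  from assms(1) obtain g where g: "arc g" "path_image g = S" "pathstart g = a" "pathfinish g = b"
    unfolding arc_between_def by blast
  have "path (f \<circ> g)" using assms(2) g by (intro path_continuous_image) (auto simp: arc_def)
  moreover have "inj_on (f \<circ> g) {0..1}"
    using assms(3) g by (intro comp_inj_on) (auto simp: arc_def path_image_def)
  ultimately have "arc (f \<circ> g)" by (simp add: arc_def)
  then show ?thesis unfolding arc_between_def
    using g by (intro exI[of _ "f \<circ> g"]) (auto simp: path_image_compose pathstart_compose pathfinish_compose)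
qed

lemma loop_inside_outside:
  assumes "arc_between S a b" "arc_between T a b" "S \<inter> T \<subseteq> {a, b}"
  shows "inside (S \<union> T) \<noteq> {}" "open (inside (S \<union> T))" "connected (inside (S \<union> T))"
    "open (outside (S \<union> T))" "connected (outside (S \<union> T))"
    "bounded (inside (S \<union> T))" "\<not> bounded (outside (S \<union> T))"
    "inside (S \<union> T) \<union> outside (S \<union> T) = - (S \<union> T)"
    "frontier (inside (S \<union> T)) = S \<union> T"
proof -
  from assms(1) obtain g where g: "arc g" "path_image g = S" "pathstart g = a" "pathfinish g = b"
    unfolding arc_between_def by blast
  from arc_between_commute[OF assms(2)] obtain h where h: "arc h" "path_image h = T" "pathstart h = b" "pathfinish h = a"
    unfolding arc_between_def by blast
  have "simple_path (g +++ h)" by (rule simple_path_join_loop) (use g h assms(3) in auto)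
  moreover have "path_image (g +++ h) = S \<union> T" using g h by (simp add: path_image_join)
  ultimately have "inside(S \<union> T) \<noteq> {} \<and> open(inside(S \<union> T)) \<and> connected(inside(S \<union> T)) \<and>
          outside(S \<union> T) \<noteq> {} \<and> open(outside(S \<union> T)) \<and> connected(outside(S \<union> T)) \<and>
          bounded(inside(S \<union> T)) \<and> \<not> bounded(outside(S \<union> T)) \<and>
          inside(S \<union> T) \<inter> outside(S \<union> T) = {} \<and> inside(S \<union> T) \<union> outside(S \<union> T) = - (S \<union> T) \<and>
          frontier(inside(S \<union> T)) = S \<union> T \<and> frontier(outside(S \<union> T)) = S \<union> T"
    using Jordan_inside_outside[of "g +++ h"] g h by simp
  then show "inside (S \<union> T) \<noteq> {}" "open (inside (S \<union> T))" "connected (inside (S \<union> T))"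
    "open (outside (S \<union> T))" "connected (outside (S \<union> T))"
    "bounded (inside (S \<union> T))" "\<not> bounded (outside (S \<union> T))"
    "inside (S \<union> T) \<union> outside (S \<union> T) = - (S \<union> T)"
    "frontier (inside (S \<union> T)) = S \<union> T" by blast+
qed

definition theta :: "complex set \<Rightarrow> complex set \<Rightarrow> complex set \<Rightarrow> complex \<Rightarrow> complex \<Rightarrow> bool" where
  "theta A B C a b \<longleftrightarrow> arc_between A a b \<and> arc_between B a b \<and> arc_between C a b \<and>
     A \<inter> B \<subseteq> {a, b} \<and> A \<inter> C \<subseteq> {a, b} \<and> B \<inter> C \<subseteq> {a, b}"

text \<open>The theta-curve theorem of the library, \<open>split_inside_simple_closed_curve\<close>,
  freed from parametrizations: an arc that enters the inside of the loop cuts it in two.\<close>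

lemma theta_split:
  assumes "theta A B C a b" "C \<inter> inside (A \<union> B) \<noteq> {}"
  shows "inside (A \<union> C) \<inter> inside (B \<union> C) = {}"
    "inside (A \<union> C) \<union> inside (B \<union> C) \<union> (C - {a, b}) = inside (A \<union> B)"
proof -
  from assms(1) have arcs: "arc_between A a b" "arc_between B a b" "arc_between C a b"
    and int: "A \<inter> B \<subseteq> {a, b}" "A \<inter> C \<subseteq> {a, b}" "B \<inter> C \<subseteq> {a, b}" by (auto simp: theta_def)
  note ends = arc_between_ends[OF arcs(1)] arc_between_ends[OF arcs(2)] arc_between_ends[OF arcs(3)]
  obtain f g h where *: "arc f" "path_image f = A" "pathstart f = a" "pathfinish f = b"
      "arc g" "path_image g = B" "pathstart g = a" "pathfinish g = b"
      "arc h" "path_image h = C" "pathstart h = a" "pathfinish h = b"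
    using arcs unfolding arc_between_def by metis
  show "inside (A \<union> C) \<inter> inside (B \<union> C) = {}"
    "inside (A \<union> C) \<union> inside (B \<union> C) \<union> (C - {a, b}) = inside (A \<union> B)"
    using split_inside_simple_closed_curve[of f a b g h] * ends int assms(2)
    by (auto simp: arc_imp_simple_path)
qed

lemma theta_swap: "theta A B C a b \<Longrightarrow> theta B A C a b"
  by (auto simp: theta_def)

text \<open>Once the third arc runs inside the loop formed by the other two, it splits that inside into two
  parts, and a connected set living there can only touch one of the two outer arcs.\<close>

lemma theta_inner:
  assumes th: "theta A B C a b" and C: "C \<inter> inside (A \<union> B) \<noteq> {}"
    and T: "connected T" "T \<inter> (A \<union> B \<union> C) = {}" "T \<inter> inside (A \<union> B) \<noteq> {}"
  shows "(A - {a, b}) \<inter> closure T = {} \<or> (B - {a, b}) \<inter> closure T = {}"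
proof -
  \<comment> \<open>A connected set that misses \<open>A \<union> C\<close> and meets its inside
    stays there, so its closure lies in that inside or on \<open>A \<union> C\<close>. The inside of
    \<open>A \<union> C\<close> is part of the inside of \<open>A \<union> B\<close> and therefore
    misses \<open>B\<close>.\<close>
  have half: "(B - {a, b}) \<inter> closure T = {}"
    if th: "theta A B C a b" and C: "C \<inter> inside (A \<union> B) \<noteq> {}"
    and T: "T \<inter> (A \<union> B \<union> C) = {}" "T \<inter> inside (A \<union> C) \<noteq> {}" for A B
  proof -
    from th have loop: "arc_between A a b" "arc_between C a b" "A \<inter> C \<subseteq> {a, b}" "B \<inter> C \<subseteq> {a, b}" "A \<inter> B \<subseteq> {a, b}"
      by (auto simp: theta_def)
    note J = loop_inside_outside[OF loop(1-3)]
    have "T \<subseteq> inside (A \<union> C)"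
      using connected_Int_frontier[OF \<open>connected T\<close> T(2)] T(1) J(9) by blast
    then have cl: "closure T \<subseteq> inside (A \<union> C) \<union> (A \<union> C)"
      using closure_mono closure_Un_frontier[of "inside (A \<union> C)"] J(9) by metis
    have "inside (A \<union> C) \<subseteq> inside (A \<union> B)" using theta_split[OF th C] by blast
    then have "B \<inter> inside (A \<union> C) = {}" using inside_no_overlap[of "A \<union> B"] by blast
    then show ?thesis using cl loop by blast
  qed
  have "T \<inter> inside (A \<union> C) \<noteq> {} \<or> T \<inter> inside (B \<union> C) \<noteq> {}"
    using theta_split(2)[OF th C] T(2,3) by blast
  then show ?thesis
  proof
    assume "T \<inter> inside (A \<union> C) \<noteq> {}"
    then show ?thesis using half[OF th C T(2)] by blast
  next
    assume "T \<inter> inside (B \<union> C) \<noteq> {}"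
    then show ?thesis using half[OF theta_swap[OF th]] C T(2) by (simp add: Un_commute Un_left_commute)
  qed
qed

text \<open>The image of the outside is connected and misses the image loop, so otherwise it would
  lie outside of that loop. The image of the punctured inside is connected as well and unbounded
  near \<open>z0\<close>, so it would lie there, too. Then only \<open>0\<close>, the one value not
  taken away from \<open>z0\<close>, could be inside the image loop, whose inside is however open
  and nonempty.\<close>

lemma inversion_outside:
  fixes z0 :: complex
  assumes loop: "arc_between A a b" "arc_between B a b" "A \<inter> B \<subseteq> {a, b}" and z0: "z0 \<in> inside (A \<union> B)"
  defines "f \<equiv> \<lambda>z. inverse (z - z0)"
  shows "f ` outside (A \<union> B) \<subseteq> inside (f ` A \<union> f ` B)"
proof -
  note J = loop_inside_outside[OF loop]
  let ?L = "A \<union> B" and ?L' = "f ` A \<union> f ` B"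
  have z0': "z0 \<notin> ?L" "z0 \<notin> outside ?L" using z0 inside_no_overlap[of ?L] inside_Int_outside[of ?L] by blast+
  \<comment> \<open>Injective on the whole plane, since \<open>inverse 0 = 0\<close> gives
    \<open>f z0 = 0\<close>; only continuity fails at \<open>z0\<close>.\<close>
  have inj: "inj f" by (auto simp: f_def inj_on_def)
  have cont: "continuous_on S f" if "z0 \<notin> S" for S
    unfolding f_def by (intro continuous_intros) (use that in auto)
  have loop': "arc_between (f ` A) (f a) (f b)" "arc_between (f ` B) (f a) (f b)" "f ` A \<inter> f ` B \<subseteq> {f a, f b}"
  proof -
    show "arc_between (f ` A) (f a) (f b)" "arc_between (f ` B) (f a) (f b)"
      using loop cont z0' inj by (auto intro!: arc_between_image intro: inj_on_subset)
    show "f ` A \<inter> f ` B \<subseteq> {f a, f b}" using loop(3) inj by (auto dest: injD)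
  qed
  note J' = loop_inside_outside[OF loop']
  have co: "connected (f ` outside ?L)"
    by (rule connected_continuous_image[OF cont J(5)]) (use z0' in auto)
  have ci: "connected (f ` (inside ?L - {z0}))"
    by (rule connected_continuous_image[OF cont connected_open_delete[OF J(2,3)]]) auto
  have disj: "f ` outside ?L \<inter> ?L' = {}" "f ` (inside ?L - {z0}) \<inter> ?L' = {}"
  proof -
    have "(inside ?L - {z0}) \<inter> ?L = {}" using inside_no_overlap[of ?L] by blast
    then show "f ` outside ?L \<inter> ?L' = {}" "f ` (inside ?L - {z0}) \<inter> ?L' = {}"
      by (simp_all add: image_Un[symmetric] image_Int[OF inj, symmetric])
  qed
  have side: "T \<subseteq> outside ?L'" if "connected T" "T \<inter> ?L' = {}" "T \<inter> outside ?L' \<noteq> {}" for T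
  proof -
    have "T \<subseteq> inside ?L' \<union> outside ?L'" using J'(8) that(2) by blast
    moreover have "inside ?L' \<inter> outside ?L' \<inter> T = {}" by simp
    ultimately have "inside ?L' \<inter> T = {}"
      using connectedD[OF that(1) J'(2) J'(4)] that(3) by (metis inf_commute)
    then show ?thesis using J'(8) that(2) by blast
  qed
  show ?thesis
  proof (rule ccontr)
    assume "\<not> ?thesis"
    moreover have sides: "X \<subseteq> inside ?L' \<or> X \<inter> outside ?L' \<noteq> {}" if "X \<inter> ?L' = {}" for X
      using J'(8) that by blast
    ultimately have "f ` outside ?L \<inter> outside ?L' \<noteq> {}" using disj(1) by metis
    then have out: "f ` outside ?L \<subseteq> outside ?L'" by (rule side[OF co disj(1)])
    obtain r where r: "r > 0" "ball z0 r \<subseteq> inside ?L" using J(2) z0 openE by blast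
    have "\<not> bounded (f ` (inside ?L - {z0}))"
    proof
      assume "bounded (f ` (inside ?L - {z0}))"
      then obtain K where K: "K > 0" "\<And>z. z \<in> inside ?L - {z0} \<Longrightarrow> norm (f z) \<le> K"
        unfolding bounded_pos by blast
      \<comment> \<open>Small enough for \<open>z0 + e\<close> to stay in the ball and for
        \<open>1 / e\<close>, the norm of its image, to exceed \<open>K\<close>.\<close>
      define e where "e = min (r / 2) (1 / (2 * K))"
      have e: "0 < e" "e < r" "e * K < 1" using r K by (auto simp: e_def min_def field_simps)
      let ?z = "z0 + of_real e"
      have "?z \<in> inside ?L - {z0}" using r e by (auto simp: dist_norm)
      then have "norm (f ?z) \<le> K" using K by blast
      then have "1 / e \<le> K" using e by (simp add: f_def norm_inverse inverse_eq_divide norm_divide)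
      then show False using e by (simp add: field_simps)
    qed
    then have "\<not> f ` (inside ?L - {z0}) \<subseteq> inside ?L'" using J'(6) bounded_subset by blast
    then have "f ` (inside ?L - {z0}) \<inter> outside ?L' \<noteq> {}" using sides[OF disj(2)] by metis
    then have ins: "f ` (inside ?L - {z0}) \<subseteq> outside ?L'" by (rule side[OF ci disj(2)])
    have "inside ?L' \<subseteq> {0}"
    proof
      fix w assume w: "w \<in> inside ?L'"
      show "w \<in> {0}"
      proof (rule ccontr)
        assume "w \<notin> {0}"
        then have fw: "f (z0 + inverse w) = w" and nz: "z0 + inverse w \<noteq> z0" by (auto simp: f_def)
        have "z0 + inverse w \<notin> ?L" using w fw inside_no_overlap[of ?L'] by (metis IntI Un_iff empty_iff image_eqI)
        then have "z0 + inverse w \<in> inside ?L - {z0} \<or> z0 + inverse w \<in> outside ?L" using J(8) nz by blast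
        then have "w \<in> outside ?L'" using ins out fw by (metis image_eqI subsetD)
        then show False using w inside_Int_outside[of ?L'] by blast
      qed
    qed
    then have "inside ?L' \<subseteq> interior {0}" using J'(2) by (rule interior_maximal)
    then show False using J'(1) by simp
  qed
qed

text \<open>A finite face of the theta graph can be turned into the outer one by an inversion; so the case
  of three mutually exterior arcs reduces to the previous lemma.\<close>

lemma theta_outer:
  assumes th: "theta A B C a b" and D: "A \<union> B \<union> C \<subseteq> D" and bd: "bounded D"
    and x: "x \<in> A - {a, b}" "y \<in> B - {a, b}" "z \<in> C - {a, b}"
    and cl: "x \<in> closure (outside D)" "y \<in> closure (outside D)" "z \<in> closure (outside D)"
  shows False
proof -
  from th have loop: "arc_between A a b" "arc_between B a b" "A \<inter> B \<subseteq> {a, b}" "arc_between C a b"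
      "A \<inter> C \<subseteq> {a, b}" "B \<inter> C \<subseteq> {a, b}" by (auto simp: theta_def)
  note J = loop_inside_outside[OF loop(1-3)]
  let ?T = "outside D"
  have TL: "?T \<subseteq> outside (A \<union> B)" using D outside_mono by (metis le_sup_iff)
  have Td: "?T \<inter> (A \<union> B \<union> C) = {}" using D outside_no_overlap by blast
  have cT: "connected ?T" by (rule connected_outside[OF bd]) simp
  have nT: "?T \<noteq> {}" using unbounded_outside[OF bd] by auto
  have clT: "closure ?T \<inter> inside (A \<union> B) = {}"
    using open_Int_closure_eq_empty[OF J(2), of ?T] TL inside_Int_outside[of "A \<union> B"] by blast
  \<comment> \<open>Otherwise the inner points of \<open>C\<close>, \<open>z\<close> among them,
    would lie in the open set \<open>inside (A \<union> B)\<close>, which the closure of the outer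
    face avoids.\<close>
  have "C \<inter> inside (A \<union> B) = {}"
  proof (rule ccontr)
    assume "C \<inter> inside (A \<union> B) \<noteq> {}"
    then have "C - {a, b} \<subseteq> inside (A \<union> B)" using theta_split(2)[OF th] by blast
    then show False using x(3) cl(3) clT by blast
  qed
  then have Cout: "C - {a, b} \<subseteq> outside (A \<union> B)" using J(8) loop by blast
  obtain z0 where z0: "z0 \<in> inside (A \<union> B)" using J(1) by blast
  define f where "f = (\<lambda>z. inverse (z - z0))"
  have z0': "z0 \<notin> A" "z0 \<notin> B" "z0 \<notin> C" "z0 \<notin> closure ?T"
    using z0 inside_no_overlap[of "A \<union> B"] clT \<open>C \<inter> inside (A \<union> B) = {}\<close> by blast+
  have inj: "inj f" by (auto simp: f_def inj_on_def)
  have cont: "continuous_on S f" if "z0 \<notin> S" for S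
    unfolding f_def by (intro continuous_intros) (use that in auto)
  have inv: "f ` outside (A \<union> B) \<subseteq> inside (f ` A \<union> f ` B)"
    unfolding f_def by (rule inversion_outside[OF loop(1-3) z0])
  have th': "theta (f ` A) (f ` B) (f ` C) (f a) (f b)"
    unfolding theta_def
  proof (intro conjI)
    show "arc_between (f ` A) (f a) (f b)" "arc_between (f ` B) (f a) (f b)" "arc_between (f ` C) (f a) (f b)"
      using loop cont z0' inj by (auto intro!: arc_between_image intro: inj_on_subset)
  qed (use loop inj in \<open>auto dest: injD\<close>)
  \<comment> \<open>After the inversion the inner points of \<open>C\<close> and the outer face both
    lie inside the loop of the images of \<open>A\<close> and \<open>B\<close>, and the outer face
    still touches inner points of both arcs; \<open>theta_inner\<close> forbids that.\<close>
  have z: "f z \<in> f ` C \<inter> inside (f ` A \<union> f ` B)" using x(3) Cout inv by blast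
  have "f ` ?T \<inter> (f ` A \<union> f ` B \<union> f ` C) = {}" 
    using Td by (simp add: image_Un[symmetric] image_Int[OF inj, symmetric])
  moreover have "f ` ?T \<inter> inside (f ` A \<union> f ` B) \<noteq> {}" using nT TL inv by blast
  moreover have "connected (f ` ?T)"
    by (rule connected_continuous_image[OF cont cT]) (use z0' closure_subset in blast)
  ultimately have "(f ` A - {f a, f b}) \<inter> closure (f ` ?T) = {} \<or> (f ` B - {f a, f b}) \<inter> closure (f ` ?T) = {}"
    using theta_inner[OF th'] z by blast
  moreover have "f w \<in> closure (f ` ?T)" if "w \<in> closure ?T" for w
    using image_closure_subset[OF cont[OF z0'(4)] closed_closure closure_subset] that by blast
  ultimately show False using x cl inj by (auto dest: injD)
qed

text \<open>By the theta lemma no edge of a subdivided \<open>K\<^sub>4\<close> reaches the outer face, which would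
  leave a finite frontier.\<close>

lemma no_outer_K4:
  assumes arcs: "arc_between AB a b" "arc_between AC a c" "arc_between AD a d"
      "arc_between BC b c" "arc_between BD b d" "arc_between CD c d"
    and int: "AB \<inter> AC \<subseteq> {a}" "AB \<inter> AD \<subseteq> {a}" "AC \<inter> AD \<subseteq> {a}"
      "AB \<inter> BC \<subseteq> {b}" "AB \<inter> BD \<subseteq> {b}" "BC \<inter> BD \<subseteq> {b}"
      "AC \<inter> BC \<subseteq> {c}" "AC \<inter> CD \<subseteq> {c}" "BC \<inter> CD \<subseteq> {c}"
      "AD \<inter> BD \<subseteq> {d}" "AD \<inter> CD \<subseteq> {d}" "BD \<inter> CD \<subseteq> {d}"
      "AB \<inter> CD = {}" "AC \<inter> BD = {}" "AD \<inter> BC = {}"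
    and K: "K = AB \<union> AC \<union> AD \<union> BC \<union> BD \<union> CD"
    and cl: "a \<in> closure (outside K)" "b \<in> closure (outside K)" "c \<in> closure (outside K)" "d \<in> closure (outside K)"
  shows False
proof -
  have cK: "compact K" unfolding K using arcs by (intro compact_Un) (auto intro: arc_between_compact)
  have bK: "bounded K" by (rule compact_imp_bounded[OF cK])
  \<comment> \<open>The edge \<open>PQ\<close> and the two detours through \<open>r\<close> and
    \<open>s\<close> form a theta curve. As \<open>r\<close> and \<open>s\<close> touch the outer
    face, no inner point of \<open>PQ\<close> does.\<close>
  have one: "PQ \<inter> closure (outside K) \<subseteq> {p, q}"
    if "arc_between PQ p q" "arc_between PR p r" "arc_between QR q r" "arc_between PS p s" "arc_between QS q s"
      "PR \<inter> QR \<subseteq> {r}" "PS \<inter> QS \<subseteq> {s}" "PQ \<inter> PR \<subseteq> {p}" "PQ \<inter> PS \<subseteq> {p}" "PQ \<inter> QR \<subseteq> {q}" "PQ \<inter> QS \<subseteq> {q}"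
      "PR \<inter> PS \<subseteq> {p}" "QR \<inter> QS \<subseteq> {q}" "PR \<inter> QS = {}" "PS \<inter> QR = {}"
      "PQ \<union> PR \<union> QR \<union> PS \<union> QS \<subseteq> K" "r \<in> closure (outside K)" "s \<in> closure (outside K)"
    for PQ PR QR PS QS p q r s
  proof
    fix x assume x: "x \<in> PQ \<inter> closure (outside K)"
    show "x \<in> {p, q}"
    proof (rule ccontr)
      assume "x \<notin> {p, q}"
      have "theta (PR \<union> QR) (PS \<union> QS) PQ p q"
        unfolding theta_def
      proof (intro conjI)
        show "arc_between (PR \<union> QR) p q" using that by (intro arc_between_join[OF that(2) arc_between_commute]) auto
        show "arc_between (PS \<union> QS) p q" using that by (intro arc_between_join[OF that(4) arc_between_commute]) auto
      qed (use that in auto)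
      moreover have "r \<in> PR \<union> QR - {p, q}" "s \<in> PS \<union> QS - {p, q}"
        using arc_between_ends[OF that(2)] arc_between_ends[OF that(3)] arc_between_ends[OF that(4)] arc_between_ends[OF that(5)] by auto
      ultimately show False
        using theta_outer[of "PR \<union> QR" "PS \<union> QS" PQ p q K r s x] x \<open>x \<notin> {p, q}\<close> that(16-18) bK by auto
    qed
  qed
  note arcs' = arcs arcs[THEN arc_between_commute]
  have "AB \<inter> closure (outside K) \<subseteq> {a, b}"
    by (rule one[of AB a b AC c BC AD d BD]) (use arcs' int cl K in auto)
  moreover have "AC \<inter> closure (outside K) \<subseteq> {a, c}"
    by (rule one[of AC a c AB b BC AD d CD]) (use arcs' int cl K in auto)
  moreover have "AD \<inter> closure (outside K) \<subseteq> {a, d}"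
    by (rule one[of AD a d AB b BD AC c CD]) (use arcs' int cl K in auto)
  moreover have "BC \<inter> closure (outside K) \<subseteq> {b, c}"
    by (rule one[of BC b c AB a AC BD d CD]) (use arcs' int cl K in auto)
  moreover have "BD \<inter> closure (outside K) \<subseteq> {b, d}"
    by (rule one[of BD b d AB a AD BC c CD]) (use arcs' int cl K in auto)
  moreover have "CD \<inter> closure (outside K) \<subseteq> {c, d}"
    by (rule one[of CD c d AC a AD BC b BD]) (use arcs' int cl K in auto)
  ultimately have "K \<inter> closure (outside K) \<subseteq> {a, b, c, d}" unfolding K by blast
  moreover have "frontier (outside K) \<subseteq> K \<inter> closure (outside K)"
    using frontier_outside_subset[OF compact_imp_closed[OF cK]] by (auto simp: frontier_def)
  ultimately have fr: "frontier (outside K) \<subseteq> {a, b, c, d}" by blast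
  \<comment> \<open>The plane without four points is connected; as it contains points of the outer
    face and points of \<open>AB\<close>, it has to meet the frontier of the outer face.\<close>
  have "connected (- {a, b, c, d})" using connected_open_delete_finite[of UNIV "{a, b, c, d}"] 
    by (simp add: Compl_eq_Diff_UNIV connected_UNIV)
  moreover have "- {a, b, c, d} \<inter> outside K \<noteq> {}"
  proof
    assume "- {a, b, c, d} \<inter> outside K = {}"
    then have "outside K \<subseteq> {a, b, c, d}" by blast
    then have "bounded (outside K)" using finite_imp_bounded finite_subset by (metis finite.emptyI finite.insertI)
    then show False using unbounded_outside[OF bK] by blast
  qed
  moreover have "\<not> AB \<subseteq> {a, b, c, d}"
  proof
    assume "AB \<subseteq> {a, b, c, d}"
    then have "finite AB" by (rule finite_subset) simp
    moreover have "infinite AB"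
    proof -
      obtain g where "arc g" "path_image g = AB" using arcs(1) unfolding arc_between_def by blast
      then show ?thesis unfolding path_image_def arc_def using finite_image_iff[of g "{0..1}"] infinite_Icc[of "0::real" 1] by auto
    qed
    ultimately show False by blast
  qed
  then have "- {a, b, c, d} - outside K \<noteq> {}" using K outside_no_overlap[of K] by blast
  ultimately show False using connected_Int_frontier[of "- {a, b, c, d}" "outside K"] fr by blast
qed

section \<open>Graph paths and their arcs in an outerplanar drawing\<close>

definition gpath :: "'a set set \<Rightarrow> 'a list \<Rightarrow> 'a \<Rightarrow> 'a \<Rightarrow> bool" where
  "gpath E P a b \<longleftrightarrow> P \<noteq> [] \<and> hd P = a \<and> last P = b \<and> distinct P \<and> successively (\<lambda>x y. {x, y} \<in> E) P"

fun edges_of :: "'a list \<Rightarrow> 'a set set" where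
  "edges_of (x # y # xs) = insert {x, y} (edges_of (y # xs))"
| "edges_of _ = {}"

lemma Union_edges_of: "\<Union>(edges_of xs) \<subseteq> set xs"
  by (induction xs rule: edges_of.induct) auto

lemma edges_of_subset: "successively (\<lambda>x y. {x, y} \<in> E) xs \<Longrightarrow> edges_of xs \<subseteq> E"
  by (induction xs rule: edges_of.induct) auto

lemma Union_edges_of_eq: "2 \<le> length xs \<Longrightarrow> \<Union>(edges_of xs) = set xs"
proof (induction xs rule: edges_of.induct)
  case (1 x y xs)
  then show ?case by (cases xs) auto
qed auto

text \<open>Two paths with the same ends and otherwise disjoint could share at most the edge between
  these ends; this excludes it once one of them has an inner vertex.\<close>

lemma ends_notin_edges_of:
  assumes "gpath E P a b" "3 \<le> length P"
  shows "{a, b} \<notin> edges_of P"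
proof -
  obtain x y zs where P: "P = x # y # zs" "zs \<noteq> []"
    using assms(2) by (cases P; cases "tl P") (auto simp: Suc_le_length_iff numeral_3_eq_3)
  have a: "x = a" and b: "last zs = b" and d: "distinct P" using assms(1) P by (auto simp: gpath_def)
  have "b \<in> set zs" using b P(2) by auto
  then have "{a, b} \<noteq> {x, y}" using a d P by (auto simp: doubleton_eq_iff)
  moreover have "{a, b} \<notin> edges_of (y # zs)"
    using Union_edges_of[of "y # zs"] a d P by auto
  ultimately show ?thesis using P by simp
qed

lemma gpath_ends: "gpath E P a b \<Longrightarrow> a \<in> set P \<and> b \<in> set P"
  by (metis gpath_def hd_in_set last_in_set)

lemma gpath_edges: "gpath E P a b \<Longrightarrow> edges_of P \<subseteq> E"
  by (auto simp: gpath_def dest: edges_of_subset)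

locale outer_drawing =
  fixes V :: "'a set" and E :: "'a set set" and p :: "'a \<Rightarrow> complex" and \<gamma> :: "'a set \<Rightarrow> real \<Rightarrow> complex"
  assumes graph: "simple_graph V E" and drawing: "plane_drawing V E p \<gamma>"
    and outer: "\<And>v. v \<in> V \<Longrightarrow> p v \<in> frontier (outside (drawing_set V E p \<gamma>))"
begin

definition drawn :: "'a set set \<Rightarrow> complex set" where
  "drawn F = (\<Union>e\<in>F. path_image (\<gamma> e))"

lemma finite_E: "finite E"
  using graph unfolding simple_graph_def by (meson Pow_iff finite_Pow_iff finite_subset subsetI)

lemma edge_arc:
  assumes "{x, y} \<in> E"
  shows "arc_between (path_image (\<gamma> {x, y})) (p x) (p y)"
proof -
  have *: "arc (\<gamma> {x, y})" "{pathstart (\<gamma> {x, y}), pathfinish (\<gamma> {x, y})} = {p x, p y}"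
    using drawing assms unfolding plane_drawing_def by auto
  then have "arc_between (path_image (\<gamma> {x, y})) (pathstart (\<gamma> {x, y})) (pathfinish (\<gamma> {x, y}))"
    unfolding arc_between_def by blast
  with *(2) show ?thesis
    by (auto simp: doubleton_eq_iff intro: arc_between_commute)
qed

lemma edge_vertices: "e \<in> E \<Longrightarrow> path_image (\<gamma> e) \<inter> p ` V = p ` e"
  using drawing unfolding plane_drawing_def by simp

lemma edges_meet: "e \<in> E \<Longrightarrow> e' \<in> E \<Longrightarrow> e \<noteq> e' \<Longrightarrow> path_image (\<gamma> e) \<inter> path_image (\<gamma> e') \<subseteq> p ` (e \<inter> e')"
  using drawing unfolding plane_drawing_def by simp

lemma vertex_drawn:
  assumes "F \<subseteq> E" "x \<in> \<Union>F"
  shows "p x \<in> drawn F"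
proof -
  obtain e where "e \<in> F" "x \<in> e" using assms by blast
  then show ?thesis using edge_vertices[of e] assms(1) unfolding drawn_def by blast
qed

lemma drawn_Int:
  assumes "F \<subseteq> E" "G \<subseteq> E" "F \<inter> G = {}"
  shows "drawn F \<inter> drawn G \<subseteq> p ` (\<Union>F \<inter> \<Union>G)"
proof
  fix z assume "z \<in> drawn F \<inter> drawn G"
  then obtain e e' where e: "e \<in> F" "e' \<in> G" "z \<in> path_image (\<gamma> e)" "z \<in> path_image (\<gamma> e')"
    unfolding drawn_def by blast
  have "e \<in> E" "e' \<in> E" "e \<noteq> e'" using e assms by auto
  from edges_meet[OF this] have "z \<in> p ` (e \<inter> e')" using e by blast
  then show "z \<in> p ` (\<Union>F \<inter> \<Union>G)" using e by blast
qed

lemma drawn_Int_single: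
  assumes "F \<subseteq> E" "G \<subseteq> E" "\<Union>F \<inter> \<Union>G \<subseteq> {v}"
  shows "drawn F \<inter> drawn G \<subseteq> {p v}" "\<Union>F \<inter> \<Union>G = {} \<Longrightarrow> drawn F \<inter> drawn G = {}"
proof -
  \<comment> \<open>An edge has two ends, so edge sets with at most one common vertex have no common
    edge.\<close>
  have "F \<inter> G = {}"
  proof (rule ccontr)
    assume "F \<inter> G \<noteq> {}"
    then obtain e where e: "e \<in> F" "e \<in> G" by blast
    then have "card e = 2" "e \<subseteq> {v}" using graph assms unfolding simple_graph_def by auto
    then show False using card_mono[of "{v}" e] by simp
  qed
  from drawn_Int[OF assms(1,2) this] assms(3)
  show "drawn F \<inter> drawn G \<subseteq> {p v}" "\<Union>F \<inter> \<Union>G = {} \<Longrightarrow> drawn F \<inter> drawn G = {}" by auto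
qed

lemma gpath_arc:
  "gpath E P a b \<Longrightarrow> 2 \<le> length P \<Longrightarrow> arc_between (drawn (edges_of P)) (p a) (p b)"
proof (induction P arbitrary: a rule: edges_of.induct)
  case (1 x y zs)
  have xa: "x = a" and xy: "{x, y} \<in> E" using 1 by (auto simp: gpath_def)
  show ?case
  proof (cases "zs = []")
    case True
    then show ?thesis using edge_arc[OF xy] 1 by (simp add: drawn_def gpath_def)
  next
    case False
    then have y: "gpath E (y # zs) y b" and x: "x \<notin> set (y # zs)" using 1(2) by (auto simp: gpath_def)
    have A: "arc_between (drawn (edges_of (y # zs))) (p y) (p b)"
      using 1(1)[OF y] False by (cases zs) auto
    have "drawn {{x, y}} \<inter> drawn (edges_of (y # zs)) \<subseteq> {p y}"
      by (rule drawn_Int_single) (use xy gpath_edges[OF y] Union_edges_of[of "y # zs"] x in auto)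
    then have "arc_between (drawn {{x, y}} \<union> drawn (edges_of (y # zs))) (p x) (p b)"
      by (intro arc_between_join[OF _ A]) (use edge_arc[OF xy] in \<open>simp_all add: drawn_def\<close>)
    then show ?thesis by (simp add: xa drawn_def)
  qed
qed auto

lemma p_inj: "x \<in> V \<Longrightarrow> y \<in> V \<Longrightarrow> p x = p y \<longleftrightarrow> x = y"
  using drawing unfolding plane_drawing_def by (auto dest: inj_onD)

lemma edges_V: "F \<subseteq> E \<Longrightarrow> \<Union>F \<subseteq> V"
  using graph unfolding simple_graph_def by blast

lemma gpath_V: "gpath E P a b \<Longrightarrow> 2 \<le> length P \<Longrightarrow> set P \<subseteq> V"
  using edges_V[OF gpath_edges] Union_edges_of_eq by metis

lemma bounded_drawing: "bounded (drawing_set V E p \<gamma>)"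
proof -
  have "bounded (path_image (\<gamma> e))" if "e \<in> E" for e
    using drawing that unfolding plane_drawing_def by (auto simp: bounded_arc_image)
  then show ?thesis unfolding drawing_set_def
    using graph finite_E by (auto simp: simple_graph_def intro: finite_imp_bounded intro!: bounded_UN)
qed

lemma drawn_subset: "F \<subseteq> E \<Longrightarrow> drawn F \<subseteq> drawing_set V E p \<gamma>"
  unfolding drawn_def drawing_set_def by blast

lemma outer_closure: "v \<in> V \<Longrightarrow> p v \<in> closure (outside (drawing_set V E p \<gamma>))"
  using outer[of v] by (simp add: frontier_def)

text \<open>Each of the three paths has an inner vertex, which lies on the outer face of the whole
  drawing. So the drawn arcs contradict \<open>theta_outer\<close>, with the whole drawing as
  \<open>D\<close>.\<close>

theorem no_theta:
  assumes P: "gpath E P a b" "gpath E Q a b" "gpath E S a b"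
    and len: "3 \<le> length P" "3 \<le> length Q" "3 \<le> length S"
    and int: "set P \<inter> set Q \<subseteq> {a, b}" "set P \<inter> set S \<subseteq> {a, b}" "set Q \<inter> set S \<subseteq> {a, b}"
  shows False
proof -
  let ?d = "\<lambda>P. drawn (edges_of P)"
  have I: "?d P \<inter> ?d Q \<subseteq> {p a, p b}"
    if "gpath E P a b" "gpath E Q a b" "3 \<le> length P" "set P \<inter> set Q \<subseteq> {a, b}" for P Q
  proof -
    have "edges_of P \<inter> edges_of Q = {}"
    proof (rule ccontr)
      assume "edges_of P \<inter> edges_of Q \<noteq> {}"
      then obtain e where e: "e \<in> edges_of P" "e \<in> edges_of Q" by blast
      then have "e \<subseteq> {a, b}" using Union_edges_of[of P] Union_edges_of[of Q] that(4) by blast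
      moreover have "card e = 2" using e gpath_edges[OF that(1)] graph by (auto simp: simple_graph_def)
      moreover have "card {a, b} \<le> 2" by (simp add: card_insert_if)
      ultimately have "e = {a, b}" by (intro card_seteq) simp_all
      then show False using ends_notin_edges_of[OF that(1,3)] e by blast
    qed
    from drawn_Int[OF gpath_edges[OF that(1)] gpath_edges[OF that(2)] this] show ?thesis
      using Union_edges_of[of P] Union_edges_of[of Q] that(4) by blast
  qed
  have th: "theta (?d P) (?d Q) (?d S) (p a) (p b)"
    unfolding theta_def using gpath_arc[OF P(1)] gpath_arc[OF P(2)] gpath_arc[OF P(3)] I P len int by simp
  have inner: "\<exists>x. x \<in> ?d P - {p a, p b} \<and> x \<in> closure (outside (drawing_set V E p \<gamma>))"
    if gp: "gpath E P a b" and ln: "3 \<le> length P" for P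
  proof -
    obtain x y z zs where xs: "P = x # y # z # zs"
      using ln by (auto simp: Suc_le_length_iff numeral_3_eq_3)
    have "a = x" "b \<in> set (z # zs)" using gp xs by (auto simp: gpath_def)
    then have "y \<noteq> a" "y \<noteq> b" "a \<in> set P" "b \<in> set P" "y \<in> set P" using gp xs by (auto simp: gpath_def)
    moreover have V: "set P \<subseteq> V" using gpath_V[OF gp] ln by simp
    moreover have "p y \<in> ?d P"
      by (rule vertex_drawn[OF gpath_edges[OF gp]]) (use xs in auto)
    ultimately show ?thesis using p_inj outer_closure by blast
  qed
  obtain x y z where "x \<in> ?d P - {p a, p b}" "x \<in> closure (outside (drawing_set V E p \<gamma>))"
    "y \<in> ?d Q - {p a, p b}" "y \<in> closure (outside (drawing_set V E p \<gamma>))"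
    "z \<in> ?d S - {p a, p b}" "z \<in> closure (outside (drawing_set V E p \<gamma>))"
    using inner P len by metis
  then show False
    using theta_outer[OF th _ bounded_drawing, of x y z] drawn_subset[OF gpath_edges[OF P(1)]]
      drawn_subset[OF gpath_edges[OF P(2)]] drawn_subset[OF gpath_edges[OF P(3)]] by blast
qed

text \<open>The subdivided graph is presented as a closed walk \<open>a\<close>, \<open>c\<close>,
  \<open>b\<close>, \<open>d\<close> of four paths with two diagonals that are edges, the shape that
  two crossing chords of a Hamiltonian cycle produce.\<close>

theorem no_K4:
  assumes P: "gpath E AC a c" "gpath E CB c b" "gpath E BD b d" "gpath E DA d a"
    and AB: "{a, b} \<in> E" and CD: "{c, d} \<in> E"
    and len: "2 \<le> length AC" "2 \<le> length CB" "2 \<le> length BD" "2 \<le> length DA"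
    and int: "set AC \<inter> set CB \<subseteq> {c}" "set CB \<inter> set BD \<subseteq> {b}" "set BD \<inter> set DA \<subseteq> {d}" "set DA \<inter> set AC \<subseteq> {a}"
      "set AC \<inter> set BD = {}" "set CB \<inter> set DA = {}"
  shows False
proof -
  let ?d = "\<lambda>P. drawn (edges_of P)"
  note sub = gpath_edges[OF P(1)] gpath_edges[OF P(2)] gpath_edges[OF P(3)] gpath_edges[OF P(4)]
  note un = Union_edges_of[of AC] Union_edges_of[of CB] Union_edges_of[of BD] Union_edges_of[of DA]
  have mem: "a \<in> set AC" "c \<in> set AC" "c \<in> set CB" "b \<in> set CB" "b \<in> set BD" "d \<in> set BD" "d \<in> set DA" "a \<in> set DA"
    using gpath_ends[OF P(1)] gpath_ends[OF P(2)] gpath_ends[OF P(3)] gpath_ends[OF P(4)] by simp_all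
  have ne: "a \<noteq> b" "c \<noteq> d" "a \<noteq> c" "a \<noteq> d" "b \<noteq> c" "b \<noteq> d"
    using mem int arc_between_ends[OF gpath_arc[OF P(1) len(1)]] arc_between_ends[OF gpath_arc[OF P(2) len(2)]]
      arc_between_ends[OF gpath_arc[OF P(3) len(3)]] arc_between_ends[OF gpath_arc[OF P(4) len(4)]] by auto
  have out: "a \<notin> set CB" "a \<notin> set BD" "b \<notin> set AC" "b \<notin> set DA" "c \<notin> set BD" "c \<notin> set DA" "d \<notin> set AC" "d \<notin> set CB"
    using mem int by auto
  have V: "a \<in> V" "b \<in> V" "c \<in> V" "d \<in> V" using gpath_V[OF P(1) len(1)] gpath_V[OF P(3) len(3)] mem by auto
  define K where "K = drawn {{a, b}} \<union> ?d AC \<union> ?d DA \<union> ?d CB \<union> ?d BD \<union> drawn {{c, d}}"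
  have "K \<subseteq> drawing_set V E p \<gamma>"
    unfolding K_def using drawn_subset sub AB CD by auto
  \<comment> \<open>Passing from the drawing to its subset \<open>K\<close> can only enlarge the
    outer face.\<close>
  then have cl: "p v \<in> closure (outside K)" if "v \<in> V" for v
    using outer_closure[OF that] closure_mono[OF outside_mono] by blast
  note arcs = gpath_arc[OF P(1) len(1)] gpath_arc[OF P(2) len(2)] gpath_arc[OF P(3) len(3)] gpath_arc[OF P(4) len(4)]
  have arcE: "arc_between (drawn {{a, b}}) (p a) (p b)" "arc_between (drawn {{c, d}}) (p c) (p d)"
    using edge_arc AB CD by (simp_all add: drawn_def)
  show False
    by (rule no_outer_K4[where AB = "drawn {{a, b}}" and AC = "?d AC" and AD = "?d DA" and BC = "?d CB"
          and BD = "?d BD" and CD = "drawn {{c, d}}" and a = "p a" and b = "p b" and c = "p c" and d = "p d" and K = K,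
          OF arcE(1) arcs(1) arc_between_commute[OF arcs(4)] arc_between_commute[OF arcs(2)] arcs(3) arcE(2)
          _ _ _ _ _ _ _ _ _ _ _ _ _ _ _ K_def])
      (rule drawn_Int_single(1) drawn_Int_single(2) cl; use sub un AB CD int out ne V in blast)+
qed

end

section \<open>Hamiltonian cycles of bridgeless graphs\<close>

text \<open>All that the coloring argument uses of outerplanarity is this and
  \<open>K4_free\<close>. Both are inherited by smaller edge sets for trivial reasons, so no drawing
  has to be restricted.\<close>

definition theta_free :: "'a set set \<Rightarrow> bool" where
  "theta_free E \<longleftrightarrow> (\<forall>a b P Q S. gpath E P a b \<longrightarrow> gpath E Q a b \<longrightarrow> gpath E S a b \<longrightarrow>
     3 \<le> length P \<longrightarrow> 3 \<le> length Q \<longrightarrow> 3 \<le> length S \<longrightarrow>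
     set P \<inter> set Q \<subseteq> {a, b} \<longrightarrow> set P \<inter> set S \<subseteq> {a, b} \<longrightarrow> set Q \<inter> set S \<subseteq> {a, b} \<longrightarrow> False)"

definition K4_free :: "'a set set \<Rightarrow> bool" where
  "K4_free E \<longleftrightarrow> (\<forall>a b c d P Q S T. gpath E P a c \<longrightarrow> gpath E Q c b \<longrightarrow> gpath E S b d \<longrightarrow> gpath E T d a \<longrightarrow>
     {a, b} \<in> E \<longrightarrow> {c, d} \<in> E \<longrightarrow> 2 \<le> length P \<longrightarrow> 2 \<le> length Q \<longrightarrow> 2 \<le> length S \<longrightarrow> 2 \<le> length T \<longrightarrow>
     set P \<inter> set Q \<subseteq> {c} \<longrightarrow> set Q \<inter> set S \<subseteq> {b} \<longrightarrow> set S \<inter> set T \<subseteq> {d} \<longrightarrow> set T \<inter> set P \<subseteq> {a} \<longrightarrow>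
     set P \<inter> set S = {} \<longrightarrow> set Q \<inter> set T = {} \<longrightarrow> False)"

lemma outerplanar_free:
  assumes "simple_graph V E" "outerplanar V E"
  shows "theta_free E" "K4_free E"
proof -
  obtain p \<gamma> where "plane_drawing V E p \<gamma>" "\<forall>v\<in>V. p v \<in> frontier (outside (drawing_set V E p \<gamma>))"
    using assms(2) unfolding outerplanar_def by blast
  then interpret outer_drawing V E p \<gamma>
    using assms(1) by unfold_locales auto
  show "theta_free E" unfolding theta_free_def by (intro allI impI) (erule (8) no_theta)
  show "K4_free E" unfolding K4_free_def by (intro allI impI) (erule (15) no_K4)
qed

lemma gpath_mono: "gpath E P a b \<Longrightarrow> E \<subseteq> F \<Longrightarrow> gpath F P a b"
  unfolding gpath_def by (auto elim!: successively_mono)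

lemma theta_free_mono: "theta_free E \<Longrightarrow> F \<subseteq> E \<Longrightarrow> theta_free F"
  unfolding theta_free_def by (meson gpath_mono)

lemma K4_free_mono: "K4_free E \<Longrightarrow> F \<subseteq> E \<Longrightarrow> K4_free F"
  unfolding K4_free_def by (meson gpath_mono subsetD)

lemma gpath_refl: "gpath E [x] x x"
  by (simp add: gpath_def)

lemma rtranclp_gpath:
  "(\<lambda>x y. {x, y} \<in> E)\<^sup>*\<^sup>* x y \<Longrightarrow> \<exists>P. gpath E P x y"
proof (induction rule: rtranclp_induct)
  case base
  show ?case using gpath_refl by fast
next
  case (step y z)
  then obtain P where P: "gpath E P x y" by blast
  show ?case
  proof (cases "z \<in> set P")
    case True
    then obtain A B where "P = A @ z # B" by (meson split_list)
    then have "gpath E (A @ [z]) x z"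
      using P by (cases A) (auto simp: gpath_def successively_append_iff successively_Cons hd_append)
    then show ?thesis by blast
  next
    case False
    then have "gpath E (P @ [z]) x z"
      using P step by (auto simp: gpath_def successively_append_iff)
    then show ?thesis by blast
  qed
qed

lemma gpath_rev: "gpath E P a b \<Longrightarrow> gpath E (rev P) b a"
  by (auto simp: gpath_def hd_rev last_rev insert_commute)

definition edge_cut :: "'a set set \<Rightarrow> 'a set \<Rightarrow> 'a set set" where
  "edge_cut E K = {e \<in> E. e \<inter> K \<noteq> {} \<and> \<not> e \<subseteq> K}"

lemma simple_graph_finite_edges: "simple_graph V E \<Longrightarrow> finite E"
  unfolding simple_graph_def by (meson Pow_iff finite_Pow_iff finite_subset subsetI)

lemma simple_graph_edge:
  "simple_graph V E \<Longrightarrow> {x, y} \<in> E \<Longrightarrow> x \<in> V \<and> y \<in> V \<and> x \<noteq> y"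
  unfolding simple_graph_def by fastforce

lemma simple_graph_edgeE:
  assumes "simple_graph V E" "e \<in> E"
  obtains x y where "e = {x, y}" "x \<in> V" "y \<in> V" "x \<noteq> y"
proof -
  have "e \<subseteq> V" "card e = 2" using assms unfolding simple_graph_def by auto
  then show thesis using that by (auto simp: card_2_iff)
qed

lemma card_nbrs_le_vdegree:
  assumes "simple_graph V E" "\<And>y. y \<in> N \<Longrightarrow> {x, y} \<in> E"
  shows "card N \<le> vdegree E x"
proof -
  have "inj_on (\<lambda>y. {x, y}) N" by (auto simp: inj_on_def doubleton_eq_iff)
  then have "card N = card ((\<lambda>y. {x, y}) ` N)" by (simp add: card_image)
  also have "\<dots> \<le> vdegree E x"
    unfolding vdegree_def
    by (rule card_mono) (use assms(2) simple_graph_finite_edges[OF assms(1)] in auto)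
  finally show ?thesis .
qed

lemma vdegree_le_card_nbrs:
  assumes "simple_graph V E" "\<And>y. {x, y} \<in> E \<Longrightarrow> y \<in> N" "finite N"
  shows "vdegree E x \<le> card N"
proof -
  have "{e \<in> E. x \<in> e} \<subseteq> (\<lambda>y. {x, y}) ` N"
  proof
    fix e assume e: "e \<in> {e \<in> E. x \<in> e}"
    then obtain u v where "e = {u, v}" using simple_graph_edgeE[OF assms(1)] by blast
    then show "e \<in> (\<lambda>y. {x, y}) ` N" using e assms(2) by (auto simp: insert_commute)
  qed
  then show ?thesis unfolding vdegree_def using assms(3) by (rule surj_card_le[rotated])
qed

lemma four_nbrs:
  assumes "simple_graph V E" "vdegree E x \<le> 3" "{x, a} \<in> E" "{x, b} \<in> E" "{x, c} \<in> E" "{x, d} \<in> E"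
    "distinct [a, b, c, d]"
  shows False
  using card_nbrs_le_vdegree[of V E "{a, b, c, d}" x] assms by auto

text \<open>Empty cuts are forbidden too, so connectedness is included; a single vertex qualifies
  since it has no proper nonempty subset.\<close>

definition bridgeless :: "'a set \<Rightarrow> 'a set set \<Rightarrow> bool" where
  "bridgeless S F \<longleftrightarrow> (\<forall>K. K \<noteq> {} \<longrightarrow> K \<subset> S \<longrightarrow> 2 \<le> card (edge_cut F K))"

lemma bridgelessD: "bridgeless S F \<Longrightarrow> K \<noteq> {} \<Longrightarrow> K \<subset> S \<Longrightarrow> 2 \<le> card (edge_cut F K)"
  by (simp add: bridgeless_def)

lemma bridgeless_cut_edge:
  assumes "simple_graph S F" "bridgeless S F" "K \<noteq> {}" "K \<subset> S"
  obtains u v where "{u, v} \<in> F" "u \<in> K" "v \<notin> K"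
proof -
  have "edge_cut F K \<noteq> {}" using bridgelessD[OF assms(2-4)] by auto
  then obtain e where "e \<in> F" "e \<inter> K \<noteq> {}" "\<not> e \<subseteq> K" unfolding edge_cut_def by blast
  moreover obtain u v where "e = {u, v}" using simple_graph_edgeE[OF assms(1) \<open>e \<in> F\<close>] .
  ultimately show thesis using that[of u v] that[of v u] by (auto simp: insert_commute)
qed

text \<open>If \<open>y\<close> could not be reached, \<open>{x, y}\<close> would be the only edge
  leaving the set of vertices reached from \<open>x\<close>.\<close>

lemma bridgeless_path:
  assumes "simple_graph S F" "bridgeless S F" "{x, y} \<in> F"
  shows "\<exists>P. gpath (F - {{x, y}}) P x y"
proof -
  let ?F = "F - {{x, y}}"
  let ?K = "{z \<in> S. (\<lambda>u v. {u, v} \<in> ?F)\<^sup>*\<^sup>* x z}"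
  have x: "x \<in> S" "y \<in> S" using simple_graph_edge[OF assms(1,3)] by auto
  have "y \<in> ?K"
  proof (rule ccontr)
    assume "y \<notin> ?K"
    then have "?K \<subset> S" "?K \<noteq> {}" using x by auto
    then have 2: "2 \<le> card (edge_cut F ?K)" by (intro bridgelessD[OF assms(2)])
    have "edge_cut F ?K \<subseteq> {{x, y}}"
    proof
      fix e assume e: "e \<in> edge_cut F ?K"
      then obtain u v where uv: "e = {u, v}" "u \<in> ?K" "v \<notin> ?K" "v \<in> S"
        using assms(1) unfolding edge_cut_def by (auto elim!: simple_graph_edgeE[OF assms(1)])
      show "e \<in> {{x, y}}"
      proof (rule ccontr)
        assume "e \<notin> {{x, y}}"
        then have "{u, v} \<in> ?F" using e uv by (auto simp: edge_cut_def)
        then have "v \<in> ?K" using uv by (auto intro: rtranclp.rtrancl_into_rtrancl)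
        then show False using uv by blast
      qed
    qed
    then have "card (edge_cut F ?K) \<le> 1" using card_mono[of "{{x, y}}" "edge_cut F ?K"] by simp
    then show False using 2 by simp
  qed
  then show ?thesis using rtranclp_gpath by fastforce
qed

definition cycle :: "'a set set \<Rightarrow> 'a list \<Rightarrow> bool" where
  "cycle F C \<longleftrightarrow> 3 \<le> length C \<and> distinct C \<and> successively (\<lambda>x y. {x, y} \<in> F) C \<and> {last C, hd C} \<in> F"

lemma cycle_rotate: "cycle F (A @ B) \<Longrightarrow> cycle F (B @ A)"
  by (cases "A = []"; cases "B = []") (auto simp: cycle_def successively_append_iff)

lemma cycle_rotate_to:
  assumes "cycle F C" "c \<in> set C"
  obtains ys where "cycle F (c # ys)" "set (c # ys) = set C" "length (c # ys) = length C"
proof -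
  obtain A B where "C = A @ c # B" using assms(2) by (meson split_list)
  then show thesis using that[of "B @ A"] cycle_rotate[of F A "c # B"] assms(1) by auto
qed

lemma cycle_subset: "simple_graph S F \<Longrightarrow> cycle F C \<Longrightarrow> set C \<subseteq> S"
proof -
  assume *: "simple_graph S F" "cycle F C"
  then have "2 \<le> length C" "successively (\<lambda>x y. {x, y} \<in> F) C" by (auto simp: cycle_def)
  then have "set C = \<Union>(edges_of C)" "edges_of C \<subseteq> F" using Union_edges_of_eq edges_of_subset by blast+
  then show ?thesis using *(1) unfolding simple_graph_def by blast
qed

lemma bridgeless_cycle:
  assumes "simple_graph S F" "bridgeless S F" "x \<in> S" "y \<in> S" "x \<noteq> y"
  shows "\<exists>C. cycle F C"
proof -
  have "{x} \<subset> S" using assms by auto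
  then obtain u z where "{u, z} \<in> F" "u \<in> {x}" "z \<notin> {x}"
    by (elim bridgeless_cut_edge[OF assms(1,2), rotated]) auto
  then have e: "{x, z} \<in> F" "x \<noteq> z" by auto
  obtain P where P: "gpath (F - {{x, z}}) P x z" using bridgeless_path[OF assms(1,2) e(1)] by blast
  have "length P \<noteq> 0" "length P \<noteq> 1" using P e by (auto simp: gpath_def length_Suc_conv)
  moreover have "length P \<noteq> 2" using P by (auto simp: gpath_def length_Suc_conv numeral_2_eq_2)
  ultimately have "3 \<le> length P" by linarith
  then have "cycle F P" using gpath_mono[OF P, of F] e by (auto simp: cycle_def gpath_def insert_commute)
  then show ?thesis by blast
qed

text \<open>A longest cycle that misses a vertex is left by an edge \<open>{c, w}\<close>, and
  bridgelessness provides a return from \<open>w\<close> that avoids this edge and first hits the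
  cycle at \<open>z\<close>. The ear thus obtained lengthens the cycle if \<open>z\<close> is next
  to \<open>c\<close> on it, and otherwise forms a theta with the two arcs of the cycle. A return to
  \<open>c\<close> itself would give \<open>c\<close> degree four.\<close>

lemma hamiltonian_cycle:
  assumes graph: "simple_graph S F" "bridgeless S F" and xy: "x \<in> S" "y \<in> S" "x \<noteq> y"
    and deg: "\<And>v. v \<in> S \<Longrightarrow> vdegree F v \<le> 3" and free: "theta_free F"
  shows "\<exists>C. cycle F C \<and> set C = S"
proof -
  have fin: "finite S" using graph by (simp add: simple_graph_def)
  have bound: "cycle F C \<Longrightarrow> length C \<le> card S" for C
    using cycle_subset[OF graph(1), of C] card_mono[OF fin, of "set C"] distinct_card[of C] by (auto simp: cycle_def)
  obtain C where C: "cycle F C" and max: "\<And>D. cycle F D \<Longrightarrow> length D \<le> length C"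
  proof -
    obtain C0 where "cycle F C0" using bridgeless_cycle[OF graph xy] by blast
    then show thesis
      using ex_has_greatest_nat[of "cycle F" C0 length "Suc (card S)"] bound that
      by (metis less_Suc_eq_le)
  qed
  have "set C = S"
  proof (rule ccontr)
    assume ne: "set C \<noteq> S"
    have sub: "set C \<subseteq> S" by (rule cycle_subset[OF graph(1) C])
    have "set C \<noteq> {}" using C by (auto simp: cycle_def)
    moreover have "set C \<subset> S" using ne sub by blast
    ultimately obtain c w where e: "{c, w} \<in> F" and c: "c \<in> set C" and w: "w \<notin> set C"
      by (rule bridgeless_cut_edge[OF graph])
    obtain ys where ys: "cycle F (c # ys)" "set (c # ys) = set C" "length (c # ys) = length C"
      by (rule cycle_rotate_to[OF C c])
    have ysd: "distinct (c # ys)" "successively (\<lambda>x y. {x, y} \<in> F) (c # ys)" "{last ys, c} \<in> F" "2 \<le> length ys"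
      using ys(1) by (auto simp: cycle_def split: if_splits)
    have "{w, c} \<in> F" using e by (simp add: insert_commute)
    then obtain Q where Q: "gpath (F - {{w, c}}) Q w c" using bridgeless_path[OF graph] by metis
    \<comment> \<open>The part of the return path before it first hits the cycle.\<close>
    define W where "W = takeWhile (\<lambda>v. v \<notin> set C) Q"
    have "c \<in> set Q" using Q gpath_ends by fast
    then obtain z rest where z: "Q = W @ z # rest" "z \<in> set C"
      using c unfolding W_def by (metis (no_types, lifting) hd_dropWhile hd_Cons_tl dropWhile_eq_Nil_conv takeWhile_dropWhile_id)
    have Wout: "set W \<inter> set C = {}" using set_takeWhileD unfolding W_def by fastforce
    have hdQ: "hd Q = w" "distinct Q" using Q by (auto simp: gpath_def)
    have "Q \<noteq> []" using Q by (simp add: gpath_def)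
    then have Wne: "W \<noteq> []" using w hdQ unfolding W_def by (cases Q) auto
    then have hdW: "hd W = w" using hdQ z by auto
    have suc: "successively (\<lambda>x y. {x, y} \<in> F - {{w, c}}) (W @ [z])"
      using Q z by (auto simp: gpath_def successively_append_iff)
    then have sucF: "successively (\<lambda>x y. {x, y} \<in> F) (W @ [z])" by (auto elim!: successively_mono)
    have lastW: "{last W, z} \<in> F - {{w, c}}" using suc Wne by (auto simp: successively_append_iff)
    have dW: "distinct (W @ [z])" using hdQ z by auto
    have lw: "last W \<notin> set C" using Wout Wne last_in_set by blast
    have zc: "z \<noteq> c"
    proof
      assume "z = c"
      then have t: "{c, last W} \<in> F" "last W \<noteq> w" using lastW by (auto simp: insert_commute)
      obtain u v vs where u: "ys = u # v # vs" using ysd(4) by (auto simp: Suc_le_length_iff numeral_2_eq_2)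
      have lv: "last ys \<in> set (v # vs)" using u by auto
      have in_C: "u \<in> set C" "last ys \<in> set C" using lv unfolding ys(2)[symmetric] u by auto
      have ul: "u \<noteq> last ys" using ysd(1) lv unfolding u by auto
      have dis: "distinct [u, last ys, w, last W]"
        using in_C ul t(2) lw w by auto
      have cu: "{c, u} \<in> F" using ysd(2) unfolding u by simp
      have cl: "{c, last ys} \<in> F" using ysd(3) by (simp add: insert_commute)
      have "vdegree F c \<le> 3" using deg c sub by blast
      from four_nbrs[OF graph(1) this cu cl e t(1) dis] show False .
    qed
    then obtain ys1 ys2 where y: "ys = ys1 @ z # ys2" using z(2) ys(2) by (metis set_ConsD split_list)
    have Wys: "set W \<inter> set (c # ys) = {}" using Wout ys(2) by simp
    have cw: "{c, hd W} \<in> F" using e hdW by simp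
    \<comment> \<open>\<open>ys1\<close> and \<open>ys2\<close> are the inner vertices of the two
      arcs of the cycle between \<open>c\<close> and \<open>z\<close>. If one of them is empty, that
      arc is a single edge, and the ear replaces it.\<close>
    consider "ys1 = []" | "ys2 = []" | "ys1 \<noteq> []" "ys2 \<noteq> []" by blast
    then show False
    proof cases
      case 1
      have "cycle F (c # W @ z # ys2)"
        using ysd Wys cw sucF dW Wne unfolding y 1 cycle_def
        by (auto simp: successively_append_iff successively_Cons hd_append split: if_splits)
      then have "length (c # W @ z # ys2) \<le> length C" by (rule max)
      then show False using ys(3) Wne unfolding y 1 by (cases W) auto
    next
      case 2
      have "successively (\<lambda>x y. {x, y} \<in> F) (rev W)"
        using sucF by (simp add: successively_append_iff insert_commute)
      then have "cycle F (c # ys1 @ z # rev W)"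
        using ysd Wys cw lastW dW Wne unfolding y 2 cycle_def
        by (auto simp: successively_append_iff successively_Cons hd_append hd_rev last_rev insert_commute split: if_splits)
      then have "length (c # ys1 @ z # rev W) \<le> length C" by (rule max)
      then show False using ys(3) Wne unfolding y 2 by (cases W) auto
    next
      case 3
      have "gpath F (c # ys1 @ [z]) c z"
        using ysd 3 unfolding y by (auto simp: gpath_def successively_append_iff successively_Cons hd_append)
      moreover have "gpath F (c # W @ [z]) c z"
        using Wys cw sucF dW Wne zc unfolding gpath_def by (auto simp: successively_append_iff successively_Cons hd_append)
      moreover have "gpath F (c # rev ys2 @ [z]) c z"
      proof -
        have "gpath F (z # ys2 @ [c]) z c"
          using ysd 3 unfolding y by (auto simp: gpath_def successively_append_iff successively_Cons hd_append)
        from gpath_rev[OF this] show ?thesis by simp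
      qed
      moreover have "set (c # ys1 @ [z]) \<inter> set (c # W @ [z]) \<subseteq> {c, z}"
        "set (c # ys1 @ [z]) \<inter> set (c # rev ys2 @ [z]) \<subseteq> {c, z}"
        "set (c # W @ [z]) \<inter> set (c # rev ys2 @ [z]) \<subseteq> {c, z}"
        using Wys ysd(1) unfolding y by auto
      moreover have "3 \<le> length (c # ys1 @ [z])" "3 \<le> length (c # W @ [z])" "3 \<le> length (c # rev ys2 @ [z])"
        using 3 Wne by (simp_all add: Suc_le_eq numeral_3_eq_3)
      ultimately show False using free unfolding theta_free_def by blast
    qed
  qed
  then show ?thesis using C by blast
qed

section \<open>Local colorings and their boundary states\<close>

definition near :: "('a \<Rightarrow> 'a \<Rightarrow> bool) \<Rightarrow> 'a \<Rightarrow> 'a \<Rightarrow> bool" where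
  "near R x y \<longleftrightarrow> x = y \<or> R x y"

text \<open>The conditions of the packing coloring together with (B), for one piece
  \<open>I\<close>. Color 4 occurs at most once, as (A) asks, so no condition reaches further than
  two steps.\<close>

definition good :: "('a \<Rightarrow> 'a \<Rightarrow> bool) \<Rightarrow> 'a set \<Rightarrow> 'a set \<Rightarrow> ('a \<Rightarrow> color) \<Rightarrow> bool" where
  "good R U I f \<longleftrightarrow>
     (\<forall>x\<in>I. \<forall>y\<in>I. R x y \<longrightarrow> f x \<noteq> f y) \<and>
     (\<forall>x\<in>I. \<forall>z\<in>I. \<forall>y\<in>I. near R x z \<longrightarrow> near R z y \<longrightarrow> f y = Color2 \<longrightarrow>
        (f x = Color2 \<longrightarrow> x = y) \<and> (f x = Color4 \<longrightarrow> y \<notin> U)) \<and>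
     (\<forall>x\<in>I. \<forall>y\<in>I. f x = Color4 \<longrightarrow> f y = Color4 \<longrightarrow> x = y)"

text \<open>In the application \<open>U\<close> consists of the vertices of degree at most two. Colors 1a, 1b and 4 are
  recorded as \<open>CA\<close>, \<open>CB\<close> and \<open>CF\<close>; color 2 is recorded as \<open>CT\<close> (only on a vertex of degree
  three) or as \<open>CD\<close>. The flag says which neighbors of color 2 are possible: none, only those of
  degree three, or all; the Boolean of a vertex state allows a neighbor of color 4. The state of a
  segment consists of the states of its two ends and tells whether these coincide and whether
  color 4 may occur.\<close>

datatype vcol = CA | CB | CT | CD | CF
datatype flag = F0 | F1 | F2

type_synonym vstate = "vcol \<times> flag \<times> bool"
type_synonym sstate = "vstate \<times> vstate \<times> bool \<times> bool"

text \<open>The cases overlap on purpose: \<open>CD\<close> promises nothing about \<open>U\<close>,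
  so that \<open>CT\<close> is the stronger claim.\<close>

fun has_col :: "'a set \<Rightarrow> ('a \<Rightarrow> color) \<Rightarrow> 'a \<Rightarrow> vcol \<Rightarrow> bool" where
  "has_col U f x CA \<longleftrightarrow> f x = Color1a"
| "has_col U f x CB \<longleftrightarrow> f x = Color1b"
| "has_col U f x CT \<longleftrightarrow> f x = Color2 \<and> x \<notin> U"
| "has_col U f x CD \<longleftrightarrow> f x = Color2"
| "has_col U f x CF \<longleftrightarrow> f x = Color4"

fun has_flag :: "('a \<Rightarrow> 'a \<Rightarrow> bool) \<Rightarrow> 'a set \<Rightarrow> 'a set \<Rightarrow> ('a \<Rightarrow> color) \<Rightarrow> 'a \<Rightarrow> flag \<Rightarrow> bool" where
  "has_flag R U I f x F0 \<longleftrightarrow> (\<forall>y\<in>I. R x y \<longrightarrow> f y \<noteq> Color2)"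
| "has_flag R U I f x F1 \<longleftrightarrow> (\<forall>y\<in>I. R x y \<longrightarrow> f y = Color2 \<longrightarrow> y \<notin> U)"
| "has_flag R U I f x F2 \<longleftrightarrow> True"

text \<open>A state only bounds from above what is seen next to the vertex, so it stays true when
  the flag or the Boolean is enlarged.\<close>

fun has_state :: "('a \<Rightarrow> 'a \<Rightarrow> bool) \<Rightarrow> 'a set \<Rightarrow> 'a set \<Rightarrow> ('a \<Rightarrow> color) \<Rightarrow> 'a \<Rightarrow> vstate \<Rightarrow> bool" where
  "has_state R U I f x (c, t, n) \<longleftrightarrow> has_col U f x c \<and> has_flag R U I f x t \<and>
     (\<not> n \<longrightarrow> (\<forall>y\<in>I. R x y \<longrightarrow> f y \<noteq> Color4))"

fun is2 :: "vcol \<Rightarrow> bool" where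
  "is2 CA = False" | "is2 CB = False" | "is2 CT = True" | "is2 CD = True" | "is2 CF = False"

text \<open>What a vertex with the first state becomes by a new edge to a vertex with the second
  state, or \<open>None\<close> if its own color or those next to it object to the new color. A
  second color 2 within distance two is refused (\<open>is2 c\<close>,
  \<open>t \<noteq> F0\<close>), for \<open>CD\<close> also a color 4 there (\<open>c = CF\<close>,
  \<open>n\<close>); a new color 4 is refused if a neighbor may have color 2 and degree at most two
  (\<open>t = F2\<close>). Objections from the other side appear when the arguments are
  exchanged.\<close>

fun step :: "vstate \<Rightarrow> vstate \<Rightarrow> vstate option" where
  "step (c, t, n) (CA, _) = (if c = CA then None else Some (c, t, n))"
| "step (c, t, n) (CB, _) = (if c = CB then None else Some (c, t, n))"
| "step (c, t, n) (CT, _) = (if is2 c \<or> t \<noteq> F0 then None else Some (c, F1, n))"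
| "step (c, t, n) (CD, _) = (if is2 c \<or> c = CF \<or> t \<noteq> F0 \<or> n then None else Some (c, F2, n))"
| "step (c, t, n) (CF, _) = (if c = CF \<or> t = F2 then None else Some (c, t, True))"

fun join_states :: "vstate \<Rightarrow> vstate \<Rightarrow> (vstate \<times> vstate) option" where
  "join_states x y = (case step x y of None \<Rightarrow> None | Some x' \<Rightarrow>
     (case step y x of None \<Rightarrow> None | Some y' \<Rightarrow> Some (x', y')))"

lemma join_states_SomeD:
  "join_states x y = Some (x', y') \<Longrightarrow> step x y = Some x' \<and> step y x = Some y'"
  by (auto split: option.splits)

definition add_edge :: "('a \<Rightarrow> 'a \<Rightarrow> bool) \<Rightarrow> 'a \<Rightarrow> 'a \<Rightarrow> 'a \<Rightarrow> 'a \<Rightarrow> bool" where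
  "add_edge R p q x y \<longleftrightarrow> R x y \<or> x = p \<and> y = q \<or> x = q \<and> y = p"

text \<open>As \<open>near R p w\<close> includes \<open>w = p\<close>, the new distances one and
  two from \<open>q\<close> across the edge are covered together.\<close>

lemma step_facts:
  assumes "has_state R U I f p x" "has_state R U I f q y" "step x y = Some x'" "step y x = Some y'"
  shows "f p \<noteq> f q"
    and "f q = Color2 \<Longrightarrow> w \<in> I \<Longrightarrow> near R p w \<Longrightarrow> f w \<noteq> Color2 \<and> (f w = Color4 \<longrightarrow> q \<notin> U)"
    and "f q = Color4 \<Longrightarrow> w \<in> I \<Longrightarrow> near R p w \<Longrightarrow> f w = Color2 \<Longrightarrow> w \<notin> U"
proof -
  obtain c t n d u m where xy: "x = (c, t, n)" "y = (d, u, m)" by (metis prod_cases3)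
  show "f p \<noteq> f q"
    using assms unfolding xy by (cases c; cases d) (auto split: if_splits)
  show "f q = Color2 \<Longrightarrow> w \<in> I \<Longrightarrow> near R p w \<Longrightarrow> f w \<noteq> Color2 \<and> (f w = Color4 \<longrightarrow> q \<notin> U)"
    using assms unfolding xy near_def by (cases c; cases d) (auto split: if_splits)
  show "f q = Color4 \<Longrightarrow> w \<in> I \<Longrightarrow> near R p w \<Longrightarrow> f w = Color2 \<Longrightarrow> w \<notin> U"
    using assms unfolding xy near_def by (cases c; cases d; cases t) (auto split: if_splits)
qed

lemma step_has_state:
  assumes "has_state R U I f p x" "has_state R U I f q y" "step x y = Some x'" "p \<noteq> q"
  shows "has_state (add_edge R p q) U I f p x'"
proof -
  obtain c t n d u m where xy: "x = (c, t, n)" "y = (d, u, m)" by (metis prod_cases3)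
  show ?thesis
    using assms unfolding xy add_edge_def by (cases d; cases t; cases n) (auto split: if_splits)
qed

lemma add_edge_commute: "add_edge R p q = add_edge R q p"
  by (auto simp: add_edge_def fun_eq_iff)

lemma symp_add_edge: "symp R \<Longrightarrow> symp (add_edge R p q)"
  by (auto simp: symp_def add_edge_def)

lemma has_state_add_edge_other:
  "r \<noteq> p \<Longrightarrow> r \<noteq> q \<Longrightarrow> has_state (add_edge R p q) U I f r x = has_state R U I f r x"
proof -
  assume "r \<noteq> p" "r \<noteq> q"
  then have R: "add_edge R p q r = R r" by (auto simp: add_edge_def fun_eq_iff)
  obtain c t n where "x = (c, t, n)" by (metis prod_cases3)
  then show ?thesis by (cases t) (simp_all add: R)
qed

text \<open>A walk of at most two steps that uses the new edge is back at its start or joins one end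
  of this edge to a vertex near the other end. So \<open>step_facts\<close>, applied in both
  directions, covers every new pair.\<close>

lemma good_add_edge:
  assumes "good R U I f" "symp R" "p \<noteq> q"
    and st: "has_state R U I f p x" "has_state R U I f q y"
    and j: "join_states x y = Some (x', y')"
  shows "good (add_edge R p q) U I f" "has_state (add_edge R p q) U I f p x'"
    "has_state (add_edge R p q) U I f q y'"
proof -
  note j = join_states_SomeD[OF j, THEN conjunct1] join_states_SomeD[OF j, THEN conjunct2]
  show "has_state (add_edge R p q) U I f p x'"
    using step_has_state[OF st j(1)] assms(3) by blast
  show "has_state (add_edge R p q) U I f q y'"
    using step_has_state[OF st(2,1) j(2)] assms(3) by (simp add: add_edge_commute)
  note A = step_facts[OF st j] and B = step_facts[OF st(2,1) j(2,1)]
  have sym: "R a b \<Longrightarrow> R b a" for a b using \<open>symp R\<close> by (auto dest: sympD)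
  then have nsym: "near R a b \<Longrightarrow> near R b a" for a b by (auto simp: near_def)
  have near': "near (add_edge R p q) a b \<longleftrightarrow> near R a b \<or> a = p \<and> b = q \<or> a = q \<and> b = p" for a b
    by (auto simp: near_def add_edge_def)
  show "good (add_edge R p q) U I f"
    unfolding good_def
  proof (intro conjI ballI impI)
    fix a b assume "a \<in> I" "b \<in> I" "add_edge R p q a b"
    then show "f a \<noteq> f b" using assms(1) A(1) B(1) unfolding good_def add_edge_def by metis
  next
    fix a b assume "a \<in> I" "b \<in> I" "f a = Color4" "f b = Color4"
    then show "a = b" using assms(1) unfolding good_def by metis
  next
    fix a z b assume I: "a \<in> I" "z \<in> I" "b \<in> I" and n: "near (add_edge R p q) a z" "near (add_edge R p q) z b"
      and fb: "f b = Color2" and fa: "f a = Color2"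
    show "a = b"
      using n fa fb I A(2) B(2) nsym assms(1) unfolding near' good_def by metis
  next
    fix a z b assume I: "a \<in> I" "z \<in> I" "b \<in> I" and n: "near (add_edge R p q) a z" "near (add_edge R p q) z b"
      and fb: "f b = Color2" and fa: "f a = Color4"
    show "b \<notin> U"
    proof -
      consider "near R a z" "near R z b" | "a = b" | "near R a p" "b = q" | "near R a q" "b = p"
        | "a = p" "near R q b" | "a = q" "near R p b"
        using n unfolding near' by blast
      then show ?thesis
      proof cases
        case 1 then show ?thesis using fa fb I assms(1) unfolding good_def by blast
      next
        case 2 then show ?thesis using fa fb by simp
      next
        case 3 then show ?thesis using fa fb I A(2)[of a] nsym by blast
      next
        case 4 then show ?thesis using fa fb I B(2)[of a] nsym by blast
      next
        case 5 then show ?thesis using fa fb I B(3)[of b] by blast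
      next
        case 6 then show ?thesis using fa fb I A(3)[of b] by blast
      qed
    qed
  qed
qed

lemma good_cong:
  assumes "\<And>x y. x \<in> I \<Longrightarrow> y \<in> I \<Longrightarrow> R x y = R' x y" "\<And>x. x \<in> I \<Longrightarrow> f x = f' x"
  shows "good R U I f = good R' U I f'"
proof -
  have "near R x y = near R' x y" if "x \<in> I" "y \<in> I" for x y
    using that assms(1) by (auto simp: near_def)
  with assms show ?thesis unfolding good_def by (simp cong: ball_cong_simp)
qed

lemma has_state_cong:
  assumes "\<And>y. y \<in> I \<Longrightarrow> R r y = R' r y" "\<And>x. x \<in> I \<Longrightarrow> f x = f' x" "r \<in> I"
  shows "has_state R U I f r x = has_state R' U I f' r x"
proof -
  obtain c t n where "x = (c, t, n)" by (metis prod_cases3)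
  with assms show ?thesis by (cases t; cases c) (simp_all cong: ball_cong_simp)
qed

lemma good_disjoint_union:
  assumes "good R U I f" "good R U J f"
    and "\<And>x y. x \<in> I \<Longrightarrow> y \<in> J \<Longrightarrow> \<not> R x y \<and> \<not> R y x" "I \<inter> J = {}"
    and "(\<forall>x\<in>I. f x \<noteq> Color4) \<or> (\<forall>x\<in>J. f x \<noteq> Color4)"
  shows "good R U (I \<union> J) f"
proof -
  have n: "near R x y \<Longrightarrow> x \<in> I \<longleftrightarrow> y \<in> I" if "x \<in> I \<union> J" "y \<in> I \<union> J" for x y
    using that assms(3,4) by (auto simp: near_def)
  have n': "near R x y \<Longrightarrow> x \<in> J \<longleftrightarrow> y \<in> J" if "x \<in> I \<union> J" "y \<in> I \<union> J" for x y
    using that assms(3,4) by (auto simp: near_def)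
  show ?thesis
    unfolding good_def
  proof (intro conjI ballI impI)
    fix x z y assume *: "x \<in> I \<union> J" "z \<in> I \<union> J" "y \<in> I \<union> J" "near R x z" "near R z y" "f y = Color2"
    then consider "x \<in> I" "z \<in> I" "y \<in> I" | "x \<in> J" "z \<in> J" "y \<in> J"
      using n n' by blast
    note cs = this
    show "x = y" if "f x = Color2"
      using cs by cases (use * that assms(1,2) in \<open>auto simp: good_def\<close>)
    show "y \<notin> U" if "f x = Color4"
      using cs by cases (use * that assms(1,2) in \<open>auto simp: good_def\<close>)
  qed (use assms in \<open>auto simp: good_def\<close>)
qed

lemma has_state_disjoint_union:
  assumes "has_state R U I f p x" "p \<in> I" "\<And>y. y \<in> J \<Longrightarrow> \<not> R p y"
  shows "has_state R U (I \<union> J) f p x"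
proof -
  obtain c t n where "x = (c, t, n)" by (metis prod_cases3)
  with assms show ?thesis by (cases t) auto
qed

section \<open>The table of boundary states and its closure properties\<close>

fun swap_col :: "vcol \<Rightarrow> vcol" where
  "swap_col CA = CB" | "swap_col CB = CA" | "swap_col CT = CT" | "swap_col CD = CD" | "swap_col CF = CF"

fun swap_state :: "sstate \<Rightarrow> sstate" where
  "swap_state ((c, t, n), (d, u, m), s, q) = ((swap_col c, t, n), (swap_col d, u, m), s, q)"

text \<open>Found by a computer search. Member 0 is the single vertex; members 1 and 2 also cover the
  segments whose two ends are joined by a chord. Up to weakening, the family is closed under adding
  such a chord around a segment and under putting one of these three in front of a segment. The
  states that arise by exchanging 1a and 1b are added afterwards.\<close>

definition family_half :: "sstate list list" where
  "family_half = [
   [((CF, F0, False), (CF, F0, False), True, True),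
    ((CD, F0, False), (CD, F0, False), True, False),
    ((CA, F0, False), (CA, F0, False), True, False)],
   [((CT, F0, False), (CA, F1, False), False, False),
    ((CF, F0, False), (CA, F0, True), False, True),
    ((CA, F0, True), (CF, F0, False), False, True),
    ((CA, F0, True), (CB, F0, True), False, True),
    ((CA, F1, False), (CT, F0, False), False, False),
    ((CA, F2, False), (CB, F2, False), False, False)],
   [((CA, F0, False), (CB, F0, False), False, False),
    ((CA, F0, True), (CF, F1, False), False, True),
    ((CA, F1, False), (CT, F0, False), False, True)],
   [((CD, F0, False), (CA, F0, False), False, False),
    ((CA, F0, False), (CF, F1, False), False, True),
    ((CA, F0, False), (CA, F0, False), False, False)],
   [((CA, F0, False), (CF, F0, False), False, True),
    ((CA, F0, False), (CD, F0, False), False, False),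
    ((CA, F0, False), (CA, F0, False), False, False)],
   [((CA, F2, False), (CF, F1, False), False, True),
    ((CA, F2, False), (CA, F0, False), False, False),
    ((CA, F2, False), (CB, F1, False), False, False)],
   [((CT, F0, False), (CA, F2, False), False, False),
    ((CA, F2, False), (CT, F0, False), False, False),
    ((CA, F2, False), (CF, F0, False), False, True),
    ((CA, F2, False), (CA, F0, True), False, True),
    ((CA, F2, False), (CA, F1, False), False, True),
    ((CA, F2, False), (CB, F0, True), False, True),
    ((CA, F2, False), (CB, F1, False), False, True),
    ((CA, F2, False), (CB, F2, False), False, False)],
   [((CA, F0, False), (CF, F1, False), False, True),
    ((CA, F0, False), (CA, F1, False), False, False),
    ((CA, F0, False), (CB, F0, False), False, False)],
   [((CT, F0, False), (CA, F2, False), False, False),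
    ((CA, F0, True), (CA, F1, False), False, True),
    ((CA, F0, True), (CB, F1, False), False, True),
    ((CA, F1, False), (CF, F0, False), False, True),
    ((CA, F1, False), (CA, F0, True), False, True),
    ((CA, F1, False), (CB, F0, True), False, True),
    ((CA, F2, False), (CT, F0, False), False, False),
    ((CA, F2, False), (CB, F2, False), False, False)],
   [((CA, F0, False), (CT, F0, False), False, False),
    ((CA, F0, False), (CF, F0, False), False, True),
    ((CA, F0, False), (CA, F0, True), False, True),
    ((CA, F0, True), (CB, F0, True), False, True),
    ((CA, F1, False), (CA, F1, False), False, False),
    ((CA, F1, False), (CB, F1, False), False, False)],
   [((CA, F0, False), (CT, F0, False), False, False),
    ((CA, F0, False), (CF, F0, False), False, True),
    ((CA, F0, False), (CA, F0, True), False, True),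
    ((CA, F0, False), (CA, F1, False), False, True),
    ((CA, F0, False), (CA, F2, False), False, False),
    ((CA, F0, False), (CB, F0, True), False, True),
    ((CA, F0, False), (CB, F1, False), False, True),
    ((CA, F1, False), (CB, F2, False), False, False)],
   [((CA, F0, False), (CB, F0, False), False, False),
    ((CA, F0, True), (CF, F0, False), False, True),
    ((CA, F2, False), (CD, F0, False), False, False)]]"

definition family :: "sstate list list" where
  "family = map (\<lambda>A. A @ map swap_state A) family_half"

fun flag_le :: "flag \<Rightarrow> flag \<Rightarrow> bool" where
  "flag_le F0 _ = True" | "flag_le F1 F0 = False" | "flag_le F1 F1 = True" | "flag_le F1 F2 = True"
| "flag_le F2 F0 = False" | "flag_le F2 F1 = False" | "flag_le F2 F2 = True"

text \<open>Ordered by strength: the smaller state promises more.\<close>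

fun vstate_le :: "vstate \<Rightarrow> vstate \<Rightarrow> bool" where
  "vstate_le (c, t, n) (d, u, m) \<longleftrightarrow> (c = d \<or> c = CT \<and> d = CD) \<and> flag_le t u \<and> (n \<longrightarrow> m)"

fun sstate_le :: "sstate \<Rightarrow> sstate \<Rightarrow> bool" where
  "sstate_le (x, y, s, q) (x', y', s', q') \<longleftrightarrow> (s \<longleftrightarrow> s') \<and> (q \<longrightarrow> q') \<and> vstate_le x x' \<and> vstate_le y y'"

text \<open>The connecting edge changes the states of the two inner ends. When a segment is a single
  vertex (\<open>s\<close> or \<open>s'\<close>), its inner end is its outer end as well and passes
  on the changed state. Two segments that may both contain color 4 are refused.\<close>

fun cat_states :: "sstate \<Rightarrow> sstate \<Rightarrow> sstate option" where
  "cat_states (x, y, s, q) (x', y', s', q') =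
     (if q \<and> q' then None else case join_states y x' of None \<Rightarrow> None
      | Some (z, z') \<Rightarrow> Some (if s then z else x, if s' then z' else y', False, q \<or> q'))"

definition single :: "vcol \<Rightarrow> sstate" where
  "single c = ((c, F0, False), (c, F0, False), True, c = CF)"

fun close_state :: "sstate \<Rightarrow> sstate option" where
  "close_state (x, y, s, q) = (case join_states x y of None \<Rightarrow> None | Some (x', y') \<Rightarrow> Some (x', y', s, q))"

fun wrap_state :: "vcol \<Rightarrow> sstate \<Rightarrow> vcol \<Rightarrow> sstate option" where
  "wrap_state c a d = Option.bind (Option.bind (cat_states (single c) a) (\<lambda>b. cat_states b (single d))) close_state"

fun option_le :: "sstate option \<Rightarrow> sstate \<Rightarrow> bool" where
  "option_le None b = False" | "option_le (Some a) b = sstate_le a b"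

text \<open>A member of the family lists states known to be realizable. So each state of
  \<open>B\<close> needs one source in \<open>J\<close> and \<open>A\<close>; the other combinations
  may be ignored.\<close>

definition cats_to :: "sstate list \<Rightarrow> sstate list \<Rightarrow> sstate list \<Rightarrow> bool" where
  "cats_to J A B \<longleftrightarrow> list_all (\<lambda>b. list_ex (\<lambda>j. list_ex (\<lambda>a. option_le (cat_states j a) b) A) J) B"

text \<open>The ends of a chord have degree three, so color 2 appears as \<open>CT\<close> among the
  candidates for them.\<close>

definition wraps_to :: "sstate list \<Rightarrow> sstate list \<Rightarrow> bool" where
  "wraps_to A B \<longleftrightarrow> list_all (\<lambda>b. list_ex (\<lambda>c. list_ex (\<lambda>d. list_ex (\<lambda>a. option_le (wrap_state c a d) b) A)
     [CA, CB, CT, CF]) [CA, CB, CT, CF]) B"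

text \<open>Each entry of the list names the member obtained from the member at the same position.
  Only 1 and 2 occur, so that chorded segments as first pieces need just two tables of
  concatenations.\<close>

lemma family_wraps: "list_all2 (\<lambda>A t. wraps_to A (family ! t)) family [1, 2, 1, 1, 1, 2, 2, 1, 2, 2, 2, 1]"
  by code_simp

text \<open>The three tables treat the possible first pieces of a segment: a single vertex, or one
  of the two members that describe chorded segments.\<close>

lemma family_cats:
  "list_all2 (\<lambda>A t. cats_to (family ! 0) A (family ! t)) family [11, 9, 3, 5, 11, 7, 10, 3, 10, 9, 10, 3]"
  "list_all2 (\<lambda>A t. cats_to (family ! 1) A (family ! t)) family [5, 8, 5, 5, 5, 5, 6, 5, 6, 6, 6, 5]"
  "list_all2 (\<lambda>A t. cats_to (family ! 2) A (family ! t)) family [4, 9, 2, 5, 4, 5, 10, 7, 10, 9, 10, 11]"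
  by code_simp+

text \<open>The root closes the cycle: it is joined to both ends of the path, and only its own final
  state is kept.\<close>

fun root_state :: "vcol \<Rightarrow> sstate \<Rightarrow> vstate option" where
  "root_state c (x, y, _) = (case join_states (c, F0, False) x of None \<Rightarrow> None
     | Some (r, _) \<Rightarrow> map_option fst (join_states r y))"

text \<open>The two ends are the only neighbors of the root, so no color 4 on them or next to them
  means distance at least three from the root.\<close>

fun root_far :: "vcol \<Rightarrow> sstate \<Rightarrow> bool" where
  "root_far c ((d, t, n), (e, u, m), s, q) \<longleftrightarrow> d \<noteq> CF \<and> e \<noteq> CF \<and> \<not> n \<and> \<not> m \<and>
     root_state c ((d, t, n), (e, u, m), s, q) \<noteq> None"

text \<open>Meant for a color 4 across the bridge: the neighbors of the root are at distance two
  from it, so by (B) a color 2 among them needs degree three, whence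
  \<open>t \<noteq> F2\<close>.\<close>

fun root_no4 :: "sstate \<Rightarrow> bool" where
  "root_no4 (x, y, s, q) \<longleftrightarrow> \<not> q \<and> (root_state CD (x, y, s, q) \<noteq> None \<or>
     (case root_state CA (x, y, s, q) of None \<Rightarrow> False | Some (c, t, n) \<Rightarrow> t \<noteq> F2))"

fun root_no2 :: "sstate \<Rightarrow> bool" where
  "root_no2 a \<longleftrightarrow> (case root_state CA a of None \<Rightarrow> False | Some (c, t, n) \<Rightarrow> t = F0)"

text \<open>Member 0 is left out because it stands for a single vertex, while a cycle without its
  root is a path with at least two. \<open>root_far\<close> is asked for both colors 1, as the color
  of the attachment vertex dictates which of them is allowed.\<close>

lemma family_root:
  "list_all (\<lambda>A. list_ex (root_far CA) A \<and> list_ex (root_far CB) A \<and> list_ex root_no4 A \<and> list_ex root_no2 A) (tl family)"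
  by code_simp

section \<open>Colorings of segments with prescribed boundary states\<close>

definition realizes :: "(nat \<Rightarrow> nat \<Rightarrow> bool) \<Rightarrow> nat set \<Rightarrow> nat \<Rightarrow> nat \<Rightarrow> sstate \<Rightarrow> (nat \<Rightarrow> color) \<Rightarrow> bool" where
  "realizes R U i j \<sigma> f \<longleftrightarrow> (case \<sigma> of (x, y, s, q) \<Rightarrow> good R U {i..j} f \<and> has_state R U {i..j} f i x \<and>
     has_state R U {i..j} f j y \<and> (s \<longleftrightarrow> i = j) \<and> (\<not> q \<longrightarrow> (\<forall>k\<in>{i..j}. f k \<noteq> Color4)))"

definition realizable :: "(nat \<Rightarrow> nat \<Rightarrow> bool) \<Rightarrow> nat set \<Rightarrow> nat \<Rightarrow> nat \<Rightarrow> sstate \<Rightarrow> bool" where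
  "realizable R U i j \<sigma> \<longleftrightarrow> (\<exists>f. realizes R U i j \<sigma> f)"

lemma vstate_le_has_state:
  "vstate_le x y \<Longrightarrow> has_state R U I f p x \<Longrightarrow> has_state R U I f p y"
proof -
  assume *: "vstate_le x y" "has_state R U I f p x"
  obtain c t n d u m where xy: "x = (c, t, n)" "y = (d, u, m)" by (metis prod_cases3)
  show ?thesis
    using * unfolding xy by (cases t; cases u) auto
qed

lemma sstate_le_realizable: "sstate_le a b \<Longrightarrow> realizable R U i j a \<Longrightarrow> realizable R U i j b"
  unfolding realizable_def realizes_def
  by (cases a; cases b) (auto dest: vstate_le_has_state)

lemma option_le_realizable:
  assumes "option_le z b" "\<And>a. z = Some a \<Longrightarrow> realizable R U i j a"
  shows "realizable R U i j b"
  using assms by (cases z) (auto intro: sstate_le_realizable)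

lemma realizable_cong:
  assumes "\<And>x y. x \<in> {i..j} \<Longrightarrow> y \<in> {i..j} \<Longrightarrow> R x y = R' x y" "i \<le> j"
  shows "realizable R U i j a = realizable R' U i j a"
proof -
  obtain x y s q where a: "a = (x, y, s, q)" by (metis prod_cases4)
  have "good R U {i..j} f = good R' U {i..j} f" for f
    by (rule good_cong) (use assms in auto)
  moreover have "has_state R U {i..j} f i x = has_state R' U {i..j} f i x" for f
    by (rule has_state_cong) (use assms in auto)
  moreover have "has_state R U {i..j} f j y = has_state R' U {i..j} f j y" for f
    by (rule has_state_cong) (use assms in auto)
  ultimately show ?thesis unfolding realizable_def realizes_def a by simp
qed

lemma realizable_single:
  assumes "c = CT \<Longrightarrow> i \<notin> U" "\<not> R i i"
  shows "realizable R U i i (single c)"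
proof -
  define col where "col = (case c of CA \<Rightarrow> Color1a | CB \<Rightarrow> Color1b | CT \<Rightarrow> Color2 | CD \<Rightarrow> Color2 | CF \<Rightarrow> Color4)"
  have "realizes R U i i (single c) (\<lambda>_. col)"
    using assms unfolding realizes_def single_def good_def col_def by (cases c) auto
  then show ?thesis unfolding realizable_def by blast
qed

lemma realizable_cat:
  assumes "symp R" "realizable R U i k a" "realizable R U (Suc k) j b" "i \<le> k" "k < j"
    and cross: "\<And>x y. x \<in> {i..k} \<Longrightarrow> y \<in> {Suc k..j} \<Longrightarrow> R x y \<longleftrightarrow> x = k \<and> y = Suc k"
    and c: "cat_states a b = Some c"
  shows "realizable R U i j c"
proof -
  obtain x y s q where a: "a = (x, y, s, q)" by (metis prod_cases4)
  obtain x' y' s' q' where b: "b = (x', y', s', q')" by (metis prod_cases4)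
  from c obtain z z' where q: "\<not> (q \<and> q')" and j: "join_states y x' = Some (z, z')"
    and c': "c = (if s then z else x, if s' then z' else y', False, q \<or> q')"
    unfolding a b by (auto split: if_splits option.splits prod.splits)
  \<comment> \<open>Without the connecting edge the two segments are independent, so their colorings
    together form a good one; \<open>good_add_edge\<close> then puts the edge back.\<close>
  define R0 where "R0 = (\<lambda>u v. R u v \<and> {u, v} \<noteq> {k, Suc k})"
  from assms(2) obtain f where f: "realizes R U i k a f" unfolding realizable_def by blast
  from assms(3) obtain g where g: "realizes R U (Suc k) j b g" unfolding realizable_def by blast
  define h where "h = (\<lambda>u. if u \<le> k then f u else g u)"
  let ?I = "{i..k}" and ?J = "{Suc k..j}"
  have IJ: "{i..j} = ?I \<union> ?J" using assms(4,5) by auto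
  have Rk: "R k (Suc k)" using cross[of k "Suc k"] assms(4,5) by auto
  then have Rk': "R (Suc k) k" using \<open>symp R\<close> by (auto dest: sympD)
  have Re: "add_edge R0 k (Suc k) = R"
    using Rk Rk' by (auto simp: add_edge_def R0_def fun_eq_iff doubleton_eq_iff)
  have s0: "symp R0" using \<open>symp R\<close> by (auto simp: R0_def symp_def insert_commute)
  have eqI: "R u v = R0 u v" if "u \<in> ?I" "v \<in> ?I" for u v
    using that by (auto simp: R0_def doubleton_eq_iff)
  have eqJ: "R u v = R0 u v" if "u \<in> ?J" "v \<in> ?J" for u v
    using that by (auto simp: R0_def doubleton_eq_iff)
  have no: "\<not> R0 u v \<and> \<not> R0 v u" if "u \<in> ?I" "v \<in> ?J" for u v
    using cross[OF that] \<open>symp R\<close> by (auto simp: R0_def symp_def)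
  have hf: "f u = h u" if "u \<in> ?I" for u using that by (simp add: h_def)
  have hg: "g u = h u" if "u \<in> ?J" for u using that by (simp add: h_def)
  have gI: "good R0 U ?I h"
    using f good_cong[of ?I R R0 f h U] eqI hf unfolding realizes_def a by auto
  have gJ: "good R0 U ?J h"
    using g good_cong[of ?J R R0 g h U] eqJ hg unfolding realizes_def b by auto
  have stI: "has_state R0 U ?I h r w \<longleftrightarrow> has_state R U ?I f r w" if "r \<in> ?I" for r w
    using has_state_cong[of ?I R r R0 f h] eqI hf that by blast
  have stJ: "has_state R0 U ?J h r w \<longleftrightarrow> has_state R U ?J g r w" if "r \<in> ?J" for r w
    using has_state_cong[of ?J R r R0 g h] eqJ hg that by blast
  have 4: "(\<not> q \<longrightarrow> (\<forall>k\<in>?I. h k \<noteq> Color4))" "(\<not> q' \<longrightarrow> (\<forall>k\<in>?J. h k \<noteq> Color4))"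
    using f g hf hg unfolding realizes_def a b by auto
  have G: "good R0 U {i..j} h"
    unfolding IJ by (rule good_disjoint_union[OF gI gJ no]) (use 4 q in auto)
  have SI: "has_state R0 U {i..j} h r w" if "r \<in> ?I" "has_state R U ?I f r w" for r w
    unfolding IJ by (rule has_state_disjoint_union) (use stI that no in auto)
  have SJ: "has_state R0 U {i..j} h r w" if "r \<in> ?J" "has_state R U ?J g r w" for r w
    unfolding IJ Un_commute[of ?I] by (rule has_state_disjoint_union) (use stJ that no in auto)
  have st: "has_state R0 U {i..j} h i x" "has_state R0 U {i..j} h k y"
    "has_state R0 U {i..j} h (Suc k) x'" "has_state R0 U {i..j} h j y'"
    using SI[of i x] SI[of k y] SJ[of "Suc k" x'] SJ[of j y'] f g assms(4,5)
    unfolding realizes_def a b by auto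
  note A = good_add_edge[OF G s0 _ st(2,3) j, unfolded Re]
  have s: "s \<longleftrightarrow> i = k" "s' \<longleftrightarrow> Suc k = j" using f g unfolding realizes_def a b by auto
  have oth: "has_state R U {i..j} h r w \<longleftrightarrow> has_state R0 U {i..j} h r w" if "r \<noteq> k" "r \<noteq> Suc k" for r w
    using has_state_add_edge_other[OF that, of R0 U "{i..j}" h w] unfolding Re .
  have F: "has_state R U {i..j} h i (if s then z else x)"
    using A(2) oth[of i x] st(1) s(1) assms(4) by (cases s) auto
  have L: "has_state R U {i..j} h j (if s' then z' else y')"
    using A(3) oth[of j y'] st(4) s(2) assms(5) by (cases s') auto
  have "\<not> (q \<or> q') \<longrightarrow> (\<forall>k\<in>{i..j}. h k \<noteq> Color4)"
    using 4 unfolding IJ by blast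
  moreover have "False \<longleftrightarrow> i = j" using assms(4,5) by simp
  ultimately have "realizes R U i j c h"
    unfolding realizes_def c' using A(1) F L by simp
  then show ?thesis unfolding realizable_def by blast
qed

lemma realizable_close:
  assumes "symp R" "realizable R0 U i j a" "i < j" "R i j"
    and R0: "R0 = (\<lambda>u v. R u v \<and> {u, v} \<noteq> {i, j})"
    and c: "close_state a = Some c"
  shows "realizable R U i j c"
proof -
  obtain x y s q where a: "a = (x, y, s, q)" by (metis prod_cases4)
  from c obtain x' y' where j: "join_states x y = Some (x', y')" and c': "c = (x', y', s, q)"
    unfolding a by (auto split: option.splits prod.splits)
  from assms(2) obtain f where f: "realizes R0 U i j a f" unfolding realizable_def by blast
  have "R j i" using assms by (auto dest: sympD)
  then have Re: "add_edge R0 i j = R"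
    using \<open>R i j\<close> by (auto simp: add_edge_def R0 fun_eq_iff doubleton_eq_iff)
  have s0: "symp R0" using \<open>symp R\<close> by (auto simp: R0 symp_def insert_commute)
  have "realizes R U i j c f"
    using f good_add_edge[OF _ s0 _ _ _ j, of U "{i..j}" f i j] \<open>i < j\<close>
    unfolding realizes_def a c' Re by auto
  then show ?thesis unfolding realizable_def by blast
qed

lemma realizable_wrap:
  assumes "symp R" "irreflp R" "realizable R U (Suc i) k a" "Suc i \<le> k" "i \<notin> U" "Suc k \<notin> U"
    and i: "\<And>y. y \<in> {Suc i..Suc k} \<Longrightarrow> R i y \<longleftrightarrow> y = Suc i \<or> y = Suc k"
    and k: "\<And>y. y \<in> {i..k} \<Longrightarrow> R y (Suc k) \<longleftrightarrow> y = i \<or> y = k"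
    and w: "wrap_state c a d = Some b"
  shows "realizable R U i (Suc k) b"
proof -
  \<comment> \<open>Without the chord, the wrapped segment is a plain concatenation of three
    pieces.\<close>
  define R0 where "R0 = (\<lambda>u v. R u v \<and> {u, v} \<noteq> {i, Suc k})"
  have s0: "symp R0" using \<open>symp R\<close> by (auto simp: R0_def symp_def insert_commute)
  from w obtain b1 b2 where b1: "cat_states (single c) a = Some b1"
    and b2: "cat_states b1 (single d) = Some b2" and b: "close_state b2 = Some b"
    by (auto simp: bind_eq_Some_conv)
  have irr: "\<not> R0 u u" for u using \<open>irreflp R\<close> by (auto simp: R0_def irreflp_def)
  have a0: "realizable R0 U (Suc i) k a"
    using assms(3,4) realizable_cong[of "Suc i" k R R0 U a]
    by (auto simp: R0_def doubleton_eq_iff)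
  have r1: "realizable R0 U i k b1"
    by (rule realizable_cat[OF s0 realizable_single[of c i U R0] a0 _ _ _ b1])
       (use assms irr in \<open>auto simp: R0_def doubleton_eq_iff\<close>)
  have r2: "realizable R0 U i (Suc k) b2"
    by (rule realizable_cat[OF s0 r1 realizable_single[of d "Suc k" U R0] _ _ _ b2])
       (use assms irr k in \<open>auto simp: R0_def doubleton_eq_iff\<close>)
  show ?thesis
    by (rule realizable_close[OF \<open>symp R\<close> r2 _ _ R0_def b]) (use assms in auto)
qed

section \<open>Paths with noncrossing chords\<close>

lemma cats_to_realizable:
  assumes "cats_to J A B" "\<And>x. x \<in> set J \<Longrightarrow> realizable R U i k x"
    "\<And>x. x \<in> set A \<Longrightarrow> realizable R U (Suc k) j x" "symp R" "i \<le> k" "k < j"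
    "\<And>x y. x \<in> {i..k} \<Longrightarrow> y \<in> {Suc k..j} \<Longrightarrow> R x y \<longleftrightarrow> x = k \<and> y = Suc k" "b \<in> set B"
  shows "realizable R U i j b"
proof -
  from assms(1,8) obtain x y where x: "x \<in> set J" and y: "y \<in> set A" and le: "option_le (cat_states x y) b"
    unfolding cats_to_def list_all_iff list_ex_iff by blast
  show ?thesis
    by (rule option_le_realizable[OF le])
       (rule realizable_cat[OF assms(4) assms(2)[OF x] assms(3)[OF y] assms(5-7)])
qed

lemma wraps_to_realizable:
  assumes "wraps_to A B" "\<And>x. x \<in> set A \<Longrightarrow> realizable R U (Suc i) k x"
    "symp R" "irreflp R" "Suc i \<le> k" "i \<notin> U" "Suc k \<notin> U"
    "\<And>y. y \<in> {Suc i..Suc k} \<Longrightarrow> R i y \<longleftrightarrow> y = Suc i \<or> y = Suc k"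
    "\<And>y. y \<in> {i..k} \<Longrightarrow> R y (Suc k) \<longleftrightarrow> y = i \<or> y = k" "b \<in> set B"
  shows "realizable R U i (Suc k) b"
proof -
  from assms(1,10) obtain c a d where x: "a \<in> set A" and le: "option_le (wrap_state c a d) b"
    unfolding wraps_to_def list_all_iff list_ex_iff by blast
  show ?thesis
    by (rule option_le_realizable[OF le])
       (rule realizable_wrap[OF assms(3,4) assms(2)[OF x] assms(5-9)])
qed

lemma length_family: "length family = 12"
  by (simp add: family_def family_half_def)

lemma family_single: "\<forall>a\<in>set (family ! 0). \<exists>c. c \<noteq> CT \<and> a = single c"
  by (simp add: family_def family_half_def single_def)

lemma family_wrap_ex: "t < 12 \<Longrightarrow> \<exists>t'\<in>{1,2}. wraps_to (family ! t) (family ! t')"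
proof -
  assume t: "t < 12"
  let ?l = "[1, 2, 1, 1, 1, 2, 2, 1, 2, 2, 2, 1::nat]"
  have "wraps_to (family ! t) (family ! (?l ! t))"
    using list_all2_nthD[OF family_wraps, of t] t by (simp add: length_family)
  moreover have "?l ! t \<in> set ?l" by (rule nth_mem) (use t in simp)
  then have "?l ! t \<in> {1, 2}" by auto
  ultimately show ?thesis by blast
qed

lemma family_cat_ex:
  assumes t: "t < 12" and j: "j \<in> {0, 1, 2}"
  shows "\<exists>t'<12. cats_to (family ! j) (family ! t) (family ! t')"
proof -
  have *: "\<exists>t'<12. cats_to (family ! j) (family ! t) (family ! t')"
    if "list_all2 (\<lambda>A t. cats_to (family ! j) A (family ! t)) family l" "\<forall>x\<in>set l. x < 12" for l
  proof -
    have "length l = 12" using list_all2_lengthD[OF that(1)] by (simp add: length_family)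
    then have "cats_to (family ! j) (family ! t) (family ! (l ! t))" "l ! t < 12"
      using list_all2_nthD[OF that(1), of t] t that(2) nth_mem[of t l] by (simp_all add: length_family del: nth_mem)
    then show ?thesis by blast
  qed
  from j consider "j = 0" | "j = 1" | "j = 2" by blast
  then show ?thesis
    by cases (use *[OF _ ] family_cats in \<open>force+\<close>)
qed

text \<open>The path runs from \<open>1\<close> to \<open>m\<close>. Index \<open>0\<close> is kept
  for the root, which has degree at most two in the application and so lies on no chord.\<close>

definition chord :: "(nat \<Rightarrow> nat \<Rightarrow> bool) \<Rightarrow> nat \<Rightarrow> nat \<Rightarrow> nat \<Rightarrow> bool" where
  "chord R m i j \<longleftrightarrow> R i j \<and> 1 \<le> i \<and> Suc i < j \<and> j \<le> m"

text \<open>\<open>right_unique\<close>, \<open>left_unique\<close> and \<open>no_chain\<close>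
  together say that the chords form a matching, each chord being directed from its smaller to its
  larger end.\<close>

locale outerpath =
  fixes R :: "nat \<Rightarrow> nat \<Rightarrow> bool" and m :: nat and U :: "nat set"
  assumes sym: "symp R" and irr: "irreflp R"
    and path: "1 \<le> i \<Longrightarrow> i < m \<Longrightarrow> R i (Suc i)"
    and right_unique: "chord R m i j \<Longrightarrow> chord R m i j' \<Longrightarrow> j = j'"
    and left_unique: "chord R m i j \<Longrightarrow> chord R m i' j \<Longrightarrow> i = i'"
    and no_chain: "chord R m i j \<Longrightarrow> chord R m j k \<Longrightarrow> False"
    and noncross: "chord R m a b \<Longrightarrow> chord R m c d \<Longrightarrow> a < c \<Longrightarrow> c < b \<Longrightarrow> d \<le> b"
    and matched: "chord R m i j \<Longrightarrow> i \<notin> U \<and> j \<notin> U"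
begin

definition closed_seg :: "nat \<Rightarrow> nat \<Rightarrow> bool" where
  "closed_seg i j \<longleftrightarrow> (\<forall>a b. chord R m a b \<longrightarrow> (a \<in> {i..j} \<longleftrightarrow> b \<in> {i..j}))"

lemma adj_less:
  "x < y \<Longrightarrow> 1 \<le> x \<Longrightarrow> y \<le> m \<Longrightarrow> R x y \<longleftrightarrow> y = Suc x \<or> chord R m x y"
  using path[of x] by (auto simp: chord_def)

text \<open>Induction from the left end. If no chord starts at \<open>i\<close>, this vertex is a
  first piece by itself. Otherwise the chord at \<open>i\<close> ends at some \<open>Suc k\<close>,
  the segment below it is shorter and again left by no chord, and wrapping it gives a first piece of
  type 1 or 2. What remains to the right is left by no chord either.\<close>

lemma segment_realizable:
  "1 \<le> i \<Longrightarrow> i \<le> j \<Longrightarrow> j \<le> m \<Longrightarrow> closed_seg i j \<Longrightarrow>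
     \<exists>t<12. \<forall>a\<in>set (family ! t). realizable R U i j a"
proof (induction "j - i" arbitrary: i j rule: less_induct)
  case less
  have single0: "\<forall>a\<in>set (family ! 0). realizable R U i i a"
    using family_single realizable_single[of _ i U R] irr by (metis irreflpD)
  show ?case
  proof (cases "\<exists>k. chord R m i k")
    case False
    show ?thesis
    proof (cases "i = j")
      case True
      then show ?thesis using single0 by (intro exI[of _ 0]) auto
    next
      case ij: False
      have cl: "closed_seg (Suc i) j"
        unfolding closed_seg_def
      proof (intro allI impI)
        fix a b assume ab: "chord R m a b"
        then have "a \<noteq> i" using False by auto
        moreover have "a < b" using ab by (auto simp: chord_def)
        moreover have "b \<noteq> i" using less.prems(4) ab unfolding closed_seg_def
          by (metis \<open>a < b\<close> atLeastAtMost_iff less.prems(2) not_le order_refl)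
        moreover have o: "a \<in> {i..j} \<longleftrightarrow> b \<in> {i..j}" using less.prems(4) ab unfolding closed_seg_def by blast
        ultimately show "a \<in> {Suc i..j} \<longleftrightarrow> b \<in> {Suc i..j}"
          by auto
      qed
      obtain t where t: "t < 12" "\<forall>a\<in>set (family ! t). realizable R U (Suc i) j a"
        using less.hyps[of j "Suc i"] less.prems ij cl diff_less_mono2[of i "Suc i" j] by auto
      obtain t' where t': "t' < 12" "cats_to (family ! 0) (family ! t) (family ! t')"
        using family_cat_ex[OF t(1)] by blast
      have cross: "R x y \<longleftrightarrow> x = i \<and> y = Suc i" if "x \<in> {i..i}" "y \<in> {Suc i..j}" for x y
        using that adj_less[of i y] less.prems False by auto
      have "realizable R U i j b" if "b \<in> set (family ! t')" for b
        using cats_to_realizable[OF t'(2) _ _ sym _ _ cross that] single0 t(2) ij less.prems by auto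
      then show ?thesis using t'(1) by blast
    qed
  next
    case True
    then obtain k' where k': "chord R m i k'" by blast
    then obtain k where k: "k' = Suc k" "i < k" by (cases k') (auto simp: chord_def)
    note ik = k'[unfolded k(1)]
    have kj: "Suc k \<le> j" using less.prems(2,4) ik unfolding closed_seg_def by (metis atLeastAtMost_iff order_refl)
    have un: "chord R m a b \<Longrightarrow> (a = i \<or> b = Suc k) \<Longrightarrow> a = i \<and> b = Suc k" for a b
      using left_unique right_unique ik by blast
    have nc: "chord R m a b \<Longrightarrow> a \<noteq> Suc k \<and> b \<noteq> i" for a b
      using no_chain ik by blast
    have cin: "closed_seg (Suc i) k"
      unfolding closed_seg_def
    proof (intro allI impI iffI)
      fix a b assume ab: "chord R m a b" and a: "a \<in> {Suc i..k}"
      have "b \<le> Suc k" using noncross[OF ik ab] a by auto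
      moreover have "b \<noteq> Suc k" using un[OF ab] a by auto
      moreover have "a < b" using ab by (auto simp: chord_def)
      ultimately show "b \<in> {Suc i..k}" using a by auto
    next
      fix a b assume ab: "chord R m a b" and b: "b \<in> {Suc i..k}"
      have lt: "a < b" using ab by (auto simp: chord_def)
      have "a \<noteq> i" using un[OF ab] b by auto
      moreover have "\<not> a < i" using noncross[OF ab ik] b by auto
      ultimately show "a \<in> {Suc i..k}" using lt b by auto
    qed
    have lt: "k - Suc i < j - i" using k(2) kj by linarith
    obtain t where t: "t < 12" "\<forall>a\<in>set (family ! t). realizable R U (Suc i) k a"
      using less.hyps[OF lt] less.prems k cin kj by auto
    obtain t' where t': "t' \<in> {1,2}" "wraps_to (family ! t) (family ! t')"
      using family_wrap_ex[OF t(1)] by blast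
    have U: "i \<notin> U" "Suc k \<notin> U" using matched[OF ik] by auto
    have e1: "R i y \<longleftrightarrow> y = Suc i \<or> y = Suc k" if "y \<in> {Suc i..Suc k}" for y
      using that adj_less[of i y] less.prems kj un ik by auto
    have e2: "R y (Suc k) \<longleftrightarrow> y = i \<or> y = k" if "y \<in> {i..k}" for y
      using that adj_less[of y "Suc k"] less.prems kj un ik by auto
    have w: "realizable R U i (Suc k) b" if "b \<in> set (family ! t')" for b
      using wraps_to_realizable[OF t'(2) _ sym irr _ U e1 e2 that] t(2) k(2) by auto
    show ?thesis
    proof (cases "Suc k = j")
      case True
      then show ?thesis using w t'(1) by (intro exI[of _ t']) auto
    next
      case kj': False
      have cl: "closed_seg (Suc (Suc k)) j"
        unfolding closed_seg_def
      proof (intro allI impI)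
        fix a b assume ab: "chord R m a b"
        have lt: "a < b" using ab by (auto simp: chord_def)
        have o: "a \<in> {i..j} \<longleftrightarrow> b \<in> {i..j}" using less.prems(4) ab unfolding closed_seg_def by blast
        have n: "a \<in> {Suc i..k} \<longleftrightarrow> b \<in> {Suc i..k}" using cin ab unfolding closed_seg_def by blast
        show "a \<in> {Suc (Suc k)..j} \<longleftrightarrow> b \<in> {Suc (Suc k)..j}"
          using o n lt un[OF ab] nc[OF ab] k(2) kj less.prems(2) unfolding atLeastAtMost_iff by presburger
      qed
      have lt': "j - Suc (Suc k) < j - i" using k(2) kj by linarith
      obtain s where s: "s < 12" "\<forall>a\<in>set (family ! s). realizable R U (Suc (Suc k)) j a"
        using less.hyps[OF lt'] less.prems k kj kj' cl by auto
      obtain s' where s': "s' < 12" "cats_to (family ! t') (family ! s) (family ! s')"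
        using family_cat_ex[OF s(1), of t'] t'(1) by blast
      have cross: "R x y \<longleftrightarrow> x = Suc k \<and> y = Suc (Suc k)" if x: "x \<in> {i..Suc k}" and y: "y \<in> {Suc (Suc k)..j}" for x y
      proof -
        have "\<not> chord R m x y"
        proof
          assume c: "chord R m x y"
          have "x \<in> {Suc i..k} \<longleftrightarrow> y \<in> {Suc i..k}" using cin c unfolding closed_seg_def by blast
          then show False using x y un[OF c] nc[OF c] by auto
        qed
        then show ?thesis using x y adj_less[of x y] less.prems k by auto
      qed
      have "realizable R U i j b" if "b \<in> set (family ! s')" for b
        by (rule cats_to_realizable[OF s'(2) _ _ sym _ _ cross that]) (use w s(2) kj kj' k in auto)
      then show ?thesis using s'(1) by blast
    qed
  qed
qed

text \<open>The colored path and the isolated root are put side by side; then the two edges at the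
  root are added one after the other.\<close>

lemma root_extend:
  assumes f: "realizes R U 1 m (x, y, s, q) f" and m: "2 \<le> m"
    and root: "\<And>w. w \<in> {1..m} \<Longrightarrow> R 0 w \<longleftrightarrow> w = 1 \<or> w = m"
    and j1: "join_states (c, F0, False) x = Some (r1, x')" and j2: "join_states r1 y = Some (r, y')"
    and col: "has_col U (\<lambda>_. col) 0 c" and c4: "col \<noteq> Color4"
  shows "good R U {0..m} (f(0 := col)) \<and> has_state R U {0..m} (f(0 := col)) 0 r"
proof -
  define h where "h = f(0 := col)"
  define R1 where "R1 = (\<lambda>u v. R u v \<and> {u, v} \<noteq> {0, 1} \<and> {u, v} \<noteq> {0, m})"
  let ?I = "{0::nat}" and ?J = "{1..m}"
  have s1: "symp R1" using sym by (auto simp: R1_def symp_def insert_commute)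
  have rt: "R 0 1" "R 0 m" "R 1 0" "R m 0"
    using root[of 1] root[of m] m sym by (auto dest: sympD)
  have IJ: "{0..m} = ?I \<union> ?J" using m by auto
  have R: "add_edge (add_edge R1 0 1) 0 m = R"
    using rt by (auto simp: add_edge_def R1_def fun_eq_iff doubleton_eq_iff)
  have RJ: "R u v = R1 u v" if "u \<in> ?J" "v \<in> ?J" for u v
    using that by (auto simp: R1_def doubleton_eq_iff)
  have h: "f u = h u" if "u \<in> ?J" for u using that by (simp add: h_def)
  have gJ: "good R1 U ?J h"
    using f good_cong[of ?J R R1 f h U] RJ h unfolding realizes_def by auto
  have gI: "good R1 U ?I h"
    using irr c4 by (auto simp: good_def R1_def irreflp_def near_def h_def)
  have stJ: "has_state R1 U ?J h k w \<longleftrightarrow> has_state R U ?J f k w" if "k \<in> ?J" for k w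
    using has_state_cong[of ?J R k R1 f h] RJ h that by blast
  have no: "\<not> R1 u v \<and> \<not> R1 v u" if "u \<in> ?I" "v \<in> ?J" for u v
    using that root[of v] sym by (auto simp: R1_def symp_def insert_commute)
  have G: "good R1 U {0..m} h"
    unfolding IJ by (rule good_disjoint_union[OF gI gJ no]) (use c4 in \<open>auto simp: h_def\<close>)
  have SJ: "has_state R1 U {0..m} h k w" if "k \<in> ?J" "has_state R U ?J f k w" for k w
    unfolding IJ Un_commute[of ?I] by (rule has_state_disjoint_union) (use stJ that no in auto)
  have S0: "has_state R1 U {0..m} h 0 (c, F0, False)"
    unfolding IJ
  proof (rule has_state_disjoint_union)
    show "has_state R1 U ?I h 0 (c, F0, False)"
      using col irr by (cases c) (auto simp: h_def R1_def irreflp_def)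
  qed (use no in auto)
  have S1: "has_state R1 U {0..m} h 1 x" "has_state R1 U {0..m} h m y"
    using SJ[of 1 x] SJ[of m y] f m unfolding realizes_def by auto
  have m0: "(0::nat) \<noteq> 1" "0 \<noteq> m" using m by auto
  note A = good_add_edge[OF G s1 m0(1) S0 S1(1) j1]
  have "has_state (add_edge R1 0 1) U {0..m} h m y"
    using S1(2) has_state_add_edge_other[of m 0 1 R1 U "{0..m}" h y] m by simp
  note B = good_add_edge[OF A(1) symp_add_edge[OF s1] m0(2) A(2) this j2, unfolded R]
  show ?thesis using B(1,2) unfolding h_def by blast
qed

lemma rooted_colorings:
  assumes m: "2 \<le> m" and root: "\<And>w. w \<in> {1..m} \<Longrightarrow> R 0 w \<longleftrightarrow> w = 1 \<or> w = m"
  shows "c \<in> {Color1a, Color1b} \<Longrightarrow> \<exists>h. good R U {0..m} h \<and> h 0 = c \<and>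
      (\<forall>z\<in>{0..m}. \<forall>w\<in>{0..m}. near R 0 z \<longrightarrow> near R z w \<longrightarrow> h w \<noteq> Color4)"
    and "\<exists>h. good R U {0..m} h \<and> (\<forall>w\<in>{0..m}. h w \<noteq> Color4) \<and>
      (h 0 = Color2 \<or> h 0 = Color1a \<and> (\<forall>w\<in>{0..m}. R 0 w \<longrightarrow> h w = Color2 \<longrightarrow> w \<notin> U))"
    and "\<exists>h. good R U {0..m} h \<and> h 0 = Color1a \<and> (\<forall>w\<in>{0..m}. R 0 w \<longrightarrow> h w \<noteq> Color2)"
proof -
  have "closed_seg 1 m" by (auto simp: closed_seg_def chord_def)
  then obtain t where t: "t < 12" "\<And>a. a \<in> set (family ! t) \<Longrightarrow> realizable R U 1 m a"
    using segment_realizable[of 1 m] m by auto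
  \<comment> \<open>The states of member 0 require both ends of the path to coincide, which
    \<open>2 \<le> m\<close> excludes.\<close>
  have "t \<noteq> 0"
  proof
    assume "t = 0"
    moreover have "single CA \<in> set (family ! 0)"
      by (simp add: family_def family_half_def single_def)
    ultimately have "realizable R U 1 m (single CA)" using t(2) by blast
    then show False using m by (auto simp: realizable_def realizes_def single_def)
  qed
  then have "family ! t \<in> set (tl family)"
    using t(1) nth_mem[of "t - 1" "tl family"] by (simp add: length_family nth_tl)
  then have ex: "\<exists>a\<in>set (family ! t). root_far CA a" "\<exists>a\<in>set (family ! t). root_far CB a"
    "\<exists>a\<in>set (family ! t). root_no4 a" "\<exists>a\<in>set (family ! t). root_no2 a"
    using family_root unfolding list_all_iff list_ex_iff by blast+
  have root_states: "\<exists>f r1 x' y'. realizes R U 1 m (x, y, s, q) f \<and> join_states (c, F0, False) x = Some (r1, x') \<and>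
      join_states r1 y = Some (r, y')"
    if "(x, y, s, q) \<in> set (family ! t)" "root_state c (x, y, s, q) = Some r" for x y s q c r
    using t(2)[OF that(1)] that(2) unfolding realizable_def by (auto split: option.splits)
  have far: "\<exists>h. good R U {0..m} h \<and> h 0 = c \<and>
      (\<forall>z\<in>{0..m}. \<forall>w\<in>{0..m}. near R 0 z \<longrightarrow> near R z w \<longrightarrow> h w \<noteq> Color4)"
    if a: "\<exists>a\<in>set (family ! t). root_far vc a" and vc: "vc = CA \<and> c = Color1a \<or> vc = CB \<and> c = Color1b" for vc c
  proof -
    obtain d u n e v k s q where *: "((d, u, n), (e, v, k), s, q) \<in> set (family ! t)"
      and rf: "root_far vc ((d, u, n), (e, v, k), s, q)"
      using a by (metis prod_cases3 surj_pair)
    then obtain r where "root_state vc ((d, u, n), (e, v, k), s, q) = Some r" by auto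
    from root_states[OF * this] obtain f r1 x' y' where
      f: "realizes R U 1 m ((d, u, n), (e, v, k), s, q) f" and j: "join_states (vc, F0, False) (d, u, n) = Some (r1, x')"
      "join_states r1 (e, v, k) = Some (r, y')" by blast
    let ?h = "f(0 := c)"
    have G: "good R U {0..m} ?h"
    proof -
      have "has_col U (\<lambda>_. c) 0 vc" "c \<noteq> Color4" using vc by auto
      then show ?thesis using root_extend[OF f m root j] by blast
    qed
    have n: "d \<noteq> CF" "e \<noteq> CF" "\<not> n" "\<not> k" using rf by auto
    have f14: "f 1 \<noteq> Color4" "f m \<noteq> Color4"
    proof -
      have "has_col U f 1 d" "has_col U f m e" using f unfolding realizes_def by auto
      moreover have "has_col U f x d \<Longrightarrow> d \<noteq> CF \<Longrightarrow> f x \<noteq> Color4" for x d by (cases d) auto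
      ultimately show "f 1 \<noteq> Color4" "f m \<noteq> Color4" using n(1,2) by blast+
    qed
    have fn4: "f w \<noteq> Color4" if "w \<in> {1..m}" "R 1 w \<or> R m w" for w
      using f n that unfolding realizes_def by auto
    have "?h w \<noteq> Color4" if "z \<in> {0..m}" "w \<in> {0..m}" "near R 0 z" "near R z w" for z w
    proof (cases "w = 0")
      case True then show ?thesis using vc by auto
    next
      case False
      have "z = 0 \<or> z = 1 \<or> z = m" using that(1,3) root[of z] by (auto simp: near_def)
      then show ?thesis using that(2,4) False root[of w] f14 fn4[of w] by (auto simp: near_def)
    qed
    then show ?thesis using G by (intro exI[of _ ?h]) auto
  qed
  show "c \<in> {Color1a, Color1b} \<Longrightarrow> \<exists>h. good R U {0..m} h \<and> h 0 = c \<and>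
      (\<forall>z\<in>{0..m}. \<forall>w\<in>{0..m}. near R 0 z \<longrightarrow> near R z w \<longrightarrow> h w \<noteq> Color4)"
    using far ex(1,2) by blast
  show "\<exists>h. good R U {0..m} h \<and> h 0 = Color1a \<and> (\<forall>w\<in>{0..m}. R 0 w \<longrightarrow> h w \<noteq> Color2)"
  proof -
    obtain x y s q where *: "(x, y, s, q) \<in> set (family ! t)" and r: "root_no2 (x, y, s, q)"
      using ex(4) by (metis surj_pair)
    from r obtain c n where "root_state CA (x, y, s, q) = Some (c, F0, n)"
      by (auto simp del: root_state.simps split: option.splits)
    from root_states[OF * this] obtain f r1 x' y' where
      f: "realizes R U 1 m (x, y, s, q) f" and j: "join_states (CA, F0, False) x = Some (r1, x')"
      "join_states r1 y = Some ((c, F0, n), y')" by blast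
    let ?h = "f(0 := Color1a)"
    have "good R U {0..m} ?h" "has_state R U {0..m} ?h 0 (c, F0, n)"
      using root_extend[OF f m root j, of Color1a] by simp_all
    then show ?thesis
      by (intro exI[of _ ?h]) (simp del: fun_upd_apply, simp)
  qed
  show "\<exists>h. good R U {0..m} h \<and> (\<forall>w\<in>{0..m}. h w \<noteq> Color4) \<and>
      (h 0 = Color2 \<or> h 0 = Color1a \<and> (\<forall>w\<in>{0..m}. R 0 w \<longrightarrow> h w = Color2 \<longrightarrow> w \<notin> U))"
  proof -
    obtain x y s q where *: "(x, y, s, q) \<in> set (family ! t)" and r: "root_no4 (x, y, s, q)"
      using ex(3) by (metis surj_pair)
    have q: "\<not> q" using r by simp
    have no4: "\<forall>w\<in>{0..m}. (f(0 := col)) w \<noteq> Color4" if "realizes R U 1 m (x, y, s, q) f" "col \<noteq> Color4" for f col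
      using that q by (auto simp: realizes_def Suc_le_eq)
    consider r where "root_state CD (x, y, s, q) = Some r"
      | c u n where "root_state CA (x, y, s, q) = Some (c, u, n)" "u \<noteq> F2"
      using r by (auto simp del: root_state.simps split: option.splits)
    then show ?thesis
    proof cases
      case 1
      from root_states[OF * 1] obtain f r1 x' y' where
        f: "realizes R U 1 m (x, y, s, q) f" and j: "join_states (CD, F0, False) x = Some (r1, x')"
        "join_states r1 y = Some (r, y')" by blast
      have "good R U {0..m} (f(0 := Color2))"
        using root_extend[OF f m root j, of Color2] by simp
      then show ?thesis
        using no4[OF f, of Color2] by (intro exI[of _ "f(0 := Color2)"]) simp
    next
      case 2
      from root_states[OF * 2(1)] obtain f r1 x' y' where
        f: "realizes R U 1 m (x, y, s, q) f" and j: "join_states (CA, F0, False) x = Some (r1, x')"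
        "join_states r1 y = Some ((c, u, n), y')" by blast
      let ?h = "f(0 := Color1a)"
      have "good R U {0..m} ?h" "has_state R U {0..m} ?h 0 (c, u, n)"
        using root_extend[OF f m root j, of Color1a] by simp_all
      moreover from this(2) 2(2) have "\<forall>w\<in>{0..m}. R 0 w \<longrightarrow> ?h w = Color2 \<longrightarrow> w \<notin> U"
        by (cases u) (simp_all del: fun_upd_apply)
      ultimately show ?thesis
        using no4[OF f, of Color1a] by (intro exI[of _ ?h]) simp
    qed
  qed
qed

end

section \<open>Bridgeless pieces\<close>

lemma gpath_slice:
  assumes "distinct C" "successively (\<lambda>x y. {x, y} \<in> F) C" "i \<le> j" "j < length C"
  shows "gpath F (map ((!) C) [i..<Suc j]) (C ! i) (C ! j)"
  using assms unfolding gpath_def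
  by (auto simp: hd_map last_map distinct_map inj_on_def nth_eq_iff_index_eq successively_conv_nth simp del: upt_Suc)

locale chorded_cycle =
  fixes S :: "'a set" and F :: "'a set set" and C :: "'a list"
  assumes graph: "simple_graph S F" and cyc: "cycle F C" and set_C: "set C = S"
    and deg: "\<And>v. v \<in> S \<Longrightarrow> vdegree F v \<le> 3" and K4: "K4_free F"
begin

abbreviation n :: nat where "n \<equiv> length C"

definition adj :: "nat \<Rightarrow> nat \<Rightarrow> bool" where
  "adj i j \<longleftrightarrow> i < n \<and> j < n \<and> {C ! i, C ! j} \<in> F"

lemma n3: "3 \<le> n" and dist: "distinct C" and walk: "successively (\<lambda>x y. {x, y} \<in> F) C"
  and close: "{last C, hd C} \<in> F"
  using cyc by (auto simp: cycle_def)

lemma adj_Suc: "Suc i < n \<Longrightarrow> adj i (Suc i)"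
  using successively_nth[OF walk] by (auto simp: adj_def)

lemma adj_sym: "adj i j \<Longrightarrow> adj j i"
  by (auto simp: adj_def insert_commute)

lemma adj_wrap: "adj 0 (n - 1)"
proof -
  have "C \<noteq> []" using n3 by auto
  then show ?thesis using close by (auto simp: adj_def hd_conv_nth last_conv_nth insert_commute)
qed

lemma adj_irrefl: "\<not> adj i i"
  using simple_graph_edge[OF graph, of "C ! i" "C ! i"] by (auto simp: adj_def)

lemma adj_distinct:
  assumes "\<And>j. j \<in> N \<Longrightarrow> adj i j"
  shows "card N \<le> vdegree F (C ! i)"
proof -
  have "inj_on ((!) C) N"
    using assms dist by (auto simp: inj_on_def adj_def nth_eq_iff_index_eq)
  then have "card N = card ((!) C ` N)" by (simp add: card_image)
  also have "\<dots> \<le> vdegree F (C ! i)"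
    by (rule card_nbrs_le_vdegree[OF graph]) (use assms in \<open>auto simp: adj_def\<close>)
  finally show ?thesis .
qed

lemma adj_three:
  assumes "adj i a" "adj i b" "adj i c" "distinct [a, b, c]"
  shows "3 \<le> vdegree F (C ! i)"
proof -
  have "card {a, b, c} = 3" using assms(4) by simp
  then show ?thesis using adj_distinct[of "{a, b, c}" i] assms(1-3) by auto
qed

lemma adj_four:
  assumes "adj i a" "adj i b" "adj i c" "adj i d" "distinct [a, b, c, d]"
  shows False
proof -
  have "card {a, b, c, d} = 4" using assms(5) by simp
  then have "4 \<le> vdegree F (C ! i)" using adj_distinct[of "{a, b, c, d}" i] assms(1-4) by auto
  moreover have "C ! i \<in> S" using assms(1) set_C nth_mem by (auto simp: adj_def)
  ultimately show False using deg by fastforce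
qed

lemma slice_set: "set (map ((!) C) [i..<Suc j]) = (!) C ` {i..j}"
  by (auto simp: image_iff Bex_def less_Suc_eq_le)

lemma nth_image_Int:
  assumes "A \<subseteq> {..<n}" "B \<subseteq> {..<n}"
  shows "(!) C ` A \<inter> (!) C ` B = (!) C ` (A \<inter> B)"
  by (rule inj_on_image_Int[symmetric, where C = "{..<n}"])
    (use assms dist in \<open>auto simp: inj_on_def nth_eq_iff_index_eq\<close>)

text \<open>The ends of two crossing chords divide the cycle into four paths, which together with
  the chords form a subdivided complete graph on four vertices.\<close>

lemma no_crossing:
  assumes ij: "adj i j" and kl: "adj k l" and o: "i < k" "k < j" "j < l"
  shows False
proof -
  have l: "l < n" using kl by (simp add: adj_def)
  let ?s = "\<lambda>i j. map ((!) C) [i..<Suc j]"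
  \<comment> \<open>The fourth path passes the seam of the list, from \<open>n - 1\<close> on to
    \<open>0\<close>.\<close>
  let ?P = "?s i k" and ?Q = "?s k j" and ?S = "?s j l" and ?T = "?s l (n - 1) @ ?s 0 i"
  have P: "gpath F ?P (C ! i) (C ! k)" and Q: "gpath F ?Q (C ! k) (C ! j)" and S: "gpath F ?S (C ! j) (C ! l)"
    by (rule gpath_slice[OF dist walk]; use o l in simp)+
  have T1: "gpath F (?s l (n - 1)) (C ! l) (C ! (n - 1))" and T2: "gpath F (?s 0 i) (C ! 0) (C ! i)"
    by (rule gpath_slice[OF dist walk]; use o l in simp)+
  have sT: "set ?T = (!) C ` ({l..n-1} \<union> {0..i})"
    using slice_set[of l "n-1"] slice_set[of 0 i] by (simp add: image_Un del: upt_Suc)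
  have T: "gpath F ?T (C ! l) (C ! i)"
  proof -
    have "set (?s l (n - 1)) \<inter> set (?s 0 i) = {}"
      unfolding slice_set using l o n3 by (subst nth_image_Int) auto
    then show ?thesis
      using T1 T2 adj_sym[OF adj_wrap] unfolding gpath_def
      by (auto simp: successively_append_iff adj_def simp del: upt_Suc)
  qed
  have len: "2 \<le> length ?P" "2 \<le> length ?Q" "2 \<le> length ?S" "2 \<le> length ?T" using o l by auto
  have I: "set ?P \<inter> set ?Q \<subseteq> {C ! k}" "set ?Q \<inter> set ?S \<subseteq> {C ! j}"
    "set ?S \<inter> set ?T \<subseteq> {C ! l}" "set ?T \<inter> set ?P \<subseteq> {C ! i}" "set ?P \<inter> set ?S = {}" "set ?Q \<inter> set ?T = {}"
    unfolding sT slice_set using o l by (subst nth_image_Int; auto)+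
  have "{C ! i, C ! j} \<in> F" "{C ! k, C ! l} \<in> F" using ij kl by (auto simp: adj_def)
  from K4[unfolded K4_free_def, rule_format, OF P Q S T this len I] show False .
qed

lemma adj_cyclic_nbrs:
  assumes "1 \<le> i" "Suc i < n" shows "adj i (i - 1)" "adj i (Suc i)"
  using adj_Suc[of i] adj_Suc[of "i - 1", THEN adj_sym] assms by auto

lemma adj_cyclic_Suc: "j < n \<Longrightarrow> adj j (if Suc j = n then 0 else Suc j)"
proof (cases "Suc j = n")
  case True
  then have "j = n - 1" by simp
  then show ?thesis using adj_sym[OF adj_wrap] True by simp
qed (use adj_Suc in auto)

text \<open>Every vertex has two neighbors on the cycle, so degree at most three leaves room for at
  most one chord, and a vertex on a chord has degree three, too large for \<open>U\<close>. The path
  consists of the indices \<open>1\<close> to \<open>n - 1\<close>, with \<open>0\<close> as the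
  root.\<close>

lemma outerpath_adj:
  assumes U: "\<And>y. y \<in> U \<Longrightarrow> vdegree F y \<le> 2"
  shows "outerpath adj (n - 1) {i. i < n \<and> C ! i \<in> U}"
proof
  show "symp adj" by (auto simp: symp_def adj_sym)
  show "irreflp adj" by (auto simp: irreflp_def adj_irrefl)
next
  fix i assume "1 \<le> i" "i < n - 1"
  then show "adj i (Suc i)" by (intro adj_Suc) simp
next
  fix i j j' assume c: "chord adj (n - 1) i j" "chord adj (n - 1) i j'"
  then have i: "1 \<le> i" "Suc i < n" and j: "Suc i < j" "Suc i < j'" "adj i j" "adj i j'" by (auto simp: chord_def)
  show "j = j'"
  proof (rule ccontr)
    assume "j \<noteq> j'"
    then have "distinct [i - 1, Suc i, j, j']" using i j by auto
    then show False using adj_four[of i "i - 1" "Suc i" j j'] adj_cyclic_nbrs[OF i] j by blast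
  qed
next
  fix i i' j assume c: "chord adj (n - 1) i j" "chord adj (n - 1) i' j"
  show "i = i'"
  proof (rule ccontr)
    assume ne: "i \<noteq> i'"
    have a: "adj j (j - 1)" using c adj_Suc[of "j - 1", THEN adj_sym] by (auto simp: chord_def)
    \<comment> \<open>The last index has \<open>0\<close> as its successor on the cycle. This
      differs from \<open>i\<close> and \<open>i'\<close>, since chords of the path avoid
      \<open>0\<close>.\<close>
    define k where "k = (if Suc j = n then 0 else Suc j)"
    have "adj j k" unfolding k_def by (rule adj_cyclic_Suc) (use c n3 in \<open>auto simp: chord_def\<close>)
    moreover have "distinct [j - 1, k, i, i']" using c ne by (auto simp: chord_def k_def)
    ultimately show False using adj_four[OF a, of k i i'] c adj_sym by (auto simp: chord_def)
  qed
next
  fix i j k assume c: "chord adj (n - 1) i j" "chord adj (n - 1) j k"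
  then have a: "adj j (j - 1)" "adj j (Suc j)" using adj_cyclic_nbrs[of j] by (auto simp: chord_def)
  have "distinct [j - 1, Suc j, i, k]" using c by (auto simp: chord_def)
  then show False using adj_four[OF a, of i k] c adj_sym by (auto simp: chord_def)
next
  fix a b c d assume "chord adj (n - 1) a b" "chord adj (n - 1) c d" "a < c" "c < b"
  then show "d \<le> b" using no_crossing[of a b c d] by (force simp: chord_def)
next
  fix i j assume c: "chord adj (n - 1) i j"
  have "3 \<le> vdegree F (C ! i)"
  proof -
    have i: "1 \<le> i" "Suc i < n" "adj i j" and "Suc i < j" using c by (auto simp: chord_def)
    then have "distinct [i - 1, Suc i, j]" by auto
    then show ?thesis using adj_three[of i "i - 1" "Suc i" j] adj_cyclic_nbrs[OF i(1,2)] i(3) by blast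
  qed
  moreover have "3 \<le> vdegree F (C ! j)"
  proof -
    have a: "adj j (j - 1)" using c adj_Suc[of "j - 1", THEN adj_sym] by (auto simp: chord_def)
    define k where "k = (if Suc j = n then 0 else Suc j)"
    have "adj j k" unfolding k_def by (rule adj_cyclic_Suc) (use c n3 in \<open>auto simp: chord_def\<close>)
    moreover have "distinct [j - 1, k, i]" using c by (auto simp: chord_def k_def)
    ultimately show ?thesis using adj_three[OF a, of k i] c adj_sym by (auto simp: chord_def)
  qed
  ultimately show "i \<notin> {i. i < n \<and> C ! i \<in> U} \<and> j \<notin> {i. i < n \<and> C ! i \<in> U}"
    using U by fastforce
qed

lemma root_adj:
  assumes "vdegree F (C ! 0) \<le> 2" "w \<in> {1..n - 1}"
  shows "adj 0 w \<longleftrightarrow> w = 1 \<or> w = n - 1"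
proof
  assume w: "adj 0 w"
  show "w = 1 \<or> w = n - 1"
  proof (rule ccontr)
    assume "\<not> (w = 1 \<or> w = n - 1)"
    then have "distinct [1, n - 1, w]" using n3 by auto
    then show False using adj_three[of 0 1 "n - 1" w] w adj_wrap adj_Suc[of 0] n3 assms by auto
  qed
qed (use adj_wrap adj_Suc[of 0] n3 in auto)

text \<open>The vertex right after the first end of a shortest chord lies on no chord.\<close>

lemma ex_small_degree: "\<exists>v\<in>S. vdegree F v \<le> 2"
proof (rule ccontr)
  assume "\<not> ?thesis"
  then have big: "3 \<le> vdegree F (C ! i)" if "i < n" for i
    using that set_C nth_mem by fastforce
  have third: "\<exists>k. adj i k \<and> k \<noteq> a \<and> k \<noteq> b" if "i < n" for i a b
  proof (rule ccontr)
    assume no: "\<not> ?thesis"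
    have "vdegree F (C ! i) \<le> card {C ! a, C ! b}"
    proof (rule vdegree_le_card_nbrs[OF graph])
      fix y assume y: "{C ! i, y} \<in> F"
      then obtain k where "k < n" "y = C ! k"
        using simple_graph_edge[OF graph y] set_C by (metis in_set_conv_nth)
      then show "y \<in> {C ! a, C ! b}" using no y that by (auto simp: adj_def)
    qed simp
    also have "\<dots> \<le> 2" by (simp add: card_insert_if)
    finally show False using big[OF that] by simp
  qed
  \<comment> \<open>The pair \<open>(0, n - 1)\<close> is the closing edge of the cycle, not a
    chord.\<close>
  define P where "P = (\<lambda>(i, j). adj i j \<and> Suc i < j \<and> (i, j) \<noteq> (0, n - 1))"
  obtain k0 where "adj 0 k0" "k0 \<noteq> 1" "k0 \<noteq> n - 1" using third[of 0 1 "n - 1"] n3 by fastforce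
  moreover from this have "k0 \<noteq> 0" using adj_irrefl by metis
  ultimately have "P (0, k0)" unfolding P_def by simp
  then obtain c where c: "P c" and min: "\<And>d. P d \<Longrightarrow> snd c - fst c \<le> snd d - fst d"
    using ex_has_least_nat[of P "(0, k0)" "\<lambda>c. snd c - fst c"] by blast
  obtain i j where ij: "c = (i, j)" by (cases c)
  have a: "adj i j" "Suc i < j" "(i, j) \<noteq> (0, n - 1)" using c unfolding P_def ij by auto
  have jn: "j < n" using a(1) by (simp add: adj_def)
  obtain k where k: "adj (Suc i) k" "k \<noteq> i" "k \<noteq> Suc (Suc i)" using third[of "Suc i" i "Suc (Suc i)"] a(2) jn by fastforce
  have k': "k \<noteq> Suc i" "k < n" using k(1) adj_irrefl by (auto simp: adj_def)
  consider "Suc (Suc i) < k" "k \<le> j" | "j < k" | "k < i" using k(2,3) k' by linarith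
  then show False
  proof cases
    case 1
    then have "P (Suc i, k)" using k unfolding P_def by simp
    from min[OF this] show False using 1 unfolding ij by simp
  next
    case 2
    then show False using no_crossing[OF a(1) k(1)] a(2) by simp
  next
    case 3
    then show False using no_crossing[OF adj_sym[OF k(1)] a(1)] a(2) by simp
  qed
qed

lemma transport_coloring:
  assumes "good adj {i. i < n \<and> C ! i \<in> U} {0..n - 1} h"
  shows "\<exists>g. good (\<lambda>x y. {x, y} \<in> F) U S g \<and> (\<forall>i<n. g (C ! i) = h i)"
proof -
  define g where "g = (\<lambda>x. h (the_inv_into {..<n} ((!) C) x))"
  have "inj_on ((!) C) {..<n}" using dist by (auto simp: inj_on_def nth_eq_iff_index_eq)
  then have g: "g (C ! i) = h i" if "i < n" for i
    using that by (simp add: g_def the_inv_into_f_f)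
  have S: "S = (!) C ` {0..n - 1}"
    using set_C n3 by (auto simp: set_conv_nth)
  have lt: "i < n" if "i \<in> {0..n - 1}" for i using that n3 by auto
  have near: "near (\<lambda>x y. {x, y} \<in> F) (C ! i) (C ! j) \<longleftrightarrow> near adj i j" if "i < n" "j < n" for i j
    using that dist by (auto simp: near_def adj_def nth_eq_iff_index_eq)
  have "good (\<lambda>x y. {x, y} \<in> F) U S g"
    using assms lt unfolding good_def S ball_simps(9) by (simp add: g near adj_def nth_eq_iff_index_eq[OF dist])
  then show ?thesis using g by blast
qed

end

abbreviation edge_rel :: "'a set set \<Rightarrow> 'a \<Rightarrow> 'a \<Rightarrow> bool" where
  "edge_rel E \<equiv> \<lambda>x y. {x, y} \<in> E"

text \<open>Color 2 at the root is offered only if \<open>S\<close> is not a single vertex: then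
  bridgelessness gives \<open>v\<close> two edges in \<open>S\<close>, hence degree three together
  with the bridge, and (B) does not apply to \<open>v\<close>.\<close>

lemma bridgeless_root_colorings:
  assumes graph: "simple_graph S F" "bridgeless S F" and free: "theta_free F" "K4_free F"
    and deg: "\<And>y. y \<in> S \<Longrightarrow> vdegree F y \<le> 3" and v: "v \<in> S" "vdegree F v \<le> 2"
    and U: "\<And>y. y \<in> U \<Longrightarrow> vdegree F y \<le> 2"
  shows "c \<in> {Color1a, Color1b} \<Longrightarrow> \<exists>g. good (edge_rel F) U S g \<and> g v = c \<and>
      (\<forall>z\<in>S. \<forall>w\<in>S. near (edge_rel F) v z \<longrightarrow> near (edge_rel F) z w \<longrightarrow> g w \<noteq> Color4)"
    and "\<exists>g. good (edge_rel F) U S g \<and> (\<forall>w\<in>S. g w \<noteq> Color4) \<and>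
      (g v = Color2 \<and> S \<noteq> {v} \<or> g v = Color1a \<and> (\<forall>w\<in>S. {v, w} \<in> F \<longrightarrow> g w = Color2 \<longrightarrow> w \<notin> U))"
    and "\<exists>g. good (edge_rel F) U S g \<and> g v = Color1a \<and> (\<forall>w\<in>S. {v, w} \<in> F \<longrightarrow> g w \<noteq> Color2)"
proof -
  let ?i = "\<lambda>c. \<exists>g. good (edge_rel F) U S g \<and> g v = c \<and>
      (\<forall>z\<in>S. \<forall>w\<in>S. near (edge_rel F) v z \<longrightarrow> near (edge_rel F) z w \<longrightarrow> g w \<noteq> Color4)"
  let ?ii = "\<exists>g. good (edge_rel F) U S g \<and> (\<forall>w\<in>S. g w \<noteq> Color4) \<and>
      (g v = Color2 \<and> S \<noteq> {v} \<or> g v = Color1a \<and> (\<forall>w\<in>S. {v, w} \<in> F \<longrightarrow> g w = Color2 \<longrightarrow> w \<notin> U))"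
  let ?iii = "\<exists>g. good (edge_rel F) U S g \<and> g v = Color1a \<and> (\<forall>w\<in>S. {v, w} \<in> F \<longrightarrow> g w \<noteq> Color2)"
  have "(\<forall>c\<in>{Color1a, Color1b}. ?i c) \<and> ?ii \<and> ?iii"
  proof (cases "S = {v}")
    case True
    have "{v} \<notin> F" using graph(1) unfolding simple_graph_def by force
    then have *: "good (edge_rel F) U S (\<lambda>_. c)" "near (edge_rel F) v v" if "c \<in> {Color1a, Color1b}" for c
      using that True by (auto simp: good_def near_def)
    have "?i c" if "c \<in> {Color1a, Color1b}" for c
      by (rule exI[of _ "\<lambda>_. c"]) (use *[OF that] that in auto)
    moreover have ?ii by (rule exI[of _ "\<lambda>_. Color1a"]) (use * in auto)
    moreover have ?iii by (rule exI[of _ "\<lambda>_. Color1a"]) (use * in auto)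
    ultimately show ?thesis by blast
  next
    case False
    then obtain y where y: "y \<in> S" "v \<noteq> y" using v by blast
    obtain C0 where C0: "cycle F C0" "set C0 = S"
      using hamiltonian_cycle[OF graph v(1) y(1) y(2) deg free(1)] by blast
    \<comment> \<open>The cycle is rotated so that the root gets index \<open>0\<close>.\<close>
    then obtain ys where ys: "cycle F (v # ys)" "set (v # ys) = S"
      using cycle_rotate_to[of F C0 v] v(1) by metis
    interpret chorded_cycle S F "v # ys"
      using graph ys deg free by unfold_locales
    let ?n = "length (v # ys)"
    let ?U = "{i. i < ?n \<and> (v # ys) ! i \<in> U}"
    interpret outerpath adj "?n - 1" ?U by (rule outerpath_adj[OF U])
    have m: "2 \<le> ?n - 1" using n3 by simp
    have root: "adj 0 w \<longleftrightarrow> w = 1 \<or> w = ?n - 1" if "w \<in> {1..?n - 1}" for w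
      using root_adj[OF _ that] v(2) by simp
    note R = rooted_colorings[OF m root]
    have in_S: "w \<in> S \<Longrightarrow> \<exists>i<?n. w = (v # ys) ! i" for w
      using ys(2) by (metis in_set_conv_nth)
    have at: "(v # ys) ! 0 = v" by simp
    have adj_iff: "adj i j \<longleftrightarrow> {(v # ys) ! i, (v # ys) ! j} \<in> F" if "i < ?n" "j < ?n" for i j
      using that by (simp add: adj_def)
    have near_iff: "near adj i j \<longleftrightarrow> near (edge_rel F) ((v # ys) ! i) ((v # ys) ! j)" if "i < ?n" "j < ?n" for i j
      using that adj_iff[OF that] dist by (simp add: near_def nth_eq_iff_index_eq del: nth_Cons_0 nth_Cons_Suc)
    have 0: "0 < ?n" by simp
    have I: "i \<in> {0..?n - 1} \<longleftrightarrow> i < ?n" for i by auto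
    have "?i c" if cc: "c \<in> {Color1a, Color1b}" for c
    proof -
      obtain h where h: "good adj ?U {0..?n - 1} h" "h 0 = c"
        "\<forall>z\<in>{0..?n - 1}. \<forall>w\<in>{0..?n - 1}. near adj 0 z \<longrightarrow> near adj z w \<longrightarrow> h w \<noteq> Color4"
        using R(1)[OF _ cc] by blast
      obtain g where g: "good (edge_rel F) U S g" "\<forall>i<?n. g ((v # ys) ! i) = h i"
        using transport_coloring[OF h(1)] by blast
      have "g w \<noteq> Color4" if zw: "z \<in> S" "w \<in> S" "near (edge_rel F) v z" "near (edge_rel F) z w" for z w
      proof -
        obtain i j where ij: "i < ?n" "z = (v # ys) ! i" "j < ?n" "w = (v # ys) ! j"
          using in_S zw by metis
        then have "near adj 0 i" "near adj i j" using near_iff[OF 0 ij(1)] near_iff[OF ij(1,3)] zw at by auto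
        then show ?thesis using h(3) g(2) ij unfolding I by auto
      qed
      moreover have "g v = c" using g(2) h(2) by force
      ultimately show ?thesis using g(1) by blast
    qed
    moreover have ?iii
    proof -
      obtain h where h: "good adj ?U {0..?n - 1} h" "h 0 = Color1a"
        "\<forall>w\<in>{0..?n - 1}. adj 0 w \<longrightarrow> h w \<noteq> Color2"
        using R(3) by blast
      obtain g where g: "good (edge_rel F) U S g" "\<forall>i<?n. g ((v # ys) ! i) = h i"
        using transport_coloring[OF h(1)] by blast
      have "g w \<noteq> Color2" if zw: "w \<in> S" "{v, w} \<in> F" for w
      proof -
        obtain j where ij: "j < ?n" "w = (v # ys) ! j"
          using in_S zw by metis
        then have "adj 0 j" using adj_iff[OF 0 ij(1)] zw at by auto
        then show ?thesis using h(3) g(2) ij unfolding I by auto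
      qed
      moreover have "g v = Color1a" using g(2) h(2) by force
      ultimately show ?thesis using g(1) by blast
    qed
    moreover have ?ii
    proof -
      obtain h where h: "good adj ?U {0..?n - 1} h" "\<forall>w\<in>{0..?n - 1}. h w \<noteq> Color4"
        "h 0 = Color2 \<or> h 0 = Color1a \<and> (\<forall>w\<in>{0..?n - 1}. adj 0 w \<longrightarrow> h w = Color2 \<longrightarrow> w \<notin> ?U)"
        using R(2) by blast
      obtain g where g: "good (edge_rel F) U S g" "\<forall>i<?n. g ((v # ys) ! i) = h i"
        using transport_coloring[OF h(1)] by blast
      have gv: "g v = h 0" using g(2) by force
      have "g w \<noteq> Color4" if "w \<in> S" for w
        using in_S[OF that] h(2) g(2) unfolding I by auto
      moreover have "h 0 = Color1a \<longrightarrow> (\<forall>w\<in>S. {v, w} \<in> F \<longrightarrow> g w = Color2 \<longrightarrow> w \<notin> U)"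
      proof (intro impI ballI)
        fix w assume h0: "h 0 = Color1a" and zw: "w \<in> S" "{v, w} \<in> F" and gw: "g w = Color2"
        obtain j where ij: "j < ?n" "w = (v # ys) ! j"
          using in_S zw by metis
        then have "adj 0 j" using adj_iff[OF 0 ij(1)] zw at by auto
        then have "j \<notin> ?U" using h(3) h0 g(2) gw ij unfolding I by auto
        then show "w \<notin> U" using ij by simp
      qed
      moreover have "h 0 = Color2 \<or> h 0 = Color1a" using h(3) by blast
      ultimately show ?thesis using g(1) gv False by (intro exI[of _ g]) auto
    qed
    ultimately show ?thesis by blast
  qed
  then show "c \<in> {Color1a, Color1b} \<Longrightarrow> ?i c" ?ii ?iii by blast+
qed

text \<open>As \<open>near\<close> is reflexive, its fourth power means distance at most four, and
  two \<open>near\<close> steps mean distance at most two.\<close>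

definition admissible :: "'a set \<Rightarrow> 'a set set \<Rightarrow> ('a \<Rightarrow> color) \<Rightarrow> bool" where
  "admissible V E f \<longleftrightarrow>
     (\<forall>x y. {x, y} \<in> E \<longrightarrow> f x \<noteq> f y) \<and>
     (\<forall>x\<in>V. \<forall>y\<in>V. \<forall>z. near (edge_rel E) x z \<longrightarrow> near (edge_rel E) z y \<longrightarrow> f y = Color2 \<longrightarrow>
        (f x = Color2 \<longrightarrow> x = y) \<and> (f x = Color4 \<longrightarrow> \<not> vdegree E y \<le> 2)) \<and>
     (\<forall>x\<in>V. \<forall>y\<in>V. f x = Color4 \<longrightarrow> f y = Color4 \<longrightarrow> (near (edge_rel E) ^^ 4) x y \<longrightarrow> x = y) \<and>
     (\<forall>W H. subgraph W H V E \<longrightarrow> nonseparable W H \<longrightarrow>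
        (\<forall>x\<in>W. \<forall>y\<in>W. f x = Color4 \<longrightarrow> f y = Color4 \<longrightarrow> x = y))"

context
  fixes V :: "'a set" and E :: "'a set set" and f :: "'a \<Rightarrow> color"
  assumes f: "admissible V E f"
begin

lemmas admissible_conjs = f[unfolded admissible_def]

lemma admissible_proper: "{x, y} \<in> E \<Longrightarrow> f x \<noteq> f y"
  using admissible_conjs[THEN conjunct1] by blast

lemma admissible_near:
  "x \<in> V \<Longrightarrow> y \<in> V \<Longrightarrow> near (edge_rel E) x z \<Longrightarrow> near (edge_rel E) z y \<Longrightarrow> f y = Color2 \<Longrightarrow>
     (f x = Color2 \<longrightarrow> x = y) \<and> (f x = Color4 \<longrightarrow> \<not> vdegree E y \<le> 2)"
  using admissible_conjs[THEN conjunct2, THEN conjunct1] by blast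

lemma admissible_far:
  "x \<in> V \<Longrightarrow> y \<in> V \<Longrightarrow> f x = Color4 \<Longrightarrow> f y = Color4 \<Longrightarrow> (near (edge_rel E) ^^ 4) x y \<Longrightarrow> x = y"
  using admissible_conjs[THEN conjunct2, THEN conjunct2, THEN conjunct1] by blast

lemma admissible_block:
  "subgraph W H V E \<Longrightarrow> nonseparable W H \<Longrightarrow> x \<in> W \<Longrightarrow> y \<in> W \<Longrightarrow> f x = Color4 \<Longrightarrow> f y = Color4 \<Longrightarrow> x = y"
  using admissible_conjs[THEN conjunct2, THEN conjunct2, THEN conjunct2] by blast

end

text \<open>A new color 1 can only remove occurrences of colors 2 and 4, so just properness has to
  be checked.\<close>

lemma admissible_update:
  assumes "admissible V E f" "\<And>y. {x, y} \<in> E \<Longrightarrow> f y \<noteq> c" "c \<in> {Color1a, Color1b}" "simple_graph V E"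
  shows "admissible V E (f(x := c))"
proof -
  let ?f = "f(x := c)"
  have eq: "?f y = Color2 \<Longrightarrow> f y = Color2" "?f y = Color4 \<Longrightarrow> f y = Color4" for y
    using assms(3) by (auto split: if_splits)
  have "?f y \<noteq> ?f z" if "{y, z} \<in> E" for y z
  proof -
    have "y \<noteq> z" "{z, y} \<in> E" "f y \<noteq> f z"
      using that assms(1) simple_graph_edge[OF assms(4) that] unfolding admissible_def
      by (auto simp: insert_commute)
    then show ?thesis using assms(2)[of z] assms(2)[of y] that by (cases "x = y"; cases "x = z") simp_all
  qed
  then show ?thesis
    using assms(1) eq unfolding admissible_def by meson
qed

text \<open>If both colors 1 occur next to \<open>u\<close>, the two neighbors that carry them are
  all its neighbors. So in the second outcome neither 2 nor 4 occurs next to \<open>u\<close>, and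
  its degree is exactly two: this is what the gluing needs when \<open>u\<close> itself has color 2
  or 4.\<close>

lemma admissible_normalize:
  assumes f: "admissible V E f" and graph: "simple_graph V E" and deg: "vdegree E u \<le> 2"
  obtains h where "admissible V E h" "h u \<in> {Color1a, Color1b}"
  | h where "admissible V E h" "vdegree E u = 2" "\<And>y. {u, y} \<in> E \<Longrightarrow> h y \<in> {Color1a, Color1b}"
proof (cases "\<exists>c\<in>{Color1a, Color1b}. \<forall>y. {u, y} \<in> E \<longrightarrow> f y \<noteq> c")
  case True
  then obtain c where c: "c \<in> {Color1a, Color1b}" "\<And>y. {u, y} \<in> E \<Longrightarrow> f y \<noteq> c" by blast
  show thesis using that(1)[OF admissible_update[OF f c(2,1) graph]] c by simp
next
  case False
  then obtain a b where ab: "{u, a} \<in> E" "f a = Color1a" "{u, b} \<in> E" "f b = Color1b" by blast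
  then have ne: "a \<noteq> b" by auto
  have "card {a, b} \<le> vdegree E u"
    by (rule card_nbrs_le_vdegree[OF graph]) (use ab in auto)
  then have 2: "vdegree E u = 2" using deg ne by simp
  have "f y \<in> {Color1a, Color1b}" if y: "{u, y} \<in> E" for y
  proof (rule ccontr)
    assume "f y \<notin> {Color1a, Color1b}"
    then have "y \<noteq> a" "y \<noteq> b" using ab by auto
    then have "card {a, b, y} = 3" using ne by auto
    moreover have "card {a, b, y} \<le> vdegree E u"
      by (rule card_nbrs_le_vdegree[OF graph]) (use ab y in auto)
    ultimately show False using deg by simp
  qed
  then show thesis using that(2)[OF f 2] by blast
qed

section \<open>Powers of \<open>near\<close> and distances\<close>

lemma near_refl [simp]: "near R x x"
  by (simp add: near_def)

lemma relpowp_near_mono: "(near R ^^ a) x y \<Longrightarrow> a \<le> b \<Longrightarrow> (near R ^^ b) x y"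
proof (induction b)
  case (Suc b)
  show ?case
  proof (cases "a = Suc b")
    case False
    then have "(near R ^^ b) x y" using Suc by auto
    then show ?thesis using near_refl relpowp_Suc_I by metis
  qed (use Suc in auto)
qed auto

lemma relpowp_near_sym: "symp R \<Longrightarrow> (near R ^^ n) x y \<Longrightarrow> (near R ^^ n) y x"
proof (induction n arbitrary: y)
  case (Suc n)
  then obtain z where "(near R ^^ n) x z" "near R z y" by auto
  moreover from this have "near R y z" using Suc.prems(1) by (auto simp: near_def symp_def)
  ultimately show ?case using Suc relpowp_Suc_I2[of "near R" y z n x] by blast
qed auto

lemma relpowp_near_2: "(near R ^^ 2) x y \<longleftrightarrow> (\<exists>z. near R x z \<and> near R z y)"
  by (auto simp: numeral_2_eq_2 relcompp_apply)

lemma walk_relpowp: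
  "walk_betw V E x xs y \<Longrightarrow> length xs - 1 \<le> n \<Longrightarrow> (near (edge_rel E) ^^ n) x y"
proof -
  have "successively (edge_rel E) xs \<Longrightarrow> xs \<noteq> [] \<Longrightarrow> (near (edge_rel E) ^^ (length xs - 1)) (hd xs) (last xs)"
  proof (induction xs)
    case (Cons a xs)
    show ?case
    proof (cases xs)
      case (Cons b ys)
      have "near (edge_rel E) a b" using Cons Cons.prems by (simp add: near_def)
      moreover have "(near (edge_rel E) ^^ (length xs - 1)) b (last xs)"
        using Cons Cons.IH Cons.prems by simp
      ultimately show ?thesis using relpowp_Suc_I2[of "near (edge_rel E)" a b "length xs - 1" "last xs"] Cons by simp
    qed auto
  qed auto
  moreover assume w: "walk_betw V E x xs y" and n: "length xs - 1 \<le> n"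
  ultimately have "(near (edge_rel E) ^^ (length xs - 1)) x y" by (simp add: walk_betw_def)
  then show ?thesis using n by (rule relpowp_near_mono)
qed

lemma gdist_less_relpowp:
  assumes "gdist V E x y < enat (Suc n)"
  shows "(near (edge_rel E) ^^ n) x y"
proof -
  obtain xs where "walk_betw V E x xs y" "enat (length xs - 1) < enat (Suc n)"
    using assms unfolding gdist_def Inf_less_iff by blast
  then show ?thesis using walk_relpowp by fastforce
qed

lemma no_cross_reachable:
  assumes "reachable_in W H x y" "\<And>a b. {a, b} \<in> H \<Longrightarrow> a \<in> S \<longleftrightarrow> b \<in> S"
  shows "x \<in> S \<longleftrightarrow> y \<in> S"
proof -
  obtain xs where xs: "walk_betw W H x xs y" using assms(1) unfolding reachable_in_def by blast
  have "successively (edge_rel H) xs \<Longrightarrow> xs \<noteq> [] \<Longrightarrow> hd xs \<in> S \<longleftrightarrow> last xs \<in> S"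
  proof (induction xs)
    case (Cons a xs)
    then show ?case using assms(2)[of a "hd xs"] by (cases xs) auto
  qed auto
  then show ?thesis using xs unfolding walk_betw_def by auto
qed

section \<open>Gluing along bridges\<close>

text \<open>If no edge joins \<open>S\<close> to the rest, \<open>u\<close> and \<open>v\<close> are
  arbitrary; \<open>bridge\<close> distinguishes the two situations.\<close>

locale gluing =
  fixes V :: "'a set" and E :: "'a set set" and S :: "'a set" and u v :: 'a
  assumes graph: "simple_graph V E" and S: "S \<subseteq> V"
    and cross: "x \<in> V - S \<Longrightarrow> y \<in> S \<Longrightarrow> {x, y} \<in> E \<Longrightarrow> x = u \<and> y = v"
begin

definition E1 :: "'a set set" where "E1 = {e \<in> E. e \<subseteq> V - S}"
definition E2 :: "'a set set" where "E2 = {e \<in> E. e \<subseteq> S}"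

definition bridge :: bool where "bridge \<longleftrightarrow> {u, v} \<in> E \<and> u \<in> V - S \<and> v \<in> S"

abbreviation "N \<equiv> near (edge_rel E)"
abbreviation "N1 \<equiv> near (edge_rel E1)"
abbreviation "N2 \<equiv> near (edge_rel E2)"

lemma bridgeD: "bridge \<Longrightarrow> u \<in> V \<and> u \<notin> S \<and> v \<in> S \<and> u \<noteq> v"
  by (auto simp: bridge_def)

lemma N_cases:
  assumes "N x y" "x \<in> V"
  obtains "x \<in> V - S" "y \<in> V - S" "N1 x y" | "x \<in> S" "y \<in> S" "N2 x y"
    | "x = u" "y = v" bridge | "x = v" "y = u" bridge
proof (cases "x = y")
  case True
  then show thesis using that(1,2) assms(2) S by auto
next
  case False
  then have e: "{x, y} \<in> E" using assms(1) by (simp add: near_def)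
  then have e': "{y, x} \<in> E" by (simp add: insert_commute)
  have y: "y \<in> V" using simple_graph_edge[OF graph e] by blast
  consider "x \<in> S" "y \<in> S" | "x \<in> V - S" "y \<in> V - S" | "x \<in> V - S" "y \<in> S" | "x \<in> S" "y \<in> V - S"
    using assms(2) y by blast
  then show thesis
  proof cases
    case 1 then show ?thesis using that(2) e by (simp add: near_def E2_def)
  next
    case 2 then show ?thesis using that(1) e by (simp add: near_def E1_def)
  next
    case 3
    then have "x = u" "y = v" using cross[OF 3 e] by auto
    then show ?thesis using that(3) 3 e by (simp add: bridge_def)
  next
    case 4
    then have "y = u" "x = v" using cross[OF 4(2,1) e'] by auto
    then show ?thesis using that(4) 4 e' by (simp add: bridge_def)
  qed
qed

lemma N2_S: "N2 x y \<Longrightarrow> x \<in> S \<longleftrightarrow> y \<in> S"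
  by (auto simp: near_def E2_def)

lemma N1_sym: "N1 x y \<Longrightarrow> N1 y x" and N2_sym: "N2 x y \<Longrightarrow> N2 y x"
  by (auto simp: near_def insert_commute)

text \<open>A walk of two steps that crosses the bridge twice is back at its start and falls under
  the first two cases. The other four cases cross once, with the crossing as first or as second
  step.\<close>

lemma N_N_cases:
  assumes "N x z" "N z y" "x \<in> V"
  obtains z' where "x \<in> V - S" "y \<in> V - S" "N1 x z'" "N1 z' y"
    | z' where "x \<in> S" "y \<in> S" "z' \<in> S" "N2 x z'" "N2 z' y"
    | "x \<in> V - S" "y \<in> S" bridge "x = u" "N2 v y"
    | "x \<in> V - S" "y \<in> S" bridge "y = v" "N1 u x"
    | "x \<in> S" "y \<in> V - S" bridge "y = u" "N2 v x"
    | "x \<in> S" "y \<in> V - S" bridge "x = v" "N1 u y"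
proof -
  have z: "z \<in> V" using assms(1,3) simple_graph_edge[OF graph] by (auto simp: near_def)
  show thesis
    using assms(1,3)
  proof (cases rule: N_cases)
    case 1
    show thesis using assms(2) z
    proof (cases rule: N_cases)
      case 1 then show thesis using that(1) \<open>x \<in> V - S\<close> \<open>N1 x z\<close> by blast
    next
      case 2 then show thesis using \<open>z \<in> V - S\<close> by blast
    next
      case 3 then show thesis using that(4) \<open>x \<in> V - S\<close> \<open>N1 x z\<close> N1_sym by (auto simp: bridge_def)
    next
      case 4 then show thesis using \<open>z \<in> V - S\<close> by (auto simp: bridge_def)
    qed
  next
    case 2
    show thesis using assms(2) z
    proof (cases rule: N_cases)
      case 1 then show thesis using \<open>z \<in> S\<close> by blast
    next
      case 2 then show thesis using that(2) \<open>x \<in> S\<close> \<open>N2 x z\<close> by blast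
    next
      case 3 then show thesis using \<open>z \<in> S\<close> by (auto simp: bridge_def)
    next
      case 4 then show thesis using that(5) \<open>x \<in> S\<close> \<open>N2 x z\<close> N2_sym by (auto simp: bridge_def)
    qed
  next
    case 3
    note xz = 3
    show thesis using assms(2) z
    proof (cases rule: N_cases)
      case 1 then show thesis using xz by (auto simp: bridge_def)
    next
      case 2 then show thesis using that(3) xz by (auto simp: bridge_def)
    next
      case 3 then show thesis using xz bridgeD by metis
    next
      case 4 then show thesis using that(1)[of u] xz by (auto simp: bridge_def)
    qed
  next
    case 4
    note xz = 4
    show thesis using assms(2) z
    proof (cases rule: N_cases)
      case 1 then show thesis using that(6) xz by (auto simp: bridge_def)
    next
      case 2 then show thesis using xz by (auto simp: bridge_def)
    next
      case 3 then show thesis using that(2)[of v] xz by (auto simp: bridge_def)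
    next
      case 4 then show thesis using xz bridgeD by metis
    qed
  qed
qed

text \<open>A walk that returns over the bridge is back at \<open>u\<close>, where it had been after
  fewer steps; as \<open>near\<close> is reflexive, the excursion can be replaced by waiting at
  \<open>u\<close>. So one crossing suffices.\<close>

lemma relpowp_N_split:
  assumes "(N ^^ n) x y" "x \<in> V - S"
  shows "y \<in> V - S \<and> (N1 ^^ n) x y \<or>
    y \<in> S \<and> bridge \<and> (\<exists>a b. a + b + 1 = n \<and> (N1 ^^ b) x u \<and> (N2 ^^ a) v y)"
  using assms(1)
proof (induction n arbitrary: y)
  case 0
  then show ?case using assms(2) by auto
next
  case (Suc n)
  then obtain z where z: "(N ^^ n) x z" "N z y" by auto
  from Suc.IH[OF z(1)] show ?case
  proof
    assume A: "z \<in> V - S \<and> (N1 ^^ n) x z"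
    then have zV: "z \<in> V" by blast
    from z(2) zV show ?case
    proof (cases rule: N_cases)
      case 1 then show ?thesis using A by auto
    next
      case 2 then show ?thesis using A by blast
    next
      case 3
      then have "0 + n + 1 = Suc n \<and> (N1 ^^ n) x u \<and> (N2 ^^ 0) v y" using A by simp
      then show ?thesis using 3 unfolding bridge_def by blast
    next
      case 4 then show ?thesis using A by (auto simp: bridge_def)
    qed
  next
    assume A: "z \<in> S \<and> bridge \<and> (\<exists>a b. a + b + 1 = n \<and> (N1 ^^ b) x u \<and> (N2 ^^ a) v z)"
    then obtain a b where ab: "a + b + 1 = n" "(N1 ^^ b) x u" "(N2 ^^ a) v z" by blast
    have zV: "z \<in> V" using A S by blast
    from z(2) zV show ?case
    proof (cases rule: N_cases)
      case 1 then show ?thesis using A by blast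
    next
      case 2
      then have "Suc a + b + 1 = Suc n \<and> (N1 ^^ b) x u \<and> (N2 ^^ Suc a) v y" using ab by auto
      then show ?thesis using 2 A by blast
    next
      case 3 then show ?thesis using A by (auto simp: bridge_def)
    next
      case 4
      then have "(N1 ^^ Suc n) x y" using relpowp_near_mono[OF ab(2), of "Suc n"] ab(1) by simp
      then show ?thesis using 4 by (auto simp: bridge_def)
    qed
  qed
qed

text \<open>\<open>{u, v}\<close> is the only edge between the two sides, so \<open>u\<close> would
  separate \<open>x\<close> from \<open>s\<close> if \<open>x\<close> were not \<open>u\<close>, and
  \<open>v\<close> would do so if \<open>s\<close> were not \<open>v\<close>. Hence (A) across the
  bridge concerns only its two ends, whose colors differ.\<close>

lemma nonseparable_cross:
  assumes W: "subgraph W H V E" "nonseparable W H" and x: "x \<in> W - S" and s: "s \<in> W \<inter> S"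
  shows "bridge \<and> x = u \<and> s = v"
proof -
  have HE: "H \<subseteq> E" and WV: "W \<subseteq> V" and WH: "simple_graph W H" using W(1) by (auto simp: subgraph_def)
  have cr: "bridge \<and> e = {u, v}" if "e \<in> H" "e = {a, b}" "a \<in> S" "b \<notin> S" for e a b
  proof -
    have e: "{b, a} \<in> E" using that HE by (auto simp: insert_commute)
    then have "b = u \<and> a = v" using cross[of b a] simple_graph_edge[OF graph e] that by blast
    then show ?thesis using that e simple_graph_edge[OF graph e] by (auto simp: bridge_def insert_commute)
  qed
  have reach: "reachable_in W H x s" using W(2) x s by (auto simp: nonseparable_def connected_graph_def)
  have no: "a \<in> S \<longleftrightarrow> b \<in> S" if ab: "{a, b} \<in> H" "{a, b} \<noteq> {u, v}" for a b
    using cr[OF ab(1), of a b] cr[OF ab(1), of b a] ab(2) by (metis insert_commute)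
  have uv: "{u, v} \<in> H"
  proof (rule ccontr)
    assume "{u, v} \<notin> H"
    then have "x \<in> S \<longleftrightarrow> s \<in> S" using no_cross_reachable[OF reach] no by metis
    then show False using x s by blast
  qed
  have br: "bridge"
  proof (rule ccontr)
    assume "\<not> bridge"
    then have "a \<in> S \<longleftrightarrow> b \<in> S" if ab: "{a, b} \<in> H" for a b
      using cr[OF ab, of a b] cr[OF ab, of b a] by (metis insert_commute)
    then have "x \<in> S \<longleftrightarrow> s \<in> S" by (rule no_cross_reachable[OF reach])
    then show False using x s by blast
  qed
  have uvW: "u \<in> W" "v \<in> W" using simple_graph_edge[OF WH uv] by auto
  have sep: "\<not> reachable_in (W - {c}) {e \<in> H. c \<notin> e} x s" if "c \<in> {u, v}" for c
  proof
    assume "reachable_in (W - {c}) {e \<in> H. c \<notin> e} x s"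
    then have "x \<in> S \<longleftrightarrow> s \<in> S"
      by (rule no_cross_reachable) (use no that in auto)
    then show False using x s by blast
  qed
  have "x = u"
  proof (rule ccontr)
    assume "x \<noteq> u"
    moreover have "s \<noteq> u" using s br by (auto simp: bridge_def)
    ultimately have "cut_vertex W H u" using sep[of u] reach x s uvW unfolding cut_vertex_def by blast
    then show False using W(2) by (auto simp: nonseparable_def)
  qed
  moreover have "s = v"
  proof (rule ccontr)
    assume "s \<noteq> v"
    moreover have "x \<noteq> v" using x br by (auto simp: bridge_def)
    ultimately have "cut_vertex W H v" using sep[of v] reach x s uvW unfolding cut_vertex_def by blast
    then show False using W(2) by (auto simp: nonseparable_def)
  qed
  ultimately show ?thesis using br by blast
qed

lemma vdegree_mono: "D \<subseteq> E \<Longrightarrow> vdegree D y \<le> vdegree E y"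
  unfolding vdegree_def
  by (rule card_mono) (use simple_graph_finite_edges[OF graph] in auto)

lemma vdegree_bridge:
  assumes bridge
  shows "vdegree E1 u < vdegree E u" "vdegree E2 v < vdegree E v"
proof -
  have uv: "{u, v} \<in> E" "{u, v} \<notin> E1" "{u, v} \<notin> E2"
    using assms by (auto simp: bridge_def E1_def E2_def)
  have "E1 \<subseteq> E" "E2 \<subseteq> E" by (auto simp: E1_def E2_def)
  then have "{e \<in> E1. u \<in> e} \<subset> {e \<in> E. u \<in> e}" "{e \<in> E2. v \<in> e} \<subset> {e \<in> E. v \<in> e}"
    using uv by blast+
  moreover have "finite {e \<in> E. w \<in> e}" for w using simple_graph_finite_edges[OF graph] by simp
  ultimately show "vdegree E1 u < vdegree E u" "vdegree E2 v < vdegree E v"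
    unfolding vdegree_def by (auto intro: psubset_card_mono)
qed

text \<open>The three cases correspond to the color of the attachment vertex \<open>u\<close> being 1, 2 or 4.\<close>

lemma glue:
  assumes f: "admissible (V - S) E1 f" and g: "good (edge_rel E2) {y \<in> S. vdegree E y \<le> 2} S g"
    and cases: "bridge \<Longrightarrow>
      (f u \<in> {Color1a, Color1b} \<and> g v \<in> {Color1a, Color1b} \<and> f u \<noteq> g v \<and>
        (\<forall>z\<in>S. \<forall>w\<in>S. N2 v z \<longrightarrow> N2 z w \<longrightarrow> g w \<noteq> Color4)) \<or>
      (f u = Color2 \<and> vdegree E1 u = 2 \<and> g v \<in> {Color1a, Color1b} \<and>
        (\<forall>w\<in>S. {v, w} \<in> E2 \<longrightarrow> g w \<noteq> Color2)) \<or>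
      (f u = Color4 \<and> (\<forall>y. {u, y} \<in> E1 \<longrightarrow> f y \<noteq> Color2) \<and> (\<forall>w\<in>S. g w \<noteq> Color4) \<and>
        (g v = Color2 \<and> \<not> vdegree E v \<le> 2 \<or>
         g v \<in> {Color1a, Color1b} \<and> (\<forall>w\<in>S. {v, w} \<in> E2 \<longrightarrow> g w = Color2 \<longrightarrow> \<not> vdegree E w \<le> 2)))"
  shows "admissible V E (\<lambda>x. if x \<in> S then g x else f x)"
proof -
  let ?h = "\<lambda>x. if x \<in> S then g x else f x"
  have hf: "?h x = f x" if "x \<in> V - S" for x using that by simp
  have hg: "?h x = g x" if "x \<in> S" for x using that by simp
  have br: "u \<in> V - S" "v \<in> S" if bridge using that by (auto simp: bridge_def)
  have "f u \<noteq> g v" if bridge using cases[OF that] by auto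
  then have uv: "?h u \<noteq> ?h v" if bridge using that br by simp
  have proper: "?h x \<noteq> ?h y" if e: "{x, y} \<in> E" for x y
  proof -
    have xy: "x \<in> V" "x \<noteq> y" using simple_graph_edge[OF graph e] by auto
    have "N x y" using e by (simp add: near_def)
    from this xy(1) show ?thesis
    proof (cases rule: N_cases)
      case 1
      then show ?thesis using admissible_proper[OF f, of x y] xy(2) unfolding near_def by simp
    next
      case 2
      then show ?thesis using g xy(2) unfolding good_def near_def by simp
    qed (use uv in force)+
  qed
  have f2: "f x = Color2 \<Longrightarrow> x = y" "f x = Color4 \<Longrightarrow> \<not> vdegree E1 y \<le> 2"
    if "x \<in> V - S" "y \<in> V - S" "N1 x z" "N1 z y" "f y = Color2" for x y z
    using admissible_near[OF f that] by blast+
  have g2: "(g x = Color2 \<longrightarrow> x = y) \<and> (g x = Color4 \<longrightarrow> \<not> vdegree E y \<le> 2)"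
    if "x \<in> S" "y \<in> S" "z \<in> S" "N2 x z" "N2 z y" "g y = Color2" for x y z
    using g that unfolding good_def by blast
  have near2: "(?h x = Color2 \<longrightarrow> x = y) \<and> (?h x = Color4 \<longrightarrow> \<not> vdegree E y \<le> 2)"
    if xy: "x \<in> V" "N x z" "N z y" "?h y = Color2" for x y z
    using xy(2,3,1)
  proof (cases rule: N_N_cases)
    case (1 z')
    have "E1 \<subseteq> E" by (auto simp: E1_def)
    then show ?thesis using f2[OF 1] xy(4) hf 1(1,2) vdegree_mono[of E1 y] by auto
  next
    case (2 z')
    then show ?thesis using g2[of x y z'] xy(4) by simp
  next
    case 3
    have "g v = Color2 \<Longrightarrow> v = y"
      using g2[of v y v] 3 br xy(4) by simp
    then show ?thesis using cases[OF 3(3)] 3 xy(4) by (auto simp: near_def)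
  next
    case 4
    have "f x = Color4 \<Longrightarrow> f u = Color2 \<Longrightarrow> vdegree E1 u = 2 \<Longrightarrow> False"
      using f2(2)[of x u u] 4 N1_sym br by auto
    then show ?thesis using cases[OF 4(3)] 4 xy(4) by (auto simp: near_def)
  next
    case 5
    \<comment> \<open>The bridge raises the degree of \<open>u\<close> to three, so (B) permits a
      color 4 in \<open>S\<close> within distance two of a color 2 at \<open>u\<close>.\<close>
    have "\<not> vdegree E u \<le> 2" if "vdegree E1 u = 2"
      using vdegree_bridge(1)[OF 5(3)] that by simp
    then show ?thesis using cases[OF 5(3)] 5 xy(4) by (auto simp: near_def)
  next
    case 6
    show ?thesis using cases[OF 6(3)] 6 xy(4) by (auto simp: near_def)
  qed
  have far0: False
    if x: "x \<in> V - S" "y \<in> S" "f x = Color4" "g y = Color4" "(N ^^ 4) x y" for x y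
  proof -
    from relpowp_N_split[OF x(5,1)] x(2) obtain a b where B: bridge
      and ab: "a + b + 1 = 4" "(N1 ^^ b) x u" "(N2 ^^ a) v y" by blast
    from cases[OF B] show False
    proof (elim disjE conjE)
      assume c: "f u \<in> {Color1a, Color1b}" "\<forall>z\<in>S. \<forall>w\<in>S. N2 v z \<longrightarrow> N2 z w \<longrightarrow> g w \<noteq> Color4"
      \<comment> \<open>At least one step before \<open>u\<close> and one over the bridge leave at
        most two inside \<open>S\<close>, too few to reach a color 4 from \<open>v\<close>.\<close>
      have "x \<noteq> u" using x(3) c(1) by auto
      then have "b \<noteq> 0" using ab(2) by (cases b) auto
      then have "a \<le> 2" using ab(1) by simp
      then have "(N2 ^^ 2) v y" by (rule relpowp_near_mono[OF ab(3)])
      then obtain z where "N2 v z" "N2 z y" unfolding relpowp_near_2 by blast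
      then show False using c(2) x(2,4) N2_S[of z y] by blast
    next
      assume c: "f u = Color2" "vdegree E1 u = 2" "g v \<in> {Color1a, Color1b}"
      \<comment> \<open>At least one step is spent inside \<open>S\<close>, so \<open>x\<close> is
        within distance two of \<open>u\<close>; there (B), applied in the rest where
        \<open>u\<close> has degree two, forbids color 4.\<close>
      have "y \<noteq> v" using x(4) c(3) by auto
      then have "a \<noteq> 0" using ab(3) by (cases a) auto
      then have "b \<le> 2" using ab(1) by simp
      then have "(N1 ^^ 2) x u" by (rule relpowp_near_mono[OF ab(2)])
      then obtain z where "N1 x z" "N1 z u" unfolding relpowp_near_2 by blast
      then show False using f2(2)[of x u z] x br(1)[OF B] c by auto
    qed (use x in auto)
  qed
  have symE: "symp (edge_rel E)" by (auto simp: symp_def insert_commute)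
  have far: "x = y" if xy: "x \<in> V" "y \<in> V" "?h x = Color4" "?h y = Color4" "(N ^^ 4) x y" for x y
  proof -
    consider "x \<in> V - S" "y \<in> V - S" | "x \<in> S" "y \<in> S" | "x \<in> V - S" "y \<in> S" | "x \<in> S" "y \<in> V - S"
      using xy by blast
    then show ?thesis
    proof cases
      case 1
      then have "(N1 ^^ 4) x y" using relpowp_N_split[OF xy(5)] by blast
      then show ?thesis using admissible_far[OF f 1] 1 xy(3,4) by simp
    next
      case 2 then show ?thesis using g xy(3,4) unfolding good_def by simp
    next
      case 3 then show ?thesis using far0[of x y] xy by simp
    next
      case 4
      then show ?thesis using far0[of y x] relpowp_near_sym[OF symE xy(5)] xy by simp
    qed
  qed
  have blocks: "x = y" if W: "subgraph W H V E" "nonseparable W H"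
    and xy: "x \<in> W" "y \<in> W" "?h x = Color4" "?h y = Color4" for W H x y
  proof (rule ccontr)
    assume ne: "x \<noteq> y"
    have WV: "W \<subseteq> V" using W(1) by (simp add: subgraph_def)
    show False
    proof (cases "W \<inter> S = {}")
      case True
      then have "subgraph W H (V - S) E1"
        using W(1) unfolding subgraph_def simple_graph_def E1_def by blast
      have "x \<notin> S" "y \<notin> S" using True xy by blast+
      with admissible_block[OF f \<open>subgraph W H (V - S) E1\<close> W(2) xy(1,2)] show False
        using xy(3,4) ne by simp
    next
      case False
      then obtain s where s: "s \<in> W \<inter> S" by blast
      show False
      proof (cases "x \<in> S")
        case xS: True
        show False
        proof (cases "y \<in> S")
          case True then show False using xS g xy ne unfolding good_def by simp
        next
          case False
          then have b: bridge and yx: "y = u" "x = v" using nonseparable_cross[OF W, of y x] xy xS by blast+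
          show False using uv[OF b] xy(3,4) unfolding yx by simp
        qed
      next
        case xS: False
        show False
        proof (cases "y \<in> S")
          case True
          then have b: bridge and yx: "x = u" "y = v" using nonseparable_cross[OF W, of x y] xy xS by blast+
          show False using uv[OF b] xy(3,4) unfolding yx by simp
        next
          case False
          then show False using nonseparable_cross[OF W _ s, of x] nonseparable_cross[OF W _ s, of y] xS xy ne by blast
        qed
      qed
    qed
  qed
  show ?thesis
    unfolding admissible_def
    by (intro conjI allI ballI impI)
      (use proper near2 in simp, (use near2 in blast)+, (rule far; assumption), (rule blocks; assumption))
qed

end

section \<open>Minimal cuts and the induction\<close>

lemma edge_cut_subset: "edge_cut E K \<subseteq> E"
  by (auto simp: edge_cut_def)

text \<open>A nonempty vertex set of least size among those with at most one outgoing edge induces a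
  bridgeless graph: one of the two sides of a smaller cut would be left by at most one edge as well.\<close>

lemma minimal_cut_bridgeless:
  assumes graph: "simple_graph V E" and S: "S \<subseteq> V" "card (edge_cut E S) \<le> 1"
    and min: "\<And>K. K \<noteq> {} \<Longrightarrow> K \<subset> S \<Longrightarrow> 2 \<le> card (edge_cut E K)"
  shows "bridgeless S {e \<in> E. e \<subseteq> S}"
  unfolding bridgeless_def
proof (intro allI impI)
  let ?F = "{e \<in> E. e \<subseteq> S}"
  fix K assume K: "K \<noteq> {}" "K \<subset> S"
  have fin: "finite (edge_cut D L)" if "D \<subseteq> E" for D L
    using finite_subset[OF edge_cut_subset] finite_subset[OF that] simple_graph_finite_edges[OF graph] by blast
  have sub: "edge_cut E L \<subseteq> edge_cut ?F L \<union> {e \<in> edge_cut E S. e \<inter> L \<noteq> {}}" if "L \<subseteq> S" for L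
    using that unfolding edge_cut_def by blast
  have comp: "edge_cut ?F (S - K) = edge_cut ?F K" using K(2) unfolding edge_cut_def by blast
  \<comment> \<open>At most one edge leaves \<open>S\<close>, and it has just one end in
    \<open>S\<close>, so it touches only one of \<open>K\<close> and \<open>S - K\<close>.\<close>
  have "(\<forall>e\<in>edge_cut E S. e \<inter> K = {}) \<or> (\<forall>e\<in>edge_cut E S. e \<inter> (S - K) = {})"
  proof (rule ccontr)
    assume "\<not> ?thesis"
    then obtain e e' where e: "e \<in> edge_cut E S" "e' \<in> edge_cut E S" "e \<inter> K \<noteq> {}" "e' \<inter> (S - K) \<noteq> {}" by blast
    have "e' = e"
      using e(1,2) S(2) fin[of E S] card_le_Suc0_iff_eq[of "edge_cut E S"] by auto
    moreover have "e \<in> E" using e(1) edge_cut_subset by blast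
    then obtain x y where "e = {x, y}" by (rule simple_graph_edgeE[OF graph])
    ultimately show False using e K(2) unfolding edge_cut_def by auto
  qed
  then show "2 \<le> card (edge_cut ?F K)"
  proof
    assume "\<forall>e\<in>edge_cut E S. e \<inter> K = {}"
    then have "edge_cut E K \<subseteq> edge_cut ?F K" using sub[of K] K(2) by blast
    then have "card (edge_cut E K) \<le> card (edge_cut ?F K)" by (rule card_mono[OF fin, rotated]) auto
    then show ?thesis using min[OF K] by simp
  next
    assume "\<forall>e\<in>edge_cut E S. e \<inter> (S - K) = {}"
    then have "edge_cut E (S - K) \<subseteq> edge_cut ?F (S - K)" using sub[of "S - K"] by blast
    then have "edge_cut E (S - K) \<subseteq> edge_cut ?F K" using comp by simp
    then have "card (edge_cut E (S - K)) \<le> card (edge_cut ?F K)" by (rule card_mono[OF fin, rotated]) auto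
    moreover have "S - K \<noteq> {}" "S - K \<subset> S" using K by blast+
    ultimately show ?thesis using min[of "S - K"] by simp
  qed
qed

text \<open>Provides a root when no edge leaves the piece.\<close>

lemma bridgeless_small_degree:
  assumes "simple_graph S F" "bridgeless S F" "theta_free F" "K4_free F" "S \<noteq> {}"
    and deg: "\<And>y. y \<in> S \<Longrightarrow> vdegree F y \<le> 3"
  shows "\<exists>v\<in>S. vdegree F v \<le> 2"
proof -
  obtain x where x: "x \<in> S" using assms(5) by blast
  show ?thesis
  proof (cases "S = {x}")
    case True
    have "vdegree F x \<le> card ({} :: 'a set)"
    proof (rule vdegree_le_card_nbrs[OF assms(1)])
      fix y assume "{x, y} \<in> F"
      from simple_graph_edge[OF assms(1) this] True show "y \<in> {}" by blast
    qed simp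
    then show ?thesis using x by (intro bexI[of _ x]) auto
  next
    case False
    then obtain y where y: "y \<in> S" "x \<noteq> y" using x by blast
    then obtain C where "cycle F C" "set C = S"
      using hamiltonian_cycle[OF assms(1,2) x y deg assms(3)] by blast
    then interpret chorded_cycle S F C
      using assms by unfold_locales auto
    show ?thesis by (rule ex_small_degree)
  qed
qed

theorem ex_admissible:
  assumes "simple_graph V E" "\<And>y. y \<in> V \<Longrightarrow> vdegree E y \<le> 3" "theta_free E" "K4_free E"
  shows "\<exists>f. admissible V E f"
  using assms
proof (induction "card V" arbitrary: V E rule: less_induct)
  case less
  note graph = less.prems(1) and deg = less.prems(2) and free = less.prems(3,4)
  have finV: "finite V" and finE: "finite E"
    using graph simple_graph_finite_edges by (auto simp: simple_graph_def)
  show ?case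
  proof (cases "V = {}")
    case True
    then have "E = {}" using graph by (auto simp: simple_graph_def)
    then have "admissible V E (\<lambda>_. Color1a)" using True by (auto simp: admissible_def)
    then show ?thesis by blast
  next
    case False
    define P where "P = (\<lambda>S. S \<noteq> {} \<and> S \<subseteq> V \<and> card (edge_cut E S) \<le> 1)"
    have "edge_cut E V = {}" using graph by (auto simp: edge_cut_def simple_graph_def)
    then have "P V" using False by (simp add: P_def)
    then obtain S where PS: "P S" and min: "\<And>T. P T \<Longrightarrow> card S \<le> card T"
      using ex_has_least_nat[of P V card] by blast
    have S: "S \<noteq> {}" "S \<subseteq> V" "card (edge_cut E S) \<le> 1" using PS by (auto simp: P_def)
    have finS: "finite S" using S finV finite_subset by blast
    let ?F = "{e \<in> E. e \<subseteq> S}" and ?E1 = "{e \<in> E. e \<subseteq> V - S}"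
    have bl: "bridgeless S ?F"
    proof (rule minimal_cut_bridgeless[OF graph S(2,3)])
      fix K assume K: "K \<noteq> {}" "K \<subset> S"
      then have "\<not> P K" using min[of K] psubset_card_mono[OF finS K(2)] by auto
      then show "2 \<le> card (edge_cut E K)" using K S unfolding P_def by auto
    qed
    have gF: "simple_graph S ?F" and gE1: "simple_graph (V - S) ?E1"
      using graph finS unfolding simple_graph_def by auto
    have vm: "vdegree D y \<le> vdegree E y" if "D \<subseteq> E" for D y
      unfolding vdegree_def by (rule card_mono) (use that finE in auto)
    have degF: "vdegree ?F y \<le> 3" if "y \<in> S" for y
      using vm[of ?F y] deg[of y] that S by fastforce
    have degE1: "vdegree ?E1 y \<le> 3" if "y \<in> V - S" for y
      using vm[of ?E1 y] deg[of y] that by fastforce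
    have freeF: "theta_free ?F" "K4_free ?F" and freeE1: "theta_free ?E1" "K4_free ?E1"
      using free theta_free_mono[of E] K4_free_mono[of E] by auto
    have "V - S \<subset> V" using S by blast
    then have "card (V - S) < card V" by (rule psubset_card_mono[OF finV])
    from less.hyps[OF this gE1 degE1 freeE1] obtain f0 where f0: "admissible (V - S) ?E1 f0" by blast
    \<comment> \<open>Degrees are taken in \<open>E\<close>, not in \<open>?F\<close>, because (B)
      has to hold in the glued graph.\<close>
    define U where "U = {y \<in> S. vdegree E y \<le> 2}"
    have U: "vdegree ?F y \<le> 2" if "y \<in> U" for y
      using vm[of ?F y] that by (auto simp: U_def)
    show ?thesis
    proof (cases "edge_cut E S = {}")
      case True
      obtain v where v: "v \<in> S" "vdegree ?F v \<le> 2"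
        using bridgeless_small_degree[OF gF bl freeF S(1) degF] by blast
      have nc: "\<not> (x \<in> V - S \<and> y \<in> S)" if "{x, y} \<in> E" for x y
        using True that unfolding edge_cut_def by blast
      interpret gluing V E S v v
        using graph S nc by unfold_locales auto
      \<comment> \<open>With nothing to attach to, any of the root colorings will do.\<close>
      obtain g where g: "good (edge_rel ?F) U S g"
        using bridgeless_root_colorings(1)[OF gF bl freeF degF v U, where c = Color1a] by blast
      have "admissible V E (\<lambda>x. if x \<in> S then g x else f0 x)"
        by (rule glue) (use f0 g v in \<open>auto simp: E1_def E2_def U_def bridge_def\<close>)
      then show ?thesis by blast
    next
      case False
      then obtain e where e: "e \<in> edge_cut E S" by blast
      have one: "e' = e" if "e' \<in> edge_cut E S" for e'
        using that e S(3) finite_subset[OF edge_cut_subset finE] card_le_Suc0_iff_eq[of "edge_cut E S"] by auto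
      obtain u v where uv: "{u, v} \<in> E" "u \<in> V - S" "v \<in> S" and euv: "e = {u, v}"
      proof -
        have "e \<in> E" using e edge_cut_subset by blast
        then obtain x y where xy: "e = {x, y}" "x \<in> V" "y \<in> V" by (rule simple_graph_edgeE[OF graph])
        show thesis using that[of x y] that[of y x] xy e unfolding edge_cut_def by (auto simp: insert_commute)
      qed
      have cr: "x = u \<and> y = v" if "x \<in> V - S" "y \<in> S" "{x, y} \<in> E" for x y
      proof -
        have "{x, y} \<in> edge_cut E S" using that unfolding edge_cut_def by auto
        then have "{x, y} = {u, v}" using one euv by blast
        then show ?thesis using that uv by (auto simp: doubleton_eq_iff)
      qed
      interpret gluing V E S u v
        using graph S cr by unfold_locales auto
      have E12: "E1 = ?E1" "E2 = ?F" by (simp_all add: E1_def E2_def)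
      have br: bridge using uv by (simp add: bridge_def)
      have du: "vdegree ?E1 u \<le> 2" and dv: "vdegree ?F v \<le> 2"
        using vdegree_bridge[OF br] deg[of u] deg[of v] uv S unfolding E12 by auto
      note R = bridgeless_root_colorings[OF gF bl freeF degF uv(3) dv U]
      have glue': "\<exists>f. admissible V E f"
        if "admissible (V - S) E1 f" "good (edge_rel ?F) U S g"
        "(f u \<in> {Color1a, Color1b} \<and> g v \<in> {Color1a, Color1b} \<and> f u \<noteq> g v \<and>
        (\<forall>z\<in>S. \<forall>w\<in>S. N2 v z \<longrightarrow> N2 z w \<longrightarrow> g w \<noteq> Color4)) \<or>
      (f u = Color2 \<and> vdegree E1 u = 2 \<and> g v \<in> {Color1a, Color1b} \<and>
        (\<forall>w\<in>S. {v, w} \<in> E2 \<longrightarrow> g w \<noteq> Color2)) \<or>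
      (f u = Color4 \<and> (\<forall>y. {u, y} \<in> E1 \<longrightarrow> f y \<noteq> Color2) \<and> (\<forall>w\<in>S. g w \<noteq> Color4) \<and>
        (g v = Color2 \<and> \<not> vdegree E v \<le> 2 \<or>
         g v \<in> {Color1a, Color1b} \<and> (\<forall>w\<in>S. {v, w} \<in> E2 \<longrightarrow> g w = Color2 \<longrightarrow> \<not> vdegree E w \<le> 2)))" for f g
        using glue[of f g] that unfolding U_def E12(2) by blast
      from f0 gE1 du show ?thesis
      proof (rule admissible_normalize)
        fix h assume h: "admissible (V - S) ?E1 h" "h u \<in> {Color1a, Color1b}"
        define c where "c = (if h u = Color1a then Color1b else Color1a)"
        have c: "c \<in> {Color1a, Color1b}" "h u \<noteq> c" using h(2) by (auto simp: c_def)
        from R(1)[OF _ _ c(1)] obtain g where g: "good (edge_rel ?F) U S g" "g v = c"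
          "\<forall>z\<in>S. \<forall>w\<in>S. near (edge_rel ?F) v z \<longrightarrow> near (edge_rel ?F) z w \<longrightarrow> g w \<noteq> Color4" by blast
        show ?thesis
          by (rule glue'[OF _ g(1), of h]) (use h c g E12 in auto)
      next
        fix h assume h: "admissible (V - S) ?E1 h" "vdegree ?E1 u = 2"
          "\<And>y. {u, y} \<in> ?E1 \<Longrightarrow> h y \<in> {Color1a, Color1b}"
        have n2: "\<forall>y. {u, y} \<in> E1 \<longrightarrow> h y \<noteq> Color2" using h(3) E12 by fastforce
        consider "h u \<in> {Color1a, Color1b}" | "h u = Color2" | "h u = Color4" by (cases "h u") auto
        then show ?thesis
        proof cases
          case 1
          define c where "c = (if h u = Color1a then Color1b else Color1a)"
          have c: "c \<in> {Color1a, Color1b}" "h u \<noteq> c" using 1 by (auto simp: c_def)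
          from R(1)[OF _ _ c(1)] obtain g where g: "good (edge_rel ?F) U S g" "g v = c"
            "\<forall>z\<in>S. \<forall>w\<in>S. near (edge_rel ?F) v z \<longrightarrow> near (edge_rel ?F) z w \<longrightarrow> g w \<noteq> Color4" by blast
          show ?thesis
            by (rule glue'[OF _ g(1), of h]) (use h 1 c g E12 in auto)
        next
          case 2
          from R(3) obtain g where g: "good (edge_rel ?F) U S g" "g v = Color1a"
            "\<forall>w\<in>S. {v, w} \<in> ?F \<longrightarrow> g w \<noteq> Color2" by blast
          show ?thesis
            by (rule glue'[OF _ g(1), of h]) (use h 2 g E12 in auto)
        next
          case 3
          from R(2) obtain g where g: "good (edge_rel ?F) U S g" "\<forall>w\<in>S. g w \<noteq> Color4"
            "g v = Color2 \<and> S \<noteq> {v} \<or> g v = Color1a \<and> (\<forall>w\<in>S. {v, w} \<in> ?F \<longrightarrow> g w = Color2 \<longrightarrow> w \<notin> U)" by blast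
          \<comment> \<open>At least two edges of the piece at \<open>v\<close> and the bridge add
            up to degree three, so (B) does not restrict a color 2 at \<open>v\<close>.\<close>
          have d3: "\<not> vdegree E v \<le> 2" if "S \<noteq> {v}"
          proof -
            have "{v} \<subset> S" using that uv(3) by blast
            then have "2 \<le> card (edge_cut ?F {v})" by (intro bridgelessD[OF bl]) auto
            also have "\<dots> \<le> vdegree ?F v"
              unfolding vdegree_def by (rule card_mono) (use finE in \<open>auto simp: edge_cut_def\<close>)
            finally show ?thesis using vdegree_bridge(2)[OF br] unfolding E12 by simp
          qed
          show ?thesis
            by (rule glue'[OF _ g(1), of h]) (use h 3 n2 g(2,3) d3 E12 in \<open>auto simp: U_def\<close>)
        qed
      qed
    qed
  qed
qed

theorem theorem7:
  fixes V :: "'a set" and E :: "'a set set"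
  assumes "simple_graph V E" and "subcubic V E" and "outerplanar V E"
  shows "\<exists>f :: 'a \<Rightarrow> color. packing_coloring V E seq1124 f \<and>
     (\<forall>W F. block V E W F \<longrightarrow> card {v \<in> W. f v = Color4} \<le> 1) \<and>
     (\<forall>v\<in>V. vdegree E v \<le> 2 \<and> f v = Color2 \<longrightarrow>
        \<not> (\<exists>w\<in>V. f w = Color4 \<and> gdist V E v w \<le> 2))"
proof -
  obtain f where f: "admissible V E f"
    using ex_admissible[OF assms(1) _ outerplanar_free[OF assms(1,3)]] assms(2)
    unfolding subcubic_def by blast
  let ?N = "near (edge_rel E)"
  have proper: "{x, y} \<in> E \<Longrightarrow> f x \<noteq> f y" for x y by (rule admissible_proper[OF f])
  have two: "(f x = Color2 \<longrightarrow> x = y) \<and> (f x = Color4 \<longrightarrow> \<not> vdegree E y \<le> 2)"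
    if "x \<in> V" "y \<in> V" "(?N ^^ 2) x y" "f y = Color2" for x y
  proof -
    obtain z where z: "?N x z" "?N z y" using \<open>(?N ^^ 2) x y\<close> unfolding relpowp_near_2 by blast
    show ?thesis by (rule admissible_near[OF f that(1,2) z that(4)])
  qed
  have four: "x = y" if "x \<in> V" "y \<in> V" "f x = Color4" "f y = Color4" "(?N ^^ 4) x y" for x y
    by (rule admissible_far[OF f that])
  have "gdist V E x y \<ge> enat (seq1124 (f x) + 1)"
    if xy: "x \<in> V" "y \<in> V" "x \<noteq> y" "f x = f y" for x y
  proof (rule ccontr)
    assume "\<not> ?thesis"
    then have n: "(?N ^^ seq1124 (f x)) x y" by (intro gdist_less_relpowp[of V]) simp
    have "f x \<noteq> Color1a \<and> f x \<noteq> Color1b"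
    proof (rule ccontr)
      assume "\<not> ?thesis"
      then have "(?N ^^ 1) x y" using n by auto
      then have "?N x y" by (simp add: eq_OO)
      then show False using proper[of x y] xy(3,4) by (auto simp: near_def)
    qed
    then show False using two[of x y] four[of x y] xy n by (cases "f x") auto
  qed
  then have "packing_coloring V E seq1124 f" unfolding packing_coloring_def by blast
  moreover have "card {v \<in> W. f v = Color4} \<le> 1" if B: "block V E W F" for W F
  proof -
    let ?W4 = "{v \<in> W. f v = Color4}"
    have B': "subgraph W F V E" "nonseparable W F" using B by (auto simp: block_def)
    then have "finite W" by (auto simp: subgraph_def simple_graph_def)
    then have fin: "finite ?W4" by simp
    have "\<forall>x\<in>?W4. \<forall>y\<in>?W4. x = y" using admissible_block[OF f B'] by blast
    then show ?thesis using card_le_Suc0_iff_eq[OF fin] by simp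
  qed
  moreover have "\<not> (\<exists>w\<in>V. f w = Color4 \<and> gdist V E v w \<le> 2)"
    if v: "v \<in> V" "vdegree E v \<le> 2" "f v = Color2" for v
  proof
    assume "\<exists>w\<in>V. f w = Color4 \<and> gdist V E v w \<le> 2"
    then obtain w where w: "w \<in> V" "f w = Color4" "gdist V E v w \<le> 2" by blast
    have "(2::enat) < enat (Suc 2)" by (simp add: numeral_eq_enat)
    then have "gdist V E v w < enat (Suc 2)" using w(3) by (rule le_less_trans[rotated])
    then have n: "(?N ^^ 2) v w" by (rule gdist_less_relpowp)
    have "symp (edge_rel E)" by (auto simp: symp_def insert_commute)
    \<comment> \<open>\<open>admissible\<close> records (B) with the vertex of color 4 as starting
      point, hence the reversal.\<close>
    from two[OF w(1) v(1) relpowp_near_sym[OF this n] v(3)] show False using v(2) w(2) by simp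
  qed
  ultimately show ?thesis by blast
qed

end
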